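(* Let $(\mathcal A,\varphi)$ be a tracial C$^*$-probability space and let $X=\{x_r\}_{r\in\Lambda}\subset\mathcal A$ be a family whose joint $*$-distribution is invariant under free complexification and which satisfies one of the following: (a) the joint $*$-distribution of $X$ is $H^+$-invariant; or (b) $\Lambda=[n]\times[n]$ for some $n\in\mathbb N$, so that $X=\{x_{rs}\}_{1\le r,s\le n}$ is an $n\times n$ array, and the joint $*$-distribution of $X$ is $H_n^+$-bi-invariant. Let $\mathcal B\subseteq\mathcal A$ be the norm-closed, non-self-adjoint, unital operator algebra generated by $X$. Then $\mathcal B$ has the metric approximation property.
   Context: $[k]=\{1,\dots,k\}$ and $\mathbb N=\{1,2,\dots\}$. A Banach space $Y$ has the metric approximation property if there is a net $\{S_\alpha\}$ of finite rank contractions in $B(Y)$ with $\lim_\alpha\|S_\alpha y-y\|=0$ for all $y\in Y$. The algebra $\mathcal B$ is the norm closure in $\mathcal A$ of the unital algebra generated by $X$ (without adjoints). A tracial C$^*$-probability space $(\mathcal A,\varphi)$ is a unital C$^*$-algebra $\mathcal A$ with a faithful tracial state $\varphi$. The joint $*$-distribution of a family is the collection of all its $*$-moments with respect to $\varphi$. Hyperoctahedral quantum group: $A_H(n)$ is the universal unital C$^*$-algebra generated by self-adjoint elements $u_{rs}$ ($1\le r,s\le n$) such that $U=[u_{rs}]$ is unitary in $M_n(A_H(n))$ and $u_{ij}u_{ik}=u_{ji}u_{ki}=0$ for all $i$ and all $j\ne k$; $H_n^+=(A_H(n),U)$. An $n$-tuple $(y_1,\dots,y_n)$ in $\mathcal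 A$ has an $H_n^+$-invariant joint $*$-distribution if for all $k\in\mathbb N$, $i:[k]\to[n]$, $\epsilon:[k]\to\{1,*\}$, $$\varphi\big(y_{i(1)}^{\epsilon(1)}\cdots y_{i(k)}^{\epsilon(k)}\big)1_{A_H(n)}=\sum_{j:[k]\to[n]}u_{i(1)j(1)}\cdots u_{i(k)j(k)}\,\varphi\big(y_{j(1)}^{\epsilon(1)}\cdots y_{j(k)}^{\epsilon(k)}\big).$$ A family $\{x_r\}_{r\in\Lambda}$ has an $H^+$-invariant joint $*$-distribution if for every $n$ every sub-$n$-tuple (distinct indices) has an $H_n^+$-invariant joint $*$-distribution. An array $\{x_{rs}\}_{1\le r,s\le n}$ has an $H_n^+$-bi-invariant joint $*$-distribution if for all $k\in\mathbb N$, $i,j:[k]\to[n]$, $\epsilon:[k]\to\{1,*\}$, $$\varphi\big(x_{i(1)j(1)}^{\epsilon(1)}\cdots x_{i(k)j(k)}^{\epsilon(k)}\big)1_{A_H(n)}=\sum_{l:[k]\to[n]}u_{i(1)l(1)}\cdots u_{i(k)l(k)}\,\varphi\big(x_{l(1)j(1)}^{\epsilon(1)}\cdots x_{l(k)j(k)}^{\epsilon(k)}\big)$$ $$=\sum_{l:[k]\to[n]}u_{l(1)j(1)}\cdots u_{l(k)j(k)}\,\varphi\big(x_{i(1)l(1)}^{\epsilon(1)}\cdots x_{i(k)l(k)}^{\epsilon(k)}\big).$$ Free complexification: a Haar unitary is a unitary $z$ with $\varphi(z^n)=\delta_{n,0}$ for all $n\in\mathbb Z$. Unital subalgebras $\mathcal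 A_1,\mathcal A_2$ are free if $\varphi(a_1\cdots a_k)=0$ whenever each $\varphi(a_j)=0$ and the $a_j$ come alternately from $\mathcal A_1$ and $\mathcal A_2$; $z$ is $*$-free from $X$ if the unital $*$-algebras generated by $z$ and by $X$ are free. The joint $*$-distribution of $X=\{x_r\}$ is invariant under free complexification if $\{zx_r\}$ and $\{x_r\}$ have the same joint $*$-distribution, where $z$ is a Haar unitary $*$-free from $X$ (lying in $\mathcal A$, or in an enlargement of $(\mathcal A,\varphi)$ such as its free product with $C(\mathbb T)$ with Haar measure; the joint $*$-distribution of $\{zx_r\}$ does not depend on the choice of $z$). *)

theory Defs
  imports "HOL-Analysis.Analysis" "HOL-Library.Poly_Mapping"
begin

section \<open>Unital C*-algebras\<close>

class scaleC = scaleR +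
  fixes scaleC :: "complex \<Rightarrow> 'a \<Rightarrow> 'a"  (infixr \<open>*\<^sub>C\<close> 75)

class complex_normed_vector = real_normed_vector + scaleC +
  assumes scaleC_add_right: "c *\<^sub>C (x + y) = c *\<^sub>C x + c *\<^sub>C y"
    and scaleC_add_left: "(c + d) *\<^sub>C x = c *\<^sub>C x + d *\<^sub>C x"
    and scaleC_scaleC: "c *\<^sub>C d *\<^sub>C x = (c * d) *\<^sub>C x"
    and scaleR_scaleC: "r *\<^sub>R x = complex_of_real r *\<^sub>C x"
    and norm_scaleC: "norm (c *\<^sub>C x) = cmod c * norm x"

class star =
  fixes star :: "'a \<Rightarrow> 'a"

class cstar_algebra = complex_normed_vector + real_normed_algebra_1 + banach + star +
  assumes mult_scaleC_left: "(c *\<^sub>C x) * y = c *\<^sub>C (x * y)"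
    and mult_scaleC_right: "x * (c *\<^sub>C y) = c *\<^sub>C (x * y)"
    and star_star: "star (star x) = x"
    and star_add: "star (x + y) = star x + star y"
    and star_mult: "star (x * y) = star y * star x"
    and star_scaleC: "star (c *\<^sub>C x) = cnj c *\<^sub>C star x"
    and cstar_identity: "norm (star x * x) = (norm x)\<^sup>2"

instantiation complex :: cstar_algebra
begin

definition "scaleC_complex (c :: complex) (x :: complex) = c * x"
definition "star_complex (x :: complex) = cnj x"

instance
  by standard
    (simp_all add: scaleC_complex_def star_complex_def algebra_simps norm_mult power2_eq_square
      scaleR_conv_of_real)

end

definition unital_star_hom :: "('a::cstar_algebra \<Rightarrow> 'b::cstar_algebra) \<Rightarrow> bool" where
  "unital_star_hom h \<longleftrightarrow>
     h 1 = 1 \<and> (\<forall>x y. h (x + y) = h x + h y) \<and> (\<forall>x y. h (x * y) = h x * h y) \<and>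
     (\<forall>c x. h (c *\<^sub>C x) = c *\<^sub>C h x) \<and> (\<forall>x. h (star x) = star (h x))"

inductive_set alg_gen :: "'a::cstar_algebra set \<Rightarrow> 'a set" for S where
  one: "1 \<in> alg_gen S"
| gen: "x \<in> S \<Longrightarrow> x \<in> alg_gen S"
| add: "x \<in> alg_gen S \<Longrightarrow> y \<in> alg_gen S \<Longrightarrow> x + y \<in> alg_gen S"
| scale: "x \<in> alg_gen S \<Longrightarrow> c *\<^sub>C x \<in> alg_gen S"
| mult: "x \<in> alg_gen S \<Longrightarrow> y \<in> alg_gen S \<Longrightarrow> x * y \<in> alg_gen S"

definition star_alg_gen :: "'a::cstar_algebra set \<Rightarrow> 'a set" where
  "star_alg_gen S = alg_gen (S \<union> star ` S)"


section \<open>Tracial C*-probability spaces, *-distributions and freeness\<close>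

definition tracial_cstar_prob_space :: "('a::cstar_algebra \<Rightarrow> complex) \<Rightarrow> bool" where
  "tracial_cstar_prob_space \<phi> \<longleftrightarrow>
     (\<forall>x y. \<phi> (x + y) = \<phi> x + \<phi> y) \<and> (\<forall>c x. \<phi> (c *\<^sub>C x) = c * \<phi> x) \<and>
     \<phi> 1 = 1 \<and> (\<forall>x. \<phi> (star x * x) \<in> \<real> \<and> 0 \<le> Re (\<phi> (star x * x))) \<and>
     (\<forall>x. \<phi> (star x * x) = 0 \<longrightarrow> x = 0) \<and>
     (\<forall>x y. \<phi> (x * y) = \<phi> (y * x))"

text \<open>An exponent string \<^term>\<open>\<epsilon>\<close> takes values in \<^typ>\<open>bool\<close>, with \<^term>\<open>True\<close> standing for the
  exponent *.\<close>

definition star_word :: "('l \<Rightarrow> 'a::cstar_algebra) \<Rightarrow> nat \<Rightarrow> (nat \<Rightarrow> 'l) \<Rightarrow> (nat \<Rightarrow> bool) \<Rightarrow> 'a" where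
  "star_word x k i \<epsilon> = prod_list (map (\<lambda>m. if \<epsilon> m then star (x (i m)) else x (i m)) [1..<Suc k])"

definition same_star_distribution ::
  "'l set \<Rightarrow> ('a::cstar_algebra \<Rightarrow> complex) \<Rightarrow> ('l \<Rightarrow> 'a) \<Rightarrow> ('b::cstar_algebra \<Rightarrow> complex) \<Rightarrow> ('l \<Rightarrow> 'b) \<Rightarrow> bool"
  where
  "same_star_distribution \<Lambda> \<phi> x \<psi> y \<longleftrightarrow>
     (\<forall>k i \<epsilon>. i \<in> {1..k} \<rightarrow> \<Lambda> \<longrightarrow> \<phi> (star_word x k i \<epsilon>) = \<psi> (star_word y k i \<epsilon>))"

definition haar_unitary :: "('a::cstar_algebra \<Rightarrow> complex) \<Rightarrow> 'a \<Rightarrow> bool" where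
  "haar_unitary \<phi> z \<longleftrightarrow> star z * z = 1 \<and> z * star z = 1 \<and>
     (\<forall>n::int. \<phi> (if 0 \<le> n then z ^ nat n else star z ^ nat (- n)) = (if n = 0 then 1 else 0))"

definition free_subalgebras :: "('a::cstar_algebra \<Rightarrow> complex) \<Rightarrow> 'a set \<Rightarrow> 'a set \<Rightarrow> bool" where
  "free_subalgebras \<phi> A\<^sub>1 A\<^sub>2 \<longleftrightarrow>
     (\<forall>as. as \<noteq> [] \<and> (\<forall>a\<in>set as. \<phi> a = 0) \<and>
        ((\<forall>j<length as. as ! j \<in> (if even j then A\<^sub>1 else A\<^sub>2)) \<or>
         (\<forall>j<length as. as ! j \<in> (if even j then A\<^sub>2 else A\<^sub>1)))
        \<longrightarrow> \<phi> (prod_list as) = 0)"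

definition star_free :: "('a::cstar_algebra \<Rightarrow> complex) \<Rightarrow> 'a set \<Rightarrow> 'a set \<Rightarrow> bool" where
  "star_free \<phi> S T \<longleftrightarrow> free_subalgebras \<phi> (star_alg_gen S) (star_alg_gen T)"

text \<open>A trace-preserving unital *-homomorphism out of a space with faithful state is injective, so
  \<^term>\<open>\<iota>\<close> embeds the first space into the second.\<close>

definition enlargement ::
  "('a::cstar_algebra \<Rightarrow> complex) \<Rightarrow> ('m::cstar_algebra \<Rightarrow> complex) \<Rightarrow> ('a \<Rightarrow> 'm) \<Rightarrow> bool" where
  "enlargement \<phi> \<psi> \<iota> \<longleftrightarrow>
     tracial_cstar_prob_space \<psi> \<and> unital_star_hom \<iota> \<and> (\<forall>a. \<psi> (\<iota> a) = \<phi> a)"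

text \<open>Invariance under free complexification, witnessed by a Haar unitary \<^term>\<open>z\<close> in an
  enlargement.  The distribution of \<^term>\<open>\<lambda>r. z * \<iota> (x r)\<close> does not depend on the witness; it is a
  parameter because HOL cannot quantify over the type of the enlargement inside a formula.\<close>

definition free_complexification_invariant ::
  "('a::cstar_algebra \<Rightarrow> complex) \<Rightarrow> 'l set \<Rightarrow> ('l \<Rightarrow> 'a) \<Rightarrow>
   ('m::cstar_algebra \<Rightarrow> complex) \<Rightarrow> ('a \<Rightarrow> 'm) \<Rightarrow> 'm \<Rightarrow> bool" where
  "free_complexification_invariant \<phi> \<Lambda> x \<psi> \<iota> z \<longleftrightarrow>
     enlargement \<phi> \<psi> \<iota> \<and> haar_unitary \<psi> z \<and> star_free \<psi> {z} (\<iota> ` x ` \<Lambda>) \<and>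
     same_star_distribution \<Lambda> \<psi> (\<lambda>r. z * \<iota> (x r)) \<phi> x"


section \<open>The hyperoctahedral quantum groups\<close>

text \<open>Defining relations for a matrix indexed by \<^term>\<open>{1..n}\<close>.\<close>

definition hyperoctahedral :: "nat \<Rightarrow> (nat \<Rightarrow> nat \<Rightarrow> 'a::cstar_algebra) \<Rightarrow> bool" where
  "hyperoctahedral n u \<longleftrightarrow>
     (\<forall>r\<in>{1..n}. \<forall>s\<in>{1..n}. star (u r s) = u r s) \<and>
     (\<forall>r\<in>{1..n}. \<forall>s\<in>{1..n}. (\<Sum>k=1..n. u r k * star (u s k)) = (if r = s then 1 else 0)) \<and>
     (\<forall>r\<in>{1..n}. \<forall>s\<in>{1..n}. (\<Sum>k=1..n. star (u k r) * u k s) = (if r = s then 1 else 0)) \<and>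
     (\<forall>i\<in>{1..n}. \<forall>j\<in>{1..n}. \<forall>k\<in>{1..n}. j \<noteq> k \<longrightarrow> u i j * u i k = 0 \<and> u j i * u k i = 0)"

text \<open>The universal C*-algebra is constructed from the free unital *-algebra on self-adjoint
  generators, the monoid algebra of the free monoid of words in the generators: it is the separated
  completion for the largest C*-seminorm that vanishes on the relations.

  In order that all the $A_H(n)$ live in one type, this is done with generators $(n,r,s)$ for all
  $n$ at once and no relation between generators with different $n$, which gives the unital free
  product of all the $A_H(n)$; $A_H(n)$ itself is the C*-subalgebra generated by the $(n,r,s)$.  The
  universal property of $A_H(n)$ is theorem \<open>AH_universal\<close> below.\<close>

datatype 'g free_word = Word (letters: "'g list")

instantiation free_word :: (type) monoid_add
begin
definition "0 = Word []"
definition "v + w = Word (letters v @ letters w)"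
instance by standard (simp_all add: zero_free_word_def plus_free_word_def)
end

definition word_rev :: "'g free_word \<Rightarrow> 'g free_word" where
  "word_rev w = Word (rev (letters w))"

type_synonym 'g free_alg = "'g free_word \<Rightarrow>\<^sub>0 complex"

type_synonym gen = "nat \<times> nat \<times> nat"

lemma letters_add [simp]: "letters (v + w) = letters v @ letters w"
  by (simp add: plus_free_word_def)

lemma letters_zero [simp]: "letters 0 = []"
  by (simp add: zero_free_word_def)

lemma word_rev_rev [simp]: "word_rev (word_rev w) = w"
  by (simp add: word_rev_def)

lemma word_rev_add: "word_rev (v + w) = word_rev w + word_rev v"
  by (simp add: word_rev_def plus_free_word_def)

lemma word_rev_zero [simp]: "word_rev 0 = 0"
  by (simp add: word_rev_def zero_free_word_def)

lemma word_rev_eq_iff: "word_rev v = w \<longleftrightarrow> v = word_rev w"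
  by (metis word_rev_rev)

lift_definition fstar :: "'g free_alg \<Rightarrow> 'g free_alg" is "\<lambda>f w. cnj (f (word_rev w))"
proof -
  fix f :: "'g free_word \<Rightarrow> complex"
  assume "finite {w. f w \<noteq> 0}"
  moreover have "{w. cnj (f (word_rev w)) \<noteq> 0} \<subseteq> word_rev ` {w. f w \<noteq> 0}"
    by (auto simp: image_iff) (metis word_rev_rev)
  ultimately show "finite {w. cnj (f (word_rev w)) \<noteq> 0}"
    by (meson finite_imageI finite_subset)
qed

definition fscale :: "complex \<Rightarrow> 'g free_alg \<Rightarrow> 'g free_alg" where
  "fscale c p = Poly_Mapping.single 0 c * p"

definition fgen :: "'g \<Rightarrow> 'g free_alg" where
  "fgen g = Poly_Mapping.single (Word [g]) 1"

lemma single_add_induct [case_names single add]: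
  fixes p :: "'a \<Rightarrow>\<^sub>0 'b::comm_monoid_add"
  assumes single: "\<And>k c. P (Poly_Mapping.single k c)"
    and add: "\<And>p q. P p \<Longrightarrow> P q \<Longrightarrow> P (p + q)"
  shows "P p"
proof (induction p rule: update_induct)
  case const
  show ?case using single[of undefined 0] by simp
next
  case (update f a b)
  have "Poly_Mapping.update a b f = f + Poly_Mapping.single a b"
    using update(1)
    by (intro poly_mapping_eqI) (auto simp: lookup_update lookup_add lookup_single in_keys_iff when_def)
  then show ?case using update add single by simp
qed

lemma lookup_fstar: "Poly_Mapping.lookup (fstar p) w = cnj (Poly_Mapping.lookup p (word_rev w))"
  by transfer simp

lemma fstar_add: "fstar (p + q) = fstar p + fstar q"
  by (intro poly_mapping_eqI) (simp add: lookup_fstar lookup_add)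

lemma fstar_single [simp]: "fstar (Poly_Mapping.single w c) = Poly_Mapping.single (word_rev w) (cnj c)"
  by (intro poly_mapping_eqI) (auto simp: lookup_fstar lookup_single when_def)

lemma fstar_fstar [simp]: "fstar (fstar p) = p"
  by (intro poly_mapping_eqI) (simp add: lookup_fstar)

lemma fstar_mult: "fstar (p * q) = fstar q * fstar p"
proof (induction p rule: single_add_induct)
  case (single v c)
  show ?case
    by (induction q rule: single_add_induct)
      (simp_all add: mult_single word_rev_add mult.commute distrib_left distrib_right fstar_add)
qed (simp add: distrib_left distrib_right fstar_add)

lemma fstar_zero [simp]: "fstar 0 = 0"
  by (intro poly_mapping_eqI) (simp add: lookup_fstar)

lemma fstar_one [simp]: "fstar 1 = 1"
  by (metis fstar_single single_one word_rev_zero complex_cnj_one)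

lemma fstar_uminus: "fstar (- p) = - fstar p"
  by (intro poly_mapping_eqI) (simp add: lookup_fstar)

lemma fstar_diff: "fstar (p - q) = fstar p - fstar q"
  by (intro poly_mapping_eqI) (simp add: lookup_fstar lookup_minus)

lemma fstar_fgen [simp]: "fstar (fgen g) = fgen g"
  by (simp add: fgen_def word_rev_def)

lemma single_zero_commute: "p * Poly_Mapping.single 0 c = Poly_Mapping.single 0 c * (p :: 'g free_alg)"
  by (induction p rule: single_add_induct) (simp_all add: mult_single mult.commute distrib_left distrib_right)

lemma fscale_one [simp]: "fscale 1 p = p"
  by (simp add: fscale_def)

lemma fscale_fscale: "fscale c (fscale d p) = fscale (c * d) p"
  by (simp add: fscale_def mult_single flip: mult.assoc)

lemma fscale_add_right: "fscale c (p + q) = fscale c p + fscale c q"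
  by (simp add: fscale_def distrib_left)

lemma fscale_diff_right: "fscale c (p - q) = fscale c p - fscale c q"
  by (simp add: fscale_def algebra_simps)

lemma fscale_add_left: "fscale (c + d) p = fscale c p + fscale d p"
  by (simp add: fscale_def single_add distrib_right)

lemma fscale_mult_left: "fscale c p * q = fscale c (p * q)"
  by (simp add: fscale_def mult.assoc)

lemma fscale_mult_right: "p * fscale c q = fscale c (p * q)"
  unfolding fscale_def by (metis mult.assoc single_zero_commute)

lemma fstar_fscale: "fstar (fscale c p) = fscale (cnj c) (fstar p)"
  by (simp add: fscale_def fstar_mult single_zero_commute)

lemma fscale_minus_one: "fscale (- 1) p = - p"
  by (simp add: fscale_def single_uminus)

definition cstar_seminorm :: "('g free_alg \<Rightarrow> real) \<Rightarrow> bool" where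
  "cstar_seminorm q \<longleftrightarrow>
     (\<forall>x. 0 \<le> q x) \<and> (\<forall>x y. q (x + y) \<le> q x + q y) \<and> (\<forall>c x. q (fscale c x) = cmod c * q x) \<and>
     (\<forall>x y. q (x * y) \<le> q x * q y) \<and> (\<forall>x. q (fstar x * x) = (q x)\<^sup>2)"

text \<open>Generators $(n,r,s)$ with indices outside \<^term>\<open>{1..n}\<close> are redundant and set to 0.\<close>

definition AH_relators :: "gen free_alg set" where
  "AH_relators =
     {fgen (n,r,s) |n r s. \<not> (r \<in> {1..n} \<and> s \<in> {1..n})} \<union>
     {(\<Sum>k=1..n. fgen (n,r,k) * fstar (fgen (n,s,k))) - (if r = s then 1 else 0)
        |n r s. r \<in> {1..n} \<and> s \<in> {1..n}} \<union>
     {(\<Sum>k=1..n. fstar (fgen (n,k,r)) * fgen (n,k,s)) - (if r = s then 1 else 0)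
        |n r s. r \<in> {1..n} \<and> s \<in> {1..n}} \<union>
     {fgen (n,i,j) * fgen (n,i,k) |n i j k. i \<in> {1..n} \<and> j \<in> {1..n} \<and> k \<in> {1..n} \<and> j \<noteq> k} \<union>
     {fgen (n,j,i) * fgen (n,k,i) |n i j k. i \<in> {1..n} \<and> j \<in> {1..n} \<and> k \<in> {1..n} \<and> j \<noteq> k}"

definition AH_seminorms :: "(gen free_alg \<Rightarrow> real) set" where
  "AH_seminorms = {q. cstar_seminorm q \<and> (\<forall>x\<in>AH_relators. q x = 0)}"

definition AH_seminorm :: "gen free_alg \<Rightarrow> real" where
  "AH_seminorm x = (SUP q\<in>AH_seminorms. q x)"

subsection \<open>The largest seminorm is finite and is itself such a C*-seminorm\<close>

lemma
  assumes "cstar_seminorm q"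
  shows csn_nonneg: "0 \<le> q x" and csn_add: "q (x + y) \<le> q x + q y"
    and csn_scale: "q (fscale c x) = cmod c * q x" and csn_mult: "q (x * y) \<le> q x * q y"
    and csn_cstar: "q (fstar x * x) = (q x)\<^sup>2"
  using assms by (auto simp: cstar_seminorm_def)

lemma csn_zero: "cstar_seminorm q \<Longrightarrow> q 0 = 0"
  using csn_scale[of q 0 0] by (simp add: fscale_def)

lemma csn_uminus: "cstar_seminorm q \<Longrightarrow> q (- x) = q x"
  using csn_scale[of q "-1" x] by (simp add: fscale_minus_one)

lemma csn_diff: "cstar_seminorm q \<Longrightarrow> q (x - y) \<le> q x + q y"
  using csn_add[of q x "- y"] by (simp add: csn_uminus)

lemma csn_commute: "cstar_seminorm q \<Longrightarrow> q (x - y) = q (y - x)"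
  using csn_uminus[of q "x - y"] by simp

lemma csn_triangle: "cstar_seminorm q \<Longrightarrow> q (x - z) \<le> q (x - y) + q (y - z)"
  using csn_add[of q "x - y" "y - z"] by simp

lemma csn_abs_diff: "cstar_seminorm q \<Longrightarrow> \<bar>q x - q y\<bar> \<le> q (x - y)"
  using csn_add[of q "x - y" y] csn_add[of q "y - x" x] csn_commute[of q x y] by simp

lemma csn_star_le: "cstar_seminorm q \<Longrightarrow> q x \<le> q (fstar x)"
proof -
  assume q: "cstar_seminorm q"
  have "q x * q x \<le> q (fstar x) * q x"
    using csn_cstar[OF q, of x] csn_mult[OF q, of "fstar x" x] by (simp add: power2_eq_square)
  then show ?thesis
    using csn_nonneg[OF q, of x] csn_nonneg[OF q, of "fstar x"]
    by (cases "q x = 0") (auto simp: mult_le_cancel_right)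
qed

lemma csn_star: "cstar_seminorm q \<Longrightarrow> q (fstar x) = q x"
  using csn_star_le[of q x] csn_star_le[of q "fstar x"] by simp

lemma csn_null_mult:
  assumes "cstar_seminorm q" "q x = 0"
  shows "q (x * y) = 0" "q (y * x) = 0"
  using csn_mult[OF assms(1), of x y] csn_nonneg[OF assms(1), of "x * y"]
    csn_mult[OF assms(1), of y x] csn_nonneg[OF assms(1), of "y * x"] assms(2) by auto

lemma csn_null_add: "cstar_seminorm q \<Longrightarrow> q x = 0 \<Longrightarrow> q y = 0 \<Longrightarrow> q (x + y) = 0"
  using csn_add[of q x y] csn_nonneg[of q "x + y"] by simp

lemma csn_null_sum:
  assumes q: "cstar_seminorm q" and "\<And>k. k \<in> K \<Longrightarrow> q (f k) = 0"
  shows "q (\<Sum>k\<in>K. f k) = 0"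
  using assms(2)
  by (induction K rule: infinite_finite_induct) (simp_all add: csn_zero[OF q] csn_null_add[OF q])

lemma csn_one_le: "cstar_seminorm q \<Longrightarrow> q 1 \<le> 1"
proof -
  assume q: "cstar_seminorm q"
  have "(q 1)\<^sup>2 = q 1" using csn_cstar[OF q, of 1] by simp
  then show ?thesis by (auto simp: power2_eq_square)
qed

lemma AH_seminorms_gen_le:
  assumes q: "q \<in> AH_seminorms"
  shows "q (fgen g) \<le> 1"
proof -
  obtain n r s where g: "g = (n,r,s)" by (cases g)
  have sn: "cstar_seminorm q" and rel: "\<And>x. x \<in> AH_relators \<Longrightarrow> q x = 0"
    using q by (auto simp: AH_seminorms_def)
  show ?thesis
  proof (cases "r \<in> {1..n} \<and> s \<in> {1..n}")
    case False
    then have "fgen g \<in> AH_relators" unfolding AH_relators_def g by blast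
    then show ?thesis using rel by simp
  next
    case True
    define G where "G = (\<lambda>k. fgen (n,r,k) :: gen free_alg)"
    define e where "e = G s * G s"
    have "(\<Sum>k=1..n. fgen (n,r,k) * fstar (fgen (n,r,k))) - (if r = r then 1 else 0) \<in> AH_relators"
      unfolding AH_relators_def using True by blast
    then have unit: "q ((\<Sum>k=1..n. G k * G k) - 1) = 0"
      using rel by (simp add: G_def)
    have orth: "q (G s * G k) = 0" if "k \<in> {1..n} - {s}" for k
    proof (rule rel)
      show "G s * G k \<in> AH_relators"
        unfolding AH_relators_def G_def using True that by blast
    qed
    have "(\<Sum>k=1..n. G k * G k) = e + (\<Sum>k\<in>{1..n}-{s}. G k * G k)"
      using True by (subst sum.remove[of _ s]) (auto simp: e_def)
    then have "e * e - e = e * ((\<Sum>k=1..n. G k * G k) - 1) + - (\<Sum>k\<in>{1..n}-{s}. G s * (G s * G k) * G k)"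
      by (simp add: algebra_simps sum_distrib_left e_def)
    moreover have "q (e * ((\<Sum>k=1..n. G k * G k) - 1)) = 0"
      by (intro csn_null_mult[OF sn] unit)
    moreover have "q (- (\<Sum>k\<in>{1..n}-{s}. G s * (G s * G k) * G k)) = 0"
      unfolding csn_uminus[OF sn] by (intro csn_null_sum[OF sn] csn_null_mult[OF sn] orth)
    ultimately have "q (e * e - e) = 0"
      using csn_null_add[OF sn] by (simp only:)
    then have "q (e * e) = q e"
      using csn_abs_diff[OF sn, of "e * e" e] by simp
    moreover have "fstar e = e" by (simp add: e_def G_def fstar_mult)
    ultimately have "(q e)\<^sup>2 = q e" using csn_cstar[OF sn, of e] by simp
    then have "q e \<le> 1" by (auto simp: power2_eq_square)
    moreover have "q e = (q (G s))\<^sup>2"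
      using csn_cstar[OF sn, of "G s"] by (simp add: e_def G_def)
    ultimately show ?thesis
      using power2_le_imp_le[of "q (G s)" 1] by (simp add: G_def g)
  qed
qed

lemma AH_seminorms_word_le:
  assumes q: "q \<in> AH_seminorms"
  shows "q (Poly_Mapping.single (Word gs) 1) \<le> 1"
proof (induction gs)
  case Nil
  then show ?case using csn_one_le[of q] q by (simp add: AH_seminorms_def flip: zero_free_word_def)
next
  case (Cons g gs)
  have sn: "cstar_seminorm q" using q by (auto simp: AH_seminorms_def)
  have "Poly_Mapping.single (Word (g # gs)) 1 = fgen g * Poly_Mapping.single (Word gs) (1::complex)"
    by (simp add: fgen_def mult_single plus_free_word_def)
  then have "q (Poly_Mapping.single (Word (g # gs)) 1) \<le> q (fgen g) * q (Poly_Mapping.single (Word gs) 1)"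
    using csn_mult[OF sn] by simp
  also have "\<dots> \<le> 1 * 1"
    by (intro mult_mono AH_seminorms_gen_le[OF q] Cons csn_nonneg[OF sn]) auto
  finally show ?case by simp
qed

lemma AH_seminorms_bounded: "\<exists>B. \<forall>q\<in>AH_seminorms. q x \<le> B"
proof (induction x rule: single_add_induct)
  case (single w c)
  have "q (Poly_Mapping.single w c) \<le> cmod c" if q: "q \<in> AH_seminorms" for q
  proof -
    have sn: "cstar_seminorm q" using q by (auto simp: AH_seminorms_def)
    have "Poly_Mapping.single w c = fscale c (Poly_Mapping.single (Word (letters w)) 1)"
      by (simp add: fscale_def mult_single)
    then have "q (Poly_Mapping.single w c) = cmod c * q (Poly_Mapping.single (Word (letters w)) 1)"
      by (simp add: csn_scale[OF sn])
    then show ?thesis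
      using AH_seminorms_word_le[OF q, of "letters w"] mult_left_mono[of _ 1 "cmod c"] by simp
  qed
  then show ?case by blast
next
  case (add x y)
  then obtain B C where "\<forall>q\<in>AH_seminorms. q x \<le> B" "\<forall>q\<in>AH_seminorms. q y \<le> C" by auto
  moreover have "q (x + y) \<le> q x + q y" if "q \<in> AH_seminorms" for q
    using that csn_add[of q] by (auto simp: AH_seminorms_def)
  ultimately have "\<forall>q\<in>AH_seminorms. q (x + y) \<le> B + C" by fastforce
  then show ?case by blast
qed

lemma AH_seminorm_upper: "q \<in> AH_seminorms \<Longrightarrow> q x \<le> AH_seminorm x"
  unfolding AH_seminorm_def using AH_seminorms_bounded[of x]
  by (intro cSUP_upper) (auto simp: bdd_above_def)

lemma zero_in_AH_seminorms: "(\<lambda>_. 0) \<in> AH_seminorms"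
  by (simp add: AH_seminorms_def cstar_seminorm_def)

lemma AH_seminorm_least: "(\<And>q. q \<in> AH_seminorms \<Longrightarrow> q x \<le> B) \<Longrightarrow> AH_seminorm x \<le> B"
  unfolding AH_seminorm_def using zero_in_AH_seminorms by (intro cSUP_least) auto

lemma AH_seminorm_nonneg: "0 \<le> AH_seminorm x"
  using AH_seminorm_upper[OF zero_in_AH_seminorms] .

lemma AH_seminorm_cstar_seminorm: "cstar_seminorm AH_seminorm"
  unfolding cstar_seminorm_def
proof (intro conjI allI)
  fix x y :: "gen free_alg" and c :: complex
  have sn: "cstar_seminorm q" if "q \<in> AH_seminorms" for q
    using that by (auto simp: AH_seminorms_def)
  note up = AH_seminorm_upper
  show "0 \<le> AH_seminorm x" by (rule AH_seminorm_nonneg)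
  show "AH_seminorm (x + y) \<le> AH_seminorm x + AH_seminorm y"
  proof (rule AH_seminorm_least)
    fix q assume q: "q \<in> AH_seminorms"
    show "q (x + y) \<le> AH_seminorm x + AH_seminorm y"
      using csn_add[OF sn[OF q], of x y] up[OF q, of x] up[OF q, of y] by simp
  qed
  have le: "AH_seminorm (fscale c x) \<le> cmod c * AH_seminorm x" for c x
    by (rule AH_seminorm_least) (simp add: csn_scale[OF sn] up mult_left_mono)
  show "AH_seminorm (fscale c x) = cmod c * AH_seminorm x"
  proof (cases "c = 0")
    case True
    then show ?thesis using le[of 0 x] AH_seminorm_nonneg[of "fscale c x"] by simp
  next
    case False
    have "AH_seminorm (fscale (inverse c) (fscale c x)) \<le> cmod (inverse c) * AH_seminorm (fscale c x)"
      by (rule le)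
    then have "AH_seminorm x \<le> AH_seminorm (fscale c x) / cmod c"
      using False by (simp add: fscale_fscale norm_inverse divide_inverse mult.commute)
    then have "cmod c * AH_seminorm x \<le> AH_seminorm (fscale c x)"
      using False by (simp add: field_simps)
    then show ?thesis using le[of c x] by simp
  qed
  show "AH_seminorm (x * y) \<le> AH_seminorm x * AH_seminorm y"
  proof (rule AH_seminorm_least)
    fix q assume q: "q \<in> AH_seminorms"
    have "q (x * y) \<le> q x * q y" by (rule csn_mult[OF sn[OF q]])
    also have "\<dots> \<le> AH_seminorm x * AH_seminorm y"
      by (intro mult_mono up q csn_nonneg[OF sn[OF q]] AH_seminorm_nonneg)
    finally show "q (x * y) \<le> AH_seminorm x * AH_seminorm y" .
  qed
  show "AH_seminorm (fstar x * x) = (AH_seminorm x)\<^sup>2"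
  proof (rule antisym)
    show "AH_seminorm (fstar x * x) \<le> (AH_seminorm x)\<^sup>2"
      by (rule AH_seminorm_least) (simp add: csn_cstar[OF sn] power_mono up csn_nonneg[OF sn])
    have "AH_seminorm x \<le> sqrt (AH_seminorm (fstar x * x))"
    proof (rule AH_seminorm_least)
      fix q assume q: "q \<in> AH_seminorms"
      have "(q x)\<^sup>2 \<le> AH_seminorm (fstar x * x)"
        using up[OF q, of "fstar x * x"] by (simp add: csn_cstar[OF sn[OF q]])
      then show "q x \<le> sqrt (AH_seminorm (fstar x * x))" by (rule real_le_rsqrt)
    qed
    then have "(AH_seminorm x)\<^sup>2 \<le> (sqrt (AH_seminorm (fstar x * x)))\<^sup>2"
      by (intro power_mono AH_seminorm_nonneg)
    then show "(AH_seminorm x)\<^sup>2 \<le> AH_seminorm (fstar x * x)"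
      by (simp add: AH_seminorm_nonneg)
  qed
qed

lemma AH_seminorm_relator: "x \<in> AH_relators \<Longrightarrow> AH_seminorm x = 0"
  using AH_seminorm_least[of x 0] AH_seminorm_nonneg[of x] by (auto simp: AH_seminorms_def)

subsection \<open>Evaluation of noncommutative polynomials in a C*-algebra\<close>

lemma scaleC_zero_left [simp]: "0 *\<^sub>C (x :: 'a::complex_normed_vector) = 0"
  using scaleC_add_left[of 0 0 x] by simp

lemma scaleC_zero_right [simp]: "c *\<^sub>C (0 :: 'a::complex_normed_vector) = 0"
  using scaleC_add_right[of c 0 "0::'a"] by simp

lemma scaleC_one [simp]: "1 *\<^sub>C (x :: 'a::complex_normed_vector) = x"
  using scaleR_scaleC[of 1 x] by simp

lemma star_zero [simp]: "star (0 :: 'a::cstar_algebra) = 0"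
  using star_add[of "0::'a" 0] by simp

lemma star_one [simp]: "star (1 :: 'a::cstar_algebra) = 1"
  using star_mult[of "star 1" "1::'a"] by (simp add: star_star)

lemma norm_star [simp]: "norm (star (x :: 'a::cstar_algebra)) = norm x"
proof -
  have le: "norm x \<le> norm (star x)" for x :: 'a
  proof -
    have "norm x * norm x \<le> norm (star x) * norm x"
      using cstar_identity[of x] norm_mult_ineq[of "star x" x] by (simp add: power2_eq_square)
    then show ?thesis by (cases "x = 0") (auto simp: mult_le_cancel_right)
  qed
  show ?thesis using le[of x] le[of "star x"] by (simp add: star_star)
qed

definition feval :: "('g \<Rightarrow> 'a::cstar_algebra) \<Rightarrow> 'g free_alg \<Rightarrow> 'a" where
  "feval v p = (\<Sum>w\<in>Poly_Mapping.keys p. Poly_Mapping.lookup p w *\<^sub>C prod_list (map v (letters w)))"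

lemma feval_superset:
  "finite W \<Longrightarrow> Poly_Mapping.keys p \<subseteq> W \<Longrightarrow> feval v p = (\<Sum>w\<in>W. Poly_Mapping.lookup p w *\<^sub>C prod_list (map v (letters w)))"
  unfolding feval_def by (rule sum.mono_neutral_left) (auto simp: in_keys_iff)

lemma feval_single [simp]: "feval v (Poly_Mapping.single w c) = c *\<^sub>C prod_list (map v (letters w))"
  by (subst feval_superset[of "{w}"]) auto

lemma feval_add: "feval v (p + q) = feval v p + feval v q"
proof -
  let ?W = "Poly_Mapping.keys p \<union> Poly_Mapping.keys q"
  have "Poly_Mapping.keys (p + q) \<subseteq> ?W" by (rule keys_add)
  then show ?thesis
    by (simp add: feval_superset[of ?W] lookup_add scaleC_add_left sum.distrib)
qed

lemma feval_mult: "feval v (p * q) = feval v p * feval v q"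
proof (induction p rule: single_add_induct)
  case (single w c)
  show ?case
    by (induction q rule: single_add_induct)
      (simp_all add: mult_single distrib_left feval_add mult_scaleC_left mult_scaleC_right scaleC_scaleC mult.commute)
qed (simp add: distrib_right feval_add)

lemma feval_one [simp]: "feval v 1 = 1"
  by (metis feval_single letters_zero list.map(1) prod_list.Nil scaleC_one single_one)

lemma feval_zero [simp]: "feval v 0 = 0"
  by (simp add: feval_def)

lemma feval_uminus: "feval v (- p) = - feval v p"
  using feval_add[of v p "- p"] by (simp add: eq_neg_iff_add_eq_0 add.commute)

lemma feval_diff: "feval v (p - q) = feval v p - feval v q"
  using feval_add[of v p "- q"] by (simp add: feval_uminus)

lemma feval_scale: "feval v (fscale c p) = c *\<^sub>C feval v p"
  by (simp add: fscale_def feval_mult mult_scaleC_left)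

lemma feval_gen [simp]: "feval v (fgen g) = v g"
  by (simp add: fgen_def)

lemma feval_sum: "feval v (\<Sum>k\<in>K. f k) = (\<Sum>k\<in>K. feval v (f k))"
  by (induction K rule: infinite_finite_induct) (auto simp: feval_add)

lemma feval_star:
  assumes "\<And>g. star (v g) = v g"
  shows "feval v (fstar p) = star (feval v p)"
proof (induction p rule: single_add_induct)
  case (single w c)
  have "star (prod_list (map v gs)) = prod_list (map v (rev gs))" for gs
    by (induction gs) (simp_all add: star_mult assms)
  then show ?case by (simp add: word_rev_def star_scaleC)
qed (simp add: feval_add fstar_add star_add)

definition AH_family :: "(gen \<Rightarrow> 'a::cstar_algebra) \<Rightarrow> bool" where
  "AH_family v \<longleftrightarrow> (\<forall>g. star (v g) = v g) \<and> (\<forall>x\<in>AH_relators. feval v x = 0)"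

lemma AH_family_seminorm: "AH_family v \<Longrightarrow> (\<lambda>x. norm (feval v x)) \<in> AH_seminorms"
  by (simp add: AH_family_def AH_seminorms_def cstar_seminorm_def feval_add feval_scale
      feval_mult feval_star norm_scaleC cstar_identity norm_triangle_ineq norm_mult_ineq
      del: split_paired_All)

lemma AH_family_le: "AH_family v \<Longrightarrow> norm (feval v x) \<le> AH_seminorm x"
  using AH_seminorm_upper[OF AH_family_seminorm] .

lemma hyperoctahedral_cong:
  assumes "hyperoctahedral n u" and eq: "\<And>r s. r \<in> {1..n} \<Longrightarrow> s \<in> {1..n} \<Longrightarrow> u' r s = u r s"
  shows "hyperoctahedral n u'"
proof -
  have "(\<Sum>k=1..n. u' r k * star (u' s k)) = (\<Sum>k=1..n. u r k * star (u s k))"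
    "(\<Sum>k=1..n. star (u' k r) * u' k s) = (\<Sum>k=1..n. star (u k r) * u k s)"
    if "r \<in> {1..n}" "s \<in> {1..n}" for r s
    using that by (auto intro!: sum.cong simp: eq simp del: One_nat_def)
  then show ?thesis
    using assms(1) unfolding hyperoctahedral_def by (auto simp: eq simp del: One_nat_def)
qed

lemma AH_family_extend:
  fixes v :: "nat \<Rightarrow> nat \<Rightarrow> 'a::cstar_algebra"
  assumes "hyperoctahedral n v"
  obtains V where "AH_family V" "\<And>r s. r \<in> {1..n} \<Longrightarrow> s \<in> {1..n} \<Longrightarrow> V (n,r,s) = v r s"
proof
  define V :: "gen \<Rightarrow> 'a" where "V = (\<lambda>(m,r,s). if r \<in> {1..m} \<and> s \<in> {1..m} then
           (if m = n then v r s else if r = s then 1 else 0) else 0)"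
  show "\<And>r s. r \<in> {1..n} \<Longrightarrow> s \<in> {1..n} \<Longrightarrow> V (n,r,s) = v r s"
    by (simp add: V_def)
  have sa: "star (V g) = V g" for g
    using assms by (cases g) (auto simp: hyperoctahedral_def V_def)
  have out: "V (m,r,s) = 0" if "\<not> (r \<in> {1..m} \<and> s \<in> {1..m})" for m r s
    using that by (auto simp: V_def)
  have rel: "hyperoctahedral m (\<lambda>r s. V (m,r,s))" for m
  proof (cases "m = n")
    case True
    show ?thesis unfolding True
      by (rule hyperoctahedral_cong[OF assms]) (simp add: V_def)
  next
    case False
    have "hyperoctahedral m (\<lambda>r s. if r = s then 1 else 0 :: 'a)"
      by (simp add: hyperoctahedral_def if_distrib[of "\<lambda>x. x * _"] if_distrib[of star] cong: if_cong)
    then show ?thesis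
      by (rule hyperoctahedral_cong) (use False in \<open>simp add: V_def\<close>)
  qed
  have one: "feval V (if r = s then 1 else 0) = (if r = s then 1 else 0)" for r s :: nat
    by simp
  show "AH_family V"
    unfolding AH_family_def
  proof (intro conjI allI ballI)
    show "star (V g) = V g" for g by (rule sa)
    show "feval V x = 0" if "x \<in> AH_relators" for x
      using that unfolding AH_relators_def
    proof (elim UnE CollectE exE conjE)
      fix m r s assume x: "x = fgen (m,r,s)" "\<not> (r \<in> {1..m} \<and> s \<in> {1..m})"
      show ?thesis using out x by simp
    next
      fix m r s
      assume "x = (\<Sum>k=1..m. fgen (m,r,k) * fstar (fgen (m,s,k))) - (if r = s then 1 else 0)"
        and "r \<in> {1..m}" "s \<in> {1..m}"
      then show ?thesis
        using rel[of m] by (simp add: hyperoctahedral_def sa feval_diff feval_sum feval_mult)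
    next
      fix m r s
      assume "x = (\<Sum>k=1..m. fstar (fgen (m,k,r)) * fgen (m,k,s)) - (if r = s then 1 else 0)"
        and "r \<in> {1..m}" "s \<in> {1..m}"
      then show ?thesis
        using rel[of m] by (simp add: hyperoctahedral_def sa feval_diff feval_sum feval_mult)
    next
      fix m i j k
      assume "x = fgen (m,i,j) * fgen (m,i,k)" "i \<in> {1..m}" "j \<in> {1..m}" "k \<in> {1..m}" "j \<noteq> k"
      then show ?thesis using rel[of m] by (simp add: hyperoctahedral_def feval_mult)
    next
      fix m i j k
      assume "x = fgen (m,j,i) * fgen (m,k,i)" "i \<in> {1..m}" "j \<in> {1..m}" "k \<in> {1..m}" "j \<noteq> k"
      then show ?thesis using rel[of m] by (simp add: hyperoctahedral_def feval_mult)
    qed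
  qed
qed

subsection \<open>Completion\<close>

definition AH_Cauchy :: "(nat \<Rightarrow> gen free_alg) \<Rightarrow> bool" where
  "AH_Cauchy X \<longleftrightarrow> (\<forall>e>0. \<exists>M. \<forall>m\<ge>M. \<forall>n\<ge>M. AH_seminorm (X m - X n) < e)"

definition AH_rel :: "(nat \<Rightarrow> gen free_alg) \<Rightarrow> (nat \<Rightarrow> gen free_alg) \<Rightarrow> bool" where
  "AH_rel X Y \<longleftrightarrow> AH_Cauchy X \<and> AH_Cauchy Y \<and> (\<lambda>k. AH_seminorm (X k - Y k)) \<longlonglongrightarrow> 0"

lemmas AHs = AH_seminorm_cstar_seminorm

lemma AH_null_bound:
  assumes "\<And>k. AH_seminorm (X k) \<le> f k" "f \<longlonglongrightarrow> 0"
  shows "(\<lambda>k. AH_seminorm (X k)) \<longlonglongrightarrow> 0"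
  by (rule tendsto_sandwich[OF _ _ tendsto_const[of 0] assms(2)])
    (simp_all add: AH_seminorm_nonneg assms(1))

lemma AH_CauchyI:
  assumes "\<And>e. e > 0 \<Longrightarrow> \<exists>M. \<forall>m\<ge>M. \<forall>n\<ge>M. AH_seminorm (X m - X n) < e"
  shows "AH_Cauchy X"
  using assms by (simp add: AH_Cauchy_def)

lemma AH_Cauchy_const: "AH_Cauchy (\<lambda>_. x)"
  by (simp add: AH_Cauchy_def csn_zero[OF AHs])

lemma AH_Cauchy_Cauchy_norm:
  assumes "AH_Cauchy X"
  shows "convergent (\<lambda>k. AH_seminorm (X k))"
proof -
  have "Cauchy (\<lambda>k. AH_seminorm (X k))"
    unfolding Cauchy_def dist_real_def
    using assms csn_abs_diff[OF AHs] unfolding AH_Cauchy_def by (meson order_le_less_trans)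
  then show ?thesis by (simp add: Cauchy_convergent_iff)
qed

lemma AH_Cauchy_bounded:
  assumes "AH_Cauchy X"
  obtains B where "B > 0" "\<And>k. AH_seminorm (X k) \<le> B"
proof -
  have "Bseq (\<lambda>k. AH_seminorm (X k))"
    using AH_Cauchy_Cauchy_norm[OF assms] by (rule convergent_imp_Bseq)
  then show ?thesis using that by (auto simp: Bseq_def AH_seminorm_nonneg)
qed

lemma AH_Cauchy_lipschitz:
  assumes X: "AH_Cauchy X" and Y: "AH_Cauchy Y"
    and le: "\<And>m n. AH_seminorm (Z m - Z n) \<le> B * AH_seminorm (X m - X n) + C * AH_seminorm (Y m - Y n)"
    and "B > 0" "C > 0"
  shows "AH_Cauchy Z"
proof (rule AH_CauchyI)
  fix e :: real assume "e > 0"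
  then have "e / (2 * B) > 0" "e / (2 * C) > 0" using assms by auto
  then obtain K L where K: "\<And>m n. m \<ge> K \<Longrightarrow> n \<ge> K \<Longrightarrow> AH_seminorm (X m - X n) < e / (2 * B)"
    and L: "\<And>m n. m \<ge> L \<Longrightarrow> n \<ge> L \<Longrightarrow> AH_seminorm (Y m - Y n) < e / (2 * C)"
    using X Y unfolding AH_Cauchy_def by meson
  have "AH_seminorm (Z m - Z n) < e" if "m \<ge> max K L" "n \<ge> max K L" for m n
  proof -
    have "B * AH_seminorm (X m - X n) < e / 2"
      using K[of m n] that \<open>B > 0\<close> by (simp add: field_simps)
    moreover have "C * AH_seminorm (Y m - Y n) < e / 2"
      using L[of m n] that \<open>C > 0\<close> by (simp add: field_simps)
    ultimately show ?thesis using le[of m n] by simp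
  qed
  then show "\<exists>M. \<forall>m\<ge>M. \<forall>n\<ge>M. AH_seminorm (Z m - Z n) < e" by blast
qed

lemma AH_Cauchy_add:
  assumes "AH_Cauchy X" "AH_Cauchy Y"
  shows "AH_Cauchy (\<lambda>k. X k + Y k)"
proof (rule AH_Cauchy_lipschitz[OF assms, where B = 1 and C = 1])
  fix m n
  show "AH_seminorm (X m + Y m - (X n + Y n)) \<le> 1 * AH_seminorm (X m - X n) + 1 * AH_seminorm (Y m - Y n)"
    using csn_add[OF AHs, of "X m - X n" "Y m - Y n"] by (simp add: algebra_simps)
qed auto

lemma AH_Cauchy_scale:
  assumes "AH_Cauchy X"
  shows "AH_Cauchy (\<lambda>k. fscale c (X k))"
proof (rule AH_Cauchy_lipschitz[OF assms AH_Cauchy_const[of 0], where B = "cmod c + 1" and C = 1])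
  fix m n
  show "AH_seminorm (fscale c (X m) - fscale c (X n)) \<le>
      (cmod c + 1) * AH_seminorm (X m - X n) + 1 * AH_seminorm (0 - 0)"
    by (simp add: csn_scale[OF AHs] csn_zero[OF AHs] AH_seminorm_nonneg distrib_right
        flip: fscale_diff_right)
qed (auto simp: add_nonneg_pos)

lemma AH_Cauchy_star:
  assumes "AH_Cauchy X"
  shows "AH_Cauchy (\<lambda>k. fstar (X k))"
  using assms by (simp add: AH_Cauchy_def csn_star[OF AHs] flip: fstar_diff)

lemma AH_diff_mult_le:
  "AH_seminorm (x * y - x' * y') \<le> AH_seminorm y * AH_seminorm (x - x') + AH_seminorm x' * AH_seminorm (y - y')"
proof -
  have "x * y - x' * y' = (x - x') * y + x' * (y - y')" by (simp add: algebra_simps)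
  then have "AH_seminorm (x * y - x' * y') \<le> AH_seminorm ((x - x') * y) + AH_seminorm (x' * (y - y'))"
    using csn_add[OF AHs] by metis
  also have "\<dots> \<le> AH_seminorm (x - x') * AH_seminorm y + AH_seminorm x' * AH_seminorm (y - y')"
    by (intro add_mono csn_mult[OF AHs])
  finally show ?thesis by (simp add: mult.commute)
qed

lemma AH_Cauchy_mult:
  assumes "AH_Cauchy X" "AH_Cauchy Y"
  shows "AH_Cauchy (\<lambda>k. X k * Y k)"
proof -
  obtain B C where BC: "B > 0" "\<And>k. AH_seminorm (X k) \<le> B" "C > 0" "\<And>k. AH_seminorm (Y k) \<le> C"
    using assms AH_Cauchy_bounded by metis
  show ?thesis
  proof (rule AH_Cauchy_lipschitz[OF assms _ BC(3) BC(1)])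
    show "AH_seminorm (X m * Y m - X n * Y n) \<le>
        C * AH_seminorm (X m - X n) + B * AH_seminorm (Y m - Y n)" for m n
      by (intro order_trans[OF AH_diff_mult_le] add_mono mult_right_mono AH_seminorm_nonneg BC)
  qed
qed

lemma AH_rel_refl: "AH_Cauchy X \<Longrightarrow> AH_rel X X"
  by (simp add: AH_rel_def csn_zero[OF AHs])

lifting_forget poly_mapping.lifting

quotient_type AH_free = "nat \<Rightarrow> gen free_alg" / partial: AH_rel
proof (rule part_equivpI)
  show "\<exists>X. AH_rel X X"
    using AH_rel_refl AH_Cauchy_const by blast
  show "symp AH_rel"
    by (auto simp: symp_def AH_rel_def csn_commute[OF AHs])
  show "transp AH_rel"
  proof (rule transpI)
    fix X Y Z assume "AH_rel X Y" "AH_rel Y Z"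
    then show "AH_rel X Z"
      unfolding AH_rel_def
      by (auto intro!: AH_null_bound[OF csn_triangle[OF AHs, of _ _ "Y _"]] tendsto_eq_intros)
  qed
qed

lemma AH_rel_lim:
  assumes "AH_rel X Y"
  shows "lim (\<lambda>k. AH_seminorm (X k)) = lim (\<lambda>k. AH_seminorm (Y k))"
proof -
  have "(\<lambda>k. AH_seminorm (X k - Y k)) \<longlonglongrightarrow> 0"
    using assms by (simp add: AH_rel_def)
  then have "(\<lambda>k. AH_seminorm (X k) - AH_seminorm (Y k)) \<longlonglongrightarrow> 0"
    by (rule Lim_null_comparison[rotated]) (simp add: csn_abs_diff[OF AHs])
  moreover obtain L where "(\<lambda>k. AH_seminorm (X k)) \<longlonglongrightarrow> L"
    using assms AH_Cauchy_Cauchy_norm unfolding AH_rel_def convergent_def by blast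
  ultimately have "(\<lambda>k. AH_seminorm (X k) - (AH_seminorm (X k) - AH_seminorm (Y k))) \<longlonglongrightarrow> L - 0"
    by (intro tendsto_diff)
  then show ?thesis using \<open>(\<lambda>k. AH_seminorm (X k)) \<longlonglongrightarrow> L\<close> by (simp add: limI)
qed

instantiation AH_free :: "{zero, one, plus, minus, uminus, times, scaleC, star}"
begin

lift_definition zero_AH_free :: AH_free is "\<lambda>_. 0"
  by (intro AH_rel_refl AH_Cauchy_const)

lift_definition one_AH_free :: AH_free is "\<lambda>_. 1"
  by (intro AH_rel_refl AH_Cauchy_const)

lift_definition plus_AH_free :: "AH_free \<Rightarrow> AH_free \<Rightarrow> AH_free" is "\<lambda>X Y k. X k + Y k"
proof -
  fix X X' Y Y' assume *: "AH_rel X X'" "AH_rel Y Y'"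
  have "(\<lambda>k. AH_seminorm (X k + Y k - (X' k + Y' k))) \<longlonglongrightarrow> 0"
  proof (rule AH_null_bound)
    show "AH_seminorm (X k + Y k - (X' k + Y' k)) \<le> AH_seminorm (X k - X' k) + AH_seminorm (Y k - Y' k)" for k
      using csn_add[OF AHs, of "X k - X' k" "Y k - Y' k"] by (simp add: algebra_simps)
  qed (use * in \<open>auto simp: AH_rel_def intro!: tendsto_eq_intros\<close>)
  then show "AH_rel (\<lambda>k. X k + Y k) (\<lambda>k. X' k + Y' k)"
    using * by (simp add: AH_rel_def AH_Cauchy_add)
qed

lift_definition scaleC_AH_free :: "complex \<Rightarrow> AH_free \<Rightarrow> AH_free" is "\<lambda>c X k. fscale c (X k)"
  by (auto simp: AH_rel_def AH_Cauchy_scale csn_scale[OF AHs] intro!: tendsto_eq_intros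
      simp flip: fscale_diff_right)

lift_definition times_AH_free :: "AH_free \<Rightarrow> AH_free \<Rightarrow> AH_free" is "\<lambda>X Y k. X k * Y k"
proof -
  fix X X' Y Y' assume *: "AH_rel X X'" "AH_rel Y Y'"
  then obtain B C where BC: "\<And>k. AH_seminorm (X' k) \<le> B" "\<And>k. AH_seminorm (Y k) \<le> C"
    unfolding AH_rel_def using AH_Cauchy_bounded by metis
  have "(\<lambda>k. AH_seminorm (X k * Y k - X' k * Y' k)) \<longlonglongrightarrow> 0"
  proof (rule AH_null_bound)
    show "AH_seminorm (X k * Y k - X' k * Y' k) \<le>
        C * AH_seminorm (X k - X' k) + B * AH_seminorm (Y k - Y' k)" for k
      by (intro order_trans[OF AH_diff_mult_le] add_mono mult_right_mono AH_seminorm_nonneg BC)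
  qed (use * in \<open>auto simp: AH_rel_def intro!: tendsto_eq_intros\<close>)
  then show "AH_rel (\<lambda>k. X k * Y k) (\<lambda>k. X' k * Y' k)"
    using * by (simp add: AH_rel_def AH_Cauchy_mult)
qed

lift_definition star_AH_free :: "AH_free \<Rightarrow> AH_free" is "\<lambda>X k. fstar (X k)"
  by (simp add: AH_rel_def AH_Cauchy_star csn_star[OF AHs] flip: fstar_diff)

definition uminus_AH_free :: "AH_free \<Rightarrow> AH_free" where "- (x :: AH_free) = (-1) *\<^sub>C x"
definition minus_AH_free :: "AH_free \<Rightarrow> AH_free \<Rightarrow> AH_free" where "(x :: AH_free) - y = x + - y"
definition scaleR_AH_free :: "real \<Rightarrow> AH_free \<Rightarrow> AH_free" where "r *\<^sub>R (x :: AH_free) = complex_of_real r *\<^sub>C x"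
instance ..

end

lift_definition AH_of :: "gen free_alg \<Rightarrow> AH_free" is "\<lambda>x _. x"
  by (intro AH_rel_refl AH_Cauchy_const)

definition AH_gen :: "nat \<Rightarrow> nat \<Rightarrow> nat \<Rightarrow> AH_free" where
  "AH_gen n r s = AH_of (fgen (n,r,s))"

lemma AH_rel_self: "AH_rel X X \<longleftrightarrow> AH_Cauchy X"
  using AH_rel_refl by (auto simp: AH_rel_def)

lemmas AH_Cauchy_intros = AH_Cauchy_const AH_Cauchy_add AH_Cauchy_mult AH_Cauchy_scale AH_Cauchy_star

instance AH_free :: ring_1
proof
  fix a b c :: AH_free
  show "a + b + c = a + (b + c)"
    by transfer (simp add: AH_rel_self add.assoc AH_Cauchy_intros)
  show "a + b = b + a"
    by transfer (simp add: add.commute AH_rel_self AH_Cauchy_intros)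
  show "0 + a = a"
    by transfer simp
  show "- a + a = 0"
    unfolding uminus_AH_free_def
    by transfer (simp add: fscale_minus_one AH_rel_refl AH_Cauchy_const)
  show "a - b = a + - b"
    by (rule minus_AH_free_def)
  show "a * b * c = a * (b * c)"
    by transfer (simp add: AH_rel_self mult.assoc AH_Cauchy_intros)
  show "1 * a = a" "a * 1 = a"
    by (transfer, simp)+
  show "(a + b) * c = a * c + b * c"
    by transfer (simp add: AH_rel_self distrib_right AH_Cauchy_intros)
  show "a * (b + c) = a * b + a * c"
    by transfer (simp add: AH_rel_self distrib_left AH_Cauchy_intros)
  show "(0 :: AH_free) \<noteq> 1"
  proof transfer
    have "hyperoctahedral 0 (\<lambda>_ _. 1 :: complex)" by (simp add: hyperoctahedral_def)
    then obtain V :: "gen \<Rightarrow> complex" where "AH_family V"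
      using AH_family_extend by metis
    then have "1 \<le> AH_seminorm 1" using AH_family_le[of V 1] by simp
    then show "\<not> AH_rel (\<lambda>_. 0) (\<lambda>_. 1)"
      by (auto simp: AH_rel_def csn_uminus[OF AHs] LIMSEQ_const_iff)
  qed
qed

lemma AH_norm_tendsto: "AH_Cauchy X \<Longrightarrow> (\<lambda>k. AH_seminorm (X k)) \<longlonglongrightarrow> lim (\<lambda>k. AH_seminorm (X k))"
  using AH_Cauchy_Cauchy_norm by (simp add: convergent_LIMSEQ_iff)

lemma AH_lim_le:
  assumes "AH_Cauchy X" "f \<longlonglongrightarrow> L" "\<And>k. AH_seminorm (X k) \<le> f k"
  shows "lim (\<lambda>k. AH_seminorm (X k)) \<le> L"
  using assms by (intro LIMSEQ_le[OF AH_norm_tendsto]) auto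

lemma AH_of_diff: "AH_of x - AH_of y = AH_of (x - y)"
  unfolding minus_AH_free_def uminus_AH_free_def
  by transfer (simp add: fscale_minus_one AH_rel_refl AH_Cauchy_const)

instantiation AH_free :: complex_normed_vector
begin

lift_definition norm_AH_free :: "AH_free \<Rightarrow> real" is "\<lambda>X. lim (\<lambda>k. AH_seminorm (X k))"
  by (rule AH_rel_lim)

definition dist_AH_free :: "AH_free \<Rightarrow> AH_free \<Rightarrow> real" where "dist (x :: AH_free) y = norm (x - y)"
definition sgn_AH_free :: "AH_free \<Rightarrow> AH_free" where "sgn (x :: AH_free) = complex_of_real (inverse (norm x)) *\<^sub>C x"
definition uniformity_AH_free :: "(AH_free \<times> AH_free) filter" where
  "uniformity = (INF e\<in>{0<..}. principal {(x, y). dist (x :: AH_free) y < e})"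
definition open_AH_free :: "AH_free set \<Rightarrow> bool" where
  "open (U :: AH_free set) \<longleftrightarrow> (\<forall>x\<in>U. \<forall>\<^sub>F (x', y) in uniformity. x' = x \<longrightarrow> y \<in> U)"

instance
proof
  fix x y :: AH_free and a b :: real and c d :: complex
  have add_right: "c *\<^sub>C (x + y) = c *\<^sub>C x + c *\<^sub>C y" for c and x y :: AH_free
    by transfer (simp add: fscale_add_right AH_rel_self AH_Cauchy_intros)
  have add_left: "(c + d) *\<^sub>C x = c *\<^sub>C x + d *\<^sub>C x" for c d and x :: AH_free
    by transfer (simp add: fscale_add_left AH_rel_self AH_Cauchy_intros)
  have assoc: "c *\<^sub>C d *\<^sub>C x = (c * d) *\<^sub>C x" for c d and x :: AH_free
    by transfer (simp add: fscale_fscale AH_rel_self AH_Cauchy_intros)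
  have nrm: "norm (c *\<^sub>C x) = cmod c * norm x" for c and x :: AH_free
  proof (transfer fixing: c)
    fix X assume "AH_rel X X"
    then have X: "AH_Cauchy X" by (simp add: AH_rel_self)
    show "lim (\<lambda>k. AH_seminorm (fscale c (X k))) = cmod c * lim (\<lambda>k. AH_seminorm (X k))"
      unfolding csn_scale[OF AHs] by (rule limI[OF tendsto_mult_left[OF AH_norm_tendsto[OF X]]])
  qed
  show "c *\<^sub>C (x + y) = c *\<^sub>C x + c *\<^sub>C y" "(c + d) *\<^sub>C x = c *\<^sub>C x + d *\<^sub>C x"
    "c *\<^sub>C d *\<^sub>C x = (c * d) *\<^sub>C x" "norm (c *\<^sub>C x) = cmod c * norm x"
    by (fact add_right add_left assoc nrm)+
  show "a *\<^sub>R x = complex_of_real a *\<^sub>C x" by (rule scaleR_AH_free_def)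
  show "a *\<^sub>R (x + y) = a *\<^sub>R x + a *\<^sub>R y" "(a + b) *\<^sub>R x = a *\<^sub>R x + b *\<^sub>R x"
    "a *\<^sub>R b *\<^sub>R x = (a * b) *\<^sub>R x" "norm (a *\<^sub>R x) = \<bar>a\<bar> * norm x"
    by (simp_all add: scaleR_AH_free_def add_right add_left assoc nrm)
  show "1 *\<^sub>R x = x"
    unfolding scaleR_AH_free_def by transfer (simp add: fscale_one)
  show "dist x y = norm (x - y)" by (rule dist_AH_free_def)
  show "sgn x = x /\<^sub>R norm x" by (simp only: sgn_AH_free_def scaleR_AH_free_def)
  show "uniformity = (INF e\<in>{0<..}. principal {(x, y). dist (x::AH_free) y < e})"
    by (rule uniformity_AH_free_def)
  show "open U \<longleftrightarrow> (\<forall>x\<in>U. \<forall>\<^sub>F (x', y) in uniformity. x' = x \<longrightarrow> y \<in> U)" for U :: "AH_free set"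
    by (rule open_AH_free_def)
  show "norm (x + y) \<le> norm x + norm y"
  proof transfer
    fix X Y assume "AH_rel X X" "AH_rel Y Y"
    then have X: "AH_Cauchy X" and Y: "AH_Cauchy Y" by (simp_all add: AH_rel_self)
    show "lim (\<lambda>k. AH_seminorm (X k + Y k)) \<le> lim (\<lambda>k. AH_seminorm (X k)) + lim (\<lambda>k. AH_seminorm (Y k))"
      by (rule AH_lim_le[OF AH_Cauchy_add[OF X Y] tendsto_add[OF AH_norm_tendsto[OF X] AH_norm_tendsto[OF Y]]])
        (rule csn_add[OF AHs])
  qed
  show "norm x = 0 \<longleftrightarrow> x = 0"
  proof transfer
    fix X assume "AH_rel X X"
    then have X: "AH_Cauchy X" by (simp add: AH_rel_self)
    have "AH_rel X (\<lambda>_. 0) \<longleftrightarrow> (\<lambda>k. AH_seminorm (X k)) \<longlonglongrightarrow> 0"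
      by (simp add: AH_rel_def X AH_Cauchy_const)
    then show "lim (\<lambda>k. AH_seminorm (X k)) = 0 \<longleftrightarrow> AH_rel X (\<lambda>_. 0)"
      using AH_norm_tendsto[OF X] LIMSEQ_unique by metis
  qed
qed

end

lemma norm_AH_of: "norm (AH_of x) = AH_seminorm x"
  by transfer simp

lemma AH_of_dense:
  assumes "e > 0"
  obtains p where "norm (x - AH_of p) < e"
proof -
  have "\<exists>p. norm (x + (-1) *\<^sub>C AH_of p) < e"
  proof (transfer fixing: e)
    fix X assume "AH_rel X X"
    then have X: "AH_Cauchy X" by (simp add: AH_rel_self)
    obtain M where M: "\<And>m n. m \<ge> M \<Longrightarrow> n \<ge> M \<Longrightarrow> AH_seminorm (X m - X n) < e / 2"
      using X assms unfolding AH_Cauchy_def by (metis half_gt_zero)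
    have C: "AH_Cauchy (\<lambda>k. X k + fscale (-1) (X M))" by (intro AH_Cauchy_intros X)
    have "\<forall>k\<ge>M. AH_seminorm (X k + fscale (-1) (X M)) \<le> e / 2"
      using M[of _ M] by (auto simp: fscale_minus_one less_imp_le)
    then have "lim (\<lambda>k. AH_seminorm (X k + fscale (-1) (X M))) \<le> e / 2"
      by (intro LIMSEQ_le_const2[OF AH_norm_tendsto[OF C]]) blast
    then show "\<exists>p. lim (\<lambda>k. AH_seminorm (X k + fscale (-1) p)) < e"
      using assms by (intro exI[of _ "X M"]) simp
  qed
  then show ?thesis using that by (auto simp: minus_AH_free_def uminus_AH_free_def)
qed

instance AH_free :: banach
proof
  fix Z :: "nat \<Rightarrow> AH_free" assume Z: "Cauchy Z"
  have "\<exists>p. norm (Z k - AH_of p) < 1 / Suc k" for k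
    by (rule AH_of_dense[of "1 / Suc k" "Z k"]) auto
  then obtain P where P: "\<And>k. norm (Z k - AH_of (P k)) < 1 / Suc k" by metis
  have lim0: "(\<lambda>k. Z k - AH_of (P k)) \<longlonglongrightarrow> 0"
    by (rule Lim_null_comparison[OF _ LIMSEQ_inverse_real_of_nat])
      (use P in \<open>auto simp: inverse_eq_divide intro!: less_imp_le always_eventually\<close>)
  have "Cauchy (\<lambda>k. AH_of (P k))"
  proof (rule metric_CauchyI)
    fix e :: real assume "e > 0"
    then have "e / 3 > 0" by simp
    then obtain M N where M: "\<And>m n. m \<ge> M \<Longrightarrow> n \<ge> M \<Longrightarrow> norm (Z m - Z n) < e / 3"
      and N: "\<And>n. n \<ge> N \<Longrightarrow> norm (Z n - AH_of (P n)) < e / 3"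
      using Z LIMSEQ_D[OF lim0] unfolding Cauchy_def dist_norm by (metis diff_zero)
    have "dist (AH_of (P m)) (AH_of (P n)) < e" if "m \<ge> max M N" "n \<ge> max M N" for m n
    proof -
      have "AH_of (P m) - AH_of (P n) = (Z m - Z n) + ((Z n - AH_of (P n)) - (Z m - AH_of (P m)))"
        by simp
      then have "norm (AH_of (P m) - AH_of (P n)) \<le>
          norm (Z m - Z n) + (norm (Z n - AH_of (P n)) + norm (Z m - AH_of (P m)))"
        using norm_triangle_ineq[of "Z m - Z n" "(Z n - AH_of (P n)) - (Z m - AH_of (P m))"]
          norm_triangle_ineq4[of "Z n - AH_of (P n)" "Z m - AH_of (P m)"] by simp
      then show ?thesis using M[of m n] N[of m] N[of n] that by (simp add: dist_norm)
    qed
    then show "\<exists>M. \<forall>m\<ge>M. \<forall>n\<ge>M. dist (AH_of (P m)) (AH_of (P n)) < e" by blast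
  qed
  then have CP: "AH_Cauchy P"
    by (simp add: Cauchy_def dist_norm AH_of_diff norm_AH_of AH_Cauchy_def)
  have CP': "AH_Cauchy (\<lambda>j. P k + fscale (-1) (P j))" for k
    by (intro AH_Cauchy_intros CP)
  define x where "x = abs_AH_free P"
  have x: "norm (AH_of (P k) - x) = lim (\<lambda>j. AH_seminorm (P k - P j))" for k
  proof -
    have "AH_of (P k) - x = abs_AH_free (\<lambda>j. P k + fscale (-1) (P j))"
      using CP unfolding x_def minus_AH_free_def uminus_AH_free_def
      by (simp add: AH_of.abs_eq scaleC_AH_free.abs_eq plus_AH_free.abs_eq AH_rel_self AH_Cauchy_intros)
    then show ?thesis
      using CP'[of k] by (simp add: norm_AH_free.abs_eq AH_rel_self fscale_minus_one)
  qed
  have "(\<lambda>k. AH_of (P k)) \<longlonglongrightarrow> x"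
  proof (rule LIMSEQ_I)
    fix e :: real assume "e > 0"
    then obtain M where M: "\<And>m n. m \<ge> M \<Longrightarrow> n \<ge> M \<Longrightarrow> AH_seminorm (P m - P n) < e / 2"
      using CP unfolding AH_Cauchy_def by (metis half_gt_zero)
    have "norm (AH_of (P k) - x) < e" if "k \<ge> M" for k
    proof -
      have "(\<lambda>j. AH_seminorm (P k - P j)) \<longlonglongrightarrow> lim (\<lambda>j. AH_seminorm (P k - P j))"
        using AH_norm_tendsto[OF CP'[of k]] by (simp add: fscale_minus_one)
      then have "lim (\<lambda>j. AH_seminorm (P k - P j)) \<le> e / 2"
        using M[OF that] by (intro LIMSEQ_le_const2) (auto intro: less_imp_le)
      then show ?thesis using x \<open>e > 0\<close> by simp
    qed
    then show "\<exists>M. \<forall>k\<ge>M. norm (AH_of (P k) - x) < e" by blast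
  qed
  then have "(\<lambda>k. (Z k - AH_of (P k)) + AH_of (P k)) \<longlonglongrightarrow> 0 + x"
    by (intro tendsto_add lim0)
  then show "convergent Z" by (auto simp: convergent_def)
qed

instance AH_free :: cstar_algebra
proof
  fix x y :: AH_free and a :: real and c :: complex
  have L: "(c *\<^sub>C x) * y = c *\<^sub>C (x * y)" for c and x y :: AH_free
    by transfer (simp add: fscale_mult_left AH_rel_self AH_Cauchy_intros)
  have R: "x * (c *\<^sub>C y) = c *\<^sub>C (x * y)" for c and x y :: AH_free
    by transfer (simp add: fscale_mult_right AH_rel_self AH_Cauchy_intros)
  show "(c *\<^sub>C x) * y = c *\<^sub>C (x * y)" "x * (c *\<^sub>C y) = c *\<^sub>C (x * y)"
    by (fact L R)+
  show "(a *\<^sub>R x) * y = a *\<^sub>R (x * y)" "x * (a *\<^sub>R y) = a *\<^sub>R (x * y)"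
    by (simp_all add: scaleR_scaleC L R)
  show "star (star x) = x"
    by transfer simp
  show "star (x + y) = star x + star y"
    by transfer (simp add: fstar_add AH_rel_self AH_Cauchy_intros)
  show "star (x * y) = star y * star x"
    by transfer (simp add: fstar_mult AH_rel_self AH_Cauchy_intros)
  show "star (c *\<^sub>C x) = cnj c *\<^sub>C star x"
    by transfer (simp add: fstar_fscale AH_rel_self AH_Cauchy_intros)
  show cst: "norm (star x * x) = (norm x)\<^sup>2" for x :: AH_free
  proof transfer
    fix X assume "AH_rel X X"
    then have X: "AH_Cauchy X" by (simp add: AH_rel_self)
    show "lim (\<lambda>k. AH_seminorm (fstar (X k) * X k)) = (lim (\<lambda>k. AH_seminorm (X k)))\<^sup>2"
      unfolding csn_cstar[OF AHs] by (rule limI[OF tendsto_power[OF AH_norm_tendsto[OF X]]])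
  qed
  show "norm (x * y) \<le> norm x * norm y"
  proof transfer
    fix X Y assume "AH_rel X X" "AH_rel Y Y"
    then have X: "AH_Cauchy X" and Y: "AH_Cauchy Y" by (simp_all add: AH_rel_self)
    show "lim (\<lambda>k. AH_seminorm (X k * Y k)) \<le> lim (\<lambda>k. AH_seminorm (X k)) * lim (\<lambda>k. AH_seminorm (Y k))"
      by (rule AH_lim_le[OF AH_Cauchy_mult[OF X Y] tendsto_mult[OF AH_norm_tendsto[OF X] AH_norm_tendsto[OF Y]]])
        (rule csn_mult[OF AHs])
  qed
  have "star (1 :: AH_free) = 1" by transfer (simp add: AH_rel_refl AH_Cauchy_const)
  then have "norm (1 :: AH_free) = (norm (1 :: AH_free))\<^sup>2" using cst[of 1] by simp
  moreover have "norm (1 :: AH_free) \<noteq> 0" by simp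
  ultimately show "norm (1 :: AH_free) = 1" by (simp add: power2_eq_square)
qed

subsection \<open>The universal property\<close>

definition AH :: "nat \<Rightarrow> AH_free set" where
  "AH n = closure (star_alg_gen {AH_gen n r s |r s. r \<in> {1..n} \<and> s \<in> {1..n}})"

lemma AH_gen_in_AH: "r \<in> {1..n} \<Longrightarrow> s \<in> {1..n} \<Longrightarrow> AH_gen n r s \<in> AH n"
  unfolding AH_def star_alg_gen_def by (rule subsetD[OF closure_subset]) (blast intro: alg_gen.gen)

lemma AH_of_zero [simp]: "AH_of 0 = 0"
  by transfer (simp add: AH_rel_refl AH_Cauchy_const)

lemma AH_of_one [simp]: "AH_of 1 = 1"
  by transfer (simp add: AH_rel_refl AH_Cauchy_const)

lemma AH_of_add: "AH_of (x + y) = AH_of x + AH_of y"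
  by transfer (simp add: AH_rel_refl AH_Cauchy_const)

lemma AH_of_mult: "AH_of (x * y) = AH_of x * AH_of y"
  by transfer (simp add: AH_rel_refl AH_Cauchy_const)

lemma AH_of_star: "AH_of (fstar x) = star (AH_of x)"
  by transfer (simp add: AH_rel_refl AH_Cauchy_const)

lemma AH_of_sum: "AH_of (\<Sum>k\<in>K. f k) = (\<Sum>k\<in>K. AH_of (f k))"
  by (induction K rule: infinite_finite_induct) (simp_all add: AH_of_add)

lemma AH_of_relator: "x \<in> AH_relators \<Longrightarrow> AH_of x = 0"
  using AH_seminorm_relator norm_AH_of[of x] by simp

theorem AH_gen_hyperoctahedral: "hyperoctahedral n (AH_gen n)"
  unfolding hyperoctahedral_def
proof (intro conjI ballI impI)
  fix r s assume rs: "r \<in> {1..n}" "s \<in> {1..n}"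
  have one: "AH_of (if r = s then 1 else 0) = (if r = s then 1 else 0)" by simp
  show "star (AH_gen n r s) = AH_gen n r s"
    by (simp add: AH_gen_def flip: AH_of_star)
  have "(\<Sum>k=1..n. fgen (n,r,k) * fstar (fgen (n,s,k))) - (if r = s then 1 else 0) \<in> AH_relators"
    unfolding AH_relators_def using rs by blast
  from AH_of_relator[OF this]
  show "(\<Sum>k=1..n. AH_gen n r k * star (AH_gen n s k)) = (if r = s then 1 else 0)"
    by (simp only: AH_gen_def AH_of_sum AH_of_mult AH_of_star one right_minus_eq flip: AH_of_diff)
  have "(\<Sum>k=1..n. fstar (fgen (n,k,r)) * fgen (n,k,s)) - (if r = s then 1 else 0) \<in> AH_relators"
    unfolding AH_relators_def using rs by blast
  from AH_of_relator[OF this]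
  show "(\<Sum>k=1..n. star (AH_gen n k r) * AH_gen n k s) = (if r = s then 1 else 0)"
    by (simp only: AH_gen_def AH_of_sum AH_of_mult AH_of_star one right_minus_eq flip: AH_of_diff)
next
  fix i j k assume ijk: "i \<in> {1..n}" "j \<in> {1..n}" "k \<in> {1..n}" "j \<noteq> k"
  have "fgen (n,i,j) * fgen (n,i,k) \<in> AH_relators" "fgen (n,j,i) * fgen (n,k,i) \<in> AH_relators"
    unfolding AH_relators_def using ijk by blast+
  then show "AH_gen n i j * AH_gen n i k = 0" "AH_gen n j i * AH_gen n k i = 0"
    by (auto simp: AH_gen_def AH_of_relator simp flip: AH_of_mult)
qed

lemma feval_Cauchy:
  assumes "AH_family V" "AH_Cauchy X"
  shows "convergent (\<lambda>k. feval V (X k))"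
proof -
  have "Cauchy (\<lambda>k. feval V (X k))"
    unfolding Cauchy_def dist_norm feval_diff[symmetric]
    using assms(2) AH_family_le[OF assms(1)] unfolding AH_Cauchy_def by (meson order_le_less_trans)
  then show ?thesis by (simp add: Cauchy_convergent_iff)
qed

lift_definition AH_eval :: "(gen \<Rightarrow> 'a::cstar_algebra) \<Rightarrow> AH_free \<Rightarrow> 'a" is
  "\<lambda>V X. if AH_family V then lim (\<lambda>k. feval V (X k)) else 0"
proof (cases)
  fix V :: "gen \<Rightarrow> 'a" and X Y
  assume XY: "AH_rel X Y" and V: "AH_family V"
  have "(\<lambda>k. AH_seminorm (X k - Y k)) \<longlonglongrightarrow> 0"
    using XY by (simp add: AH_rel_def)
  then have "(\<lambda>k. feval V (X k) - feval V (Y k)) \<longlonglongrightarrow> 0"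
    by (rule Lim_null_comparison[rotated]) (simp add: AH_family_le[OF V] flip: feval_diff)
  moreover obtain L where L: "(\<lambda>k. feval V (X k)) \<longlonglongrightarrow> L"
    using XY feval_Cauchy[OF V] unfolding AH_rel_def convergent_def by blast
  ultimately have "(\<lambda>k. feval V (X k) - (feval V (X k) - feval V (Y k))) \<longlonglongrightarrow> L - 0"
    by (intro tendsto_diff)
  then show "(if AH_family V then lim (\<lambda>k. feval V (X k)) else 0) =
      (if AH_family V then lim (\<lambda>k. feval V (Y k)) else 0)"
    using L by (simp add: limI)
qed simp

lemma tendsto_star:
  fixes f :: "'b \<Rightarrow> 'a::cstar_algebra"
  assumes "(f \<longlongrightarrow> l) F"
  shows "((\<lambda>x. star (f x)) \<longlongrightarrow> star l) F"
proof -
  have minus: "star (- y) = - star y" for y :: 'a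
    using star_add[of y "- y"] by (simp add: eq_neg_iff_add_eq_0 add.commute)
  have "((\<lambda>x. f x - l) \<longlongrightarrow> 0) F" using assms by (simp add: LIM_zero_iff)
  then have "((\<lambda>x. norm (star (f x - l))) \<longlongrightarrow> 0) F"
    unfolding norm_star by (rule tendsto_norm_zero)
  then have "((\<lambda>x. star (f x - l)) \<longlongrightarrow> 0) F" by (rule tendsto_norm_zero_cancel)
  moreover have "star (f x - l) = star (f x) - star l" for x
    using star_add[of "f x" "- l"] by (simp add: minus)
  ultimately show ?thesis by (simp add: LIM_zero_iff)
qed

lemma tendsto_scaleC:
  fixes f :: "'b \<Rightarrow> 'a::complex_normed_vector"
  assumes "(f \<longlongrightarrow> l) F"
  shows "((\<lambda>x. c *\<^sub>C f x) \<longlongrightarrow> c *\<^sub>C l) F"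
proof -
  have minus: "c *\<^sub>C (- y) = - (c *\<^sub>C y)" for y :: 'a
    using scaleC_add_right[of c y "- y"] by (simp add: eq_neg_iff_add_eq_0 add.commute)
  have "((\<lambda>x. f x - l) \<longlongrightarrow> 0) F" using assms by (simp add: LIM_zero_iff)
  then have "((\<lambda>x. cmod c * norm (f x - l)) \<longlongrightarrow> 0) F"
    by (intro tendsto_mult_right_zero) (simp add: tendsto_norm_zero_iff)
  then have "((\<lambda>x. c *\<^sub>C f x + c *\<^sub>C (- l)) \<longlongrightarrow> 0) F"
    by (simp add: tendsto_norm_zero_iff flip: scaleC_add_right norm_scaleC)
  then show ?thesis by (simp add: minus LIM_zero_iff)
qed

lemma AH_eval_hom:
  assumes V: "AH_family V"
  shows "unital_star_hom (AH_eval V)" "norm (AH_eval V x) \<le> norm x" "AH_eval V (AH_of p) = feval V p"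
proof -
  have lims: "(\<lambda>k. feval V (X k)) \<longlonglongrightarrow> lim (\<lambda>k. feval V (X k))" if "AH_rel X X" for X
    using feval_Cauchy[OF V, of X] that by (simp add: convergent_LIMSEQ_iff AH_rel_self)
  have "AH_eval V 1 = 1"
    by (transfer fixing: V) (simp add: V)
  moreover have "AH_eval V (x + y) = AH_eval V x + AH_eval V y" for x y
    by (transfer fixing: V) (simp add: V feval_add limI[OF tendsto_add[OF lims lims]])
  moreover have "AH_eval V (x * y) = AH_eval V x * AH_eval V y" for x y
    by (transfer fixing: V) (simp add: V feval_mult limI[OF tendsto_mult[OF lims lims]])
  moreover have "AH_eval V (c *\<^sub>C x) = c *\<^sub>C AH_eval V x" for c x
    by (transfer fixing: V c) (simp add: V feval_scale limI[OF tendsto_scaleC[OF lims]])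
  moreover have "feval V (fstar p) = star (feval V p)" for p
    using V by (intro feval_star) (auto simp: AH_family_def)
  then have "AH_eval V (star x) = star (AH_eval V x)" for x
    by (transfer fixing: V) (simp add: V limI[OF tendsto_star[OF lims]])
  ultimately show "unital_star_hom (AH_eval V)" by (simp add: unital_star_hom_def)
  show "norm (AH_eval V x) \<le> norm x"
  proof (transfer fixing: V)
    fix X assume X: "AH_rel X X"
    have "norm (lim (\<lambda>k. feval V (X k))) \<le> lim (\<lambda>k. AH_seminorm (X k))"
      using X by (intro LIMSEQ_le[OF tendsto_norm[OF lims[OF X]] AH_norm_tendsto])
        (auto simp: AH_rel_self AH_family_le[OF V])
    then show "norm (if AH_family V then lim (\<lambda>k. feval V (X k)) else 0) \<le> lim (\<lambda>k. AH_seminorm (X k))"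
      by (simp add: V)
  qed
  show "AH_eval V (AH_of p) = feval V p"
    by (transfer fixing: V) (simp add: V)
qed

theorem AH_universal:
  fixes v :: "nat \<Rightarrow> nat \<Rightarrow> 'a::cstar_algebra"
  assumes "hyperoctahedral n v"
  shows "\<exists>h :: AH_free \<Rightarrow> 'a. unital_star_hom h \<and> (\<forall>x. norm (h x) \<le> norm x) \<and>
           (\<forall>r\<in>{1..n}. \<forall>s\<in>{1..n}. h (AH_gen n r s) = v r s)"
proof -
  obtain V where V: "AH_family V" "\<And>r s. r \<in> {1..n} \<Longrightarrow> s \<in> {1..n} \<Longrightarrow> V (n,r,s) = v r s"
    using AH_family_extend[OF assms] by blast
  then show ?thesis
    using AH_eval_hom[OF V(1)] by (intro exI[of _ "AH_eval V"]) (simp add: AH_gen_def)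
qed

section \<open>Quantum symmetries of *-distributions\<close>

definition H_invariant :: "('a::cstar_algebra \<Rightarrow> complex) \<Rightarrow> nat \<Rightarrow> (nat \<Rightarrow> 'a) \<Rightarrow> bool" where
  "H_invariant \<phi> n y \<longleftrightarrow>
     (\<forall>k i \<epsilon>. i \<in> {1..k} \<rightarrow> {1..n} \<longrightarrow>
        \<phi> (star_word y k i \<epsilon>) *\<^sub>C (1 :: AH_free) =
          (\<Sum>j \<in> {1..k} \<rightarrow>\<^sub>E {1..n}.
             \<phi> (star_word y k j \<epsilon>) *\<^sub>C prod_list (map (\<lambda>m. AH_gen n (i m) (j m)) [1..<Suc k])))"

definition H_plus_invariant :: "('a::cstar_algebra \<Rightarrow> complex) \<Rightarrow> 'l set \<Rightarrow> ('l \<Rightarrow> 'a) \<Rightarrow> bool" where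
  "H_plus_invariant \<phi> \<Lambda> x \<longleftrightarrow>
     (\<forall>n r. inj_on r {1..n} \<and> r ` {1..n} \<subseteq> \<Lambda> \<longrightarrow> H_invariant \<phi> n (\<lambda>m. x (r m)))"

definition H_bi_invariant :: "('a::cstar_algebra \<Rightarrow> complex) \<Rightarrow> nat \<Rightarrow> (nat \<Rightarrow> nat \<Rightarrow> 'a) \<Rightarrow> bool" where
  "H_bi_invariant \<phi> n x \<longleftrightarrow>
     (\<forall>k i j \<epsilon>. i \<in> {1..k} \<rightarrow> {1..n} \<and> j \<in> {1..k} \<rightarrow> {1..n} \<longrightarrow>
        \<phi> (star_word (\<lambda>(r,s). x r s) k (\<lambda>m. (i m, j m)) \<epsilon>) *\<^sub>C (1 :: AH_free) =
          (\<Sum>l \<in> {1..k} \<rightarrow>\<^sub>E {1..n}.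
             \<phi> (star_word (\<lambda>(r,s). x r s) k (\<lambda>m. (l m, j m)) \<epsilon>) *\<^sub>C
               prod_list (map (\<lambda>m. AH_gen n (i m) (l m)) [1..<Suc k])) \<and>
        \<phi> (star_word (\<lambda>(r,s). x r s) k (\<lambda>m. (i m, j m)) \<epsilon>) *\<^sub>C (1 :: AH_free) =
          (\<Sum>l \<in> {1..k} \<rightarrow>\<^sub>E {1..n}.
             \<phi> (star_word (\<lambda>(r,s). x r s) k (\<lambda>m. (i m, l m)) \<epsilon>) *\<^sub>C
               prod_list (map (\<lambda>m. AH_gen n (l m) (j m)) [1..<Suc k])))"


section \<open>The metric approximation property\<close>

text \<open>Operators on a subspace \<^term>\<open>Y\<close> are functions on the ambient type whose values outside
  \<^term>\<open>Y\<close> are irrelevant.\<close>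

definition finite_rank_contraction :: "'a::complex_normed_vector set \<Rightarrow> ('a \<Rightarrow> 'a) \<Rightarrow> bool" where
  "finite_rank_contraction Y S \<longleftrightarrow>
     (\<forall>y\<in>Y. S y \<in> Y) \<and>
     (\<forall>x\<in>Y. \<forall>y\<in>Y. S (x + y) = S x + S y) \<and> (\<forall>c. \<forall>y\<in>Y. S (c *\<^sub>C y) = c *\<^sub>C S y) \<and>
     (\<exists>B. finite B \<and> B \<subseteq> Y \<and> (\<forall>y\<in>Y. \<exists>c. S y = (\<Sum>b\<in>B. c b *\<^sub>C b))) \<and>
     (\<forall>y\<in>Y. norm (S y) \<le> norm y)"

text \<open>A net of operators is represented by the image of its filter of tails, a proper filter on
  operators; conversely a proper filter is the filter of tails of a net indexed by pairs of a set in
  the filter and an element of that set.\<close>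

definition metric_approximation_property :: "'a::complex_normed_vector set \<Rightarrow> bool" where
  "metric_approximation_property Y \<longleftrightarrow>
     (\<exists>F :: ('a \<Rightarrow> 'a) filter. F \<noteq> bot \<and> (\<forall>\<^sub>F S in F. finite_rank_contraction Y S) \<and>
        (\<forall>y\<in>Y. ((\<lambda>S. norm (S y - y)) \<longlongrightarrow> 0) F))"

end

theory Submission
  imports Defs
begin

text \<open>
  Since the state is a faithful trace, the norm of an element is determined by the moments of its
  absolute square; hence a change of the generators that preserves all *-moments is isometric.
  Invariance under free complexification makes a *-moment vanish unless its total degree (an
  unstarred letter counting $1$, a starred letter $-1$) is $0$, so $x_r \mapsto \mu x_r$ is isometric
  for $|\mu| = 1$, and Fejer means over roots of unity are contractions that truncate the degree.

  If \<^term>\<open>\<Lambda>\<close> is finite, these means have finite rank; this covers the array case.  In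
  the $H^+$-invariant case one also needs $x_r \mapsto \mu x_r$ for the letters outside a finite set
  $F$ only: averaging it over $\mu$ removes all words with a letter outside $F$.  By freeness a
  *-moment reduces to moments of words in which starred and unstarred letters alternate.  For these,
  the representation of $A_H(n)$ by a diagonal matrix of reflections in the plane shows that every
  letter occurs as often starred as unstarred.
\<close>

section \<open>Square roots and positive parts\<close>

text \<open>Freeness alone does not reach every moment. Multiplying each letter by \<open>z\<close>
  turns x x into z x z x, where \<open>z\<close> separates the letters, but x (star x) into z x
  (star x) (star z) and (star x) x into itself, since the inner powers of \<open>z\<close> cancel.
  Alternating words are those that are not broken up, so the quantum symmetry has to control them.
  Classical sign changes would only give the parity of each letter's occurrences; non-commuting
  reflections give an alternating sum of angles, which on an alternating word is, up to sign, a
  weight.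

  The absence of adjoints in the algebra matters: the degree of an unstarred word is its length, so
  over finitely many letters only finitely many words have bounded degree, whereas infinitely many
  words with stars have degree 0.

  The family may satisfy algebraic relations, so scaling and truncation are not obviously defined on
  the algebra. Scaling is therefore a relation between elements, truncation acts on formal
  polynomials, and the norm inequalities supply well-definedness. Square roots given by a power
  series do the work of spectral theory.\<close>

lemma star_minus [simp]: "star (- x) = - star (x :: 'a::cstar_algebra)"
  using star_add[of x "- x"] by (simp add: eq_neg_iff_add_eq_0 add.commute)

lemma scaleC_minus_right: "c *\<^sub>C (- x) = - (c *\<^sub>C (x :: 'a::complex_normed_vector))"
  using scaleC_add_right[of c x "- x"] by (simp add: eq_neg_iff_add_eq_0 add.commute)

lemma scaleC_minus_left: "(- c) *\<^sub>C x = - (c *\<^sub>C (x :: 'a::complex_normed_vector))"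
  using scaleC_add_left[of c "- c" x] by (simp add: eq_neg_iff_add_eq_0 add.commute)

lemma scaleC_diff_right: "c *\<^sub>C (x - y) = c *\<^sub>C x - c *\<^sub>C (y :: 'a::complex_normed_vector)"
  using scaleC_add_right[of c x "- y"] by (simp add: scaleC_minus_right)

lemma scaleC_diff_left: "(c - d) *\<^sub>C x = c *\<^sub>C x - d *\<^sub>C (x :: 'a::complex_normed_vector)"
  using scaleC_add_left[of c "- d" x] by (simp add: scaleC_minus_left)

lemma star_diff: "star (x - y) = star x - star (y :: 'a::cstar_algebra)"
  using star_add[of x "- y"] by simp

lemma star_scaleR: "star (r *\<^sub>R x) = r *\<^sub>R star (x :: 'a::cstar_algebra)"
  by (simp add: scaleR_scaleC star_scaleC)

lemma star_power: "star (x ^ n) = star (x :: 'a::cstar_algebra) ^ n"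
  by (induction n) (simp_all add: star_mult power_commutes)

lemma star_sum: "star (\<Sum>i\<in>I. f i) = (\<Sum>i\<in>I. star (f i :: 'a::cstar_algebra))"
  by (induction I rule: infinite_finite_induct) (simp_all add: star_add)

lemma star_suminf:
  fixes f :: "nat \<Rightarrow> 'a::cstar_algebra"
  assumes "summable f"
  shows "star (suminf f) = suminf (\<lambda>n. star (f n))"
proof -
  have "(\<lambda>n. \<Sum>i<n. star (f i)) \<longlonglongrightarrow> star (suminf f)"
    unfolding star_sum[symmetric] by (intro tendsto_star summable_LIMSEQ assms)
  then show ?thesis by (simp add: sums_def sums_unique)
qed

text \<open>The Taylor coefficients of $\sqrt{1-t}$.\<close>

definition sqrt_coeff :: "nat \<Rightarrow> real" where
  "sqrt_coeff n = pochhammer (- 1/2) n / fact n"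

lemma sqrt_coeff_0 [simp]: "sqrt_coeff 0 = 1"
  by (simp add: sqrt_coeff_def)

lemma sqrt_coeff_Suc_le: "sqrt_coeff (Suc n) \<le> 0"
  using pochhammer_nonneg[of "1/2 :: real" n]
  by (simp add: sqrt_coeff_def pochhammer_rec divide_le_0_iff)

text \<open>Taking partial sums multiplies the series of (1 - t)^(1/2) by that of (1 - t)^(-1),
  which gives the coefficients of (1 - t)^(-1/2). Their non-negativity is what is wanted.\<close>

lemma sqrt_coeff_partial_sum: "(\<Sum>n\<le>N. sqrt_coeff n) = pochhammer (1/2) N / fact N"
proof (induction N)
  case (Suc N)
  let ?P = "pochhammer (1/2) N :: real"
  have "(\<Sum>n\<le>Suc N. sqrt_coeff n) = ?P / fact N + pochhammer (- 1/2) (Suc N) / fact (Suc N)"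
    by (simp only: sum.atMost_Suc Suc.IH) (simp only: sqrt_coeff_def)
  also have "\<dots> = ?P / fact N - 1/2 * ?P / ((real N + 1) * fact N)"
    by (simp add: pochhammer_rec algebra_simps)
  also have "\<dots> = (1/2 + real N) * ?P / ((real N + 1) * fact N)"
    by (simp add: divide_simps) (simp add: algebra_simps)
  also have "\<dots> = pochhammer (1/2) (Suc N) / fact (Suc N)"
    by (simp add: pochhammer_rec' algebra_simps)
  finally show ?case .
qed simp

text \<open>By the Vandermonde identity for Pochhammer symbols the squared series has the
  coefficients \<open>pochhammer (- 1) n / fact n\<close>, which are those of 1 - t.\<close>

lemma sqrt_coeff_square:
  "(\<Sum>i\<le>n. sqrt_coeff i * sqrt_coeff (n - i)) = (if n = 0 then 1 else if n = 1 then - 1 else 0)"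
proof -
  have "pochhammer (- 1/2 + - 1/2) n = (\<Sum>k\<le>n. real (n choose k) * pochhammer (- 1/2) k * pochhammer (- 1/2) (n - k))"
    by (rule pochhammer_binomial_sum)
  also have "\<dots> = fact n * (\<Sum>i\<le>n. sqrt_coeff i * sqrt_coeff (n - i))"
    unfolding sum_distrib_left by (rule sum.cong) (auto simp: sqrt_coeff_def binomial_fact)
  finally have "(\<Sum>i\<le>n. sqrt_coeff i * sqrt_coeff (n - i)) = pochhammer (- 1) n / fact n"
    by (simp add: field_simps)
  then show ?thesis
    using pochhammer_of_nat_eq_0_iff[of 1 n, where 'a = real] by (cases n) (auto simp: pochhammer_rec)
qed

text \<open>The coefficients past the constant term are non-positive while the partial sums stay
  non-negative, so their absolute values add up to at most the constant term 1.\<close>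

lemma sqrt_coeff_summable: "summable (\<lambda>n. \<bar>sqrt_coeff (Suc n)\<bar>)"
  and sqrt_coeff_suminf_le: "suminf (\<lambda>n. \<bar>sqrt_coeff (Suc n)\<bar>) \<le> 1"
proof -
  have le: "(\<Sum>n<N. \<bar>sqrt_coeff (Suc n)\<bar>) \<le> 1" for N
  proof -
    have "(\<Sum>n\<le>N. sqrt_coeff n) = 1 - (\<Sum>n<N. \<bar>sqrt_coeff (Suc n)\<bar>)"
      by (simp add: sum.atMost_shift abs_of_nonpos sqrt_coeff_Suc_le sum_negf)
    moreover have "0 \<le> (\<Sum>n\<le>N. sqrt_coeff n)"
      unfolding sqrt_coeff_partial_sum by (simp add: pochhammer_nonneg)
    ultimately show ?thesis by simp
  qed
  then show "summable (\<lambda>n. \<bar>sqrt_coeff (Suc n)\<bar>)"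
    by (intro summableI_nonneg_bounded[where x = 1]) auto
  then show "suminf (\<lambda>n. \<bar>sqrt_coeff (Suc n)\<bar>) \<le> 1"
    using le by (intro suminf_le_const) auto
qed

text \<open>The coefficients are absolutely summable, so the series may be used up to
  \<open>norm k = 1\<close>. The bound on \<open>norm (1 - v)\<close> allows a second application
  with \<open>1 - v\<close> in place of \<open>k\<close>, which iterated roots require.\<close>

lemma cstar_sqrt:
  fixes k :: "'a::cstar_algebra"
  assumes k: "star k = k" "norm k \<le> 1"
  shows "\<exists>v. star v = v \<and> v * v = 1 - k \<and> norm (1 - v) \<le> 1 \<and> (\<forall>y. y * k = k * y \<longrightarrow> y * v = v * y)"
proof (intro exI conjI allI impI)
  define f where "f n = sqrt_coeff n *\<^sub>R k ^ n" for n
  define v where "v = suminf f"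
  have le: "norm (f n) \<le> \<bar>sqrt_coeff n\<bar>" for n
  proof -
    have "norm (k ^ n) \<le> 1"
      using norm_power_ineq[of k n] power_le_one[OF norm_ge_zero k(2), of n] by linarith
    then show ?thesis by (simp add: f_def mult_left_le)
  qed
  have "summable (\<lambda>n. \<bar>sqrt_coeff n\<bar>)"
    using sqrt_coeff_summable by (subst (asm) summable_Suc_iff)
  then have sn: "summable (\<lambda>n. norm (f n))"
    by (rule summable_comparison_test'[where N = 0]) (simp add: le)
  then have s: "summable f" by (rule summable_norm_cancel)
  have "star (f n) = f n" for n
    by (simp add: f_def star_scaleR star_power k(1))
  then show "star v = v" unfolding v_def star_suminf[OF s] by simp
  have eq: "(\<Sum>i\<le>n. f i * f (n - i)) = (if n = 0 then 1 else if n = 1 then - k else 0)" for n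
  proof -
    have "(\<Sum>i\<le>n. f i * f (n - i)) = (\<Sum>i\<le>n. sqrt_coeff i * sqrt_coeff (n - i)) *\<^sub>R k ^ n"
      unfolding scaleR_sum_left by (rule sum.cong) (auto simp: f_def simp flip: power_add)
    then show ?thesis by (simp add: sqrt_coeff_square)
  qed
  have "(\<lambda>n. \<Sum>i\<le>n. f i * f (n - i)) sums (v * v)"
    unfolding v_def by (rule Cauchy_product_sums[OF sn sn])
  moreover have "(\<lambda>n. \<Sum>i\<le>n. f i * f (n - i)) sums (\<Sum>n\<in>{0,1}. \<Sum>i\<le>n. f i * f (n - i))"
    by (rule sums_finite) (auto simp: eq)
  ultimately have "v * v = (\<Sum>n\<in>{0,1}. \<Sum>i\<le>n. f i * f (n - i))" by (rule sums_unique2)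
  then show "v * v = 1 - k" by (simp add: eq del: sum.atMost_Suc)
  have sn': "summable (\<lambda>n. norm (f (Suc n)))"
    using sn by (subst summable_Suc_iff)
  have "v = f 0 + suminf (\<lambda>n. f (Suc n))" unfolding v_def using suminf_split_head[OF s] by simp
  then have "1 - v = - suminf (\<lambda>n. f (Suc n))" by (simp add: f_def)
  then have "norm (1 - v) = norm (suminf (\<lambda>n. f (Suc n)))" by simp
  also have "\<dots> \<le> suminf (\<lambda>n. norm (f (Suc n)))"
    by (rule summable_norm[OF sn'])
  also have "\<dots> \<le> suminf (\<lambda>n. \<bar>sqrt_coeff (Suc n)\<bar>)"
    by (rule suminf_le[OF le sn' sqrt_coeff_summable])
  finally show "norm (1 - v) \<le> 1" using sqrt_coeff_suminf_le by linarith
  show "y * v = v * y" if y: "y * k = k * y" for y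
  proof -
    have "y * f n = f n * y" for n
      using power_commuting_commutes[OF y[symmetric], of n] by (simp add: f_def)
    then show ?thesis
      by (simp add: v_def s flip: suminf_mult suminf_mult2)
  qed
qed

text \<open>The element \<open>a\<close> is the real part of
  \<open>u = a + \<i> *\<^sub>C b\<close>, and by commutativity star u * u is the scalar
  \<open>s\<close>. This replaces a comparison of \<open>a * a\<close> with \<open>s\<close> in the
  order of the algebra.\<close>

lemma norm_le_of_sum_squares:
  fixes a b :: "'a::cstar_algebra"
  assumes sa: "star a = a" "star b = b" and comm: "a * b = b * a"
    and sq: "a * a + b * b = s *\<^sub>R 1" and "0 \<le> s"
  shows "(norm a)\<^sup>2 \<le> s"
proof -
  define u where "u = a + \<i> *\<^sub>C b"
  have star_u: "star u = a - \<i> *\<^sub>C b"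
    by (simp add: u_def star_add star_scaleC sa scaleC_minus_left)
  have "star u * u = a * a + b * b + \<i> *\<^sub>C (a * b - b * a)"
    by (simp add: star_u) (simp add: u_def algebra_simps mult_scaleC_left mult_scaleC_right scaleC_scaleC
      scaleC_add_right scaleC_diff_right scaleC_minus_left)
  then have "star u * u = a * a + b * b" by (simp add: comm)
  then have "(norm u)\<^sup>2 = s"
    using sq \<open>0 \<le> s\<close> by (simp flip: cstar_identity)
  moreover have "norm a \<le> norm u"
  proof -
    have "2 *\<^sub>R a = u + star u" unfolding star_u by (simp add: u_def scaleR_2)
    then have "2 * norm a = norm (u + star u)" by (metis abs_numeral norm_scaleR)
    then show ?thesis using norm_triangle_ineq[of u "star u"] by simp
  qed
  ultimately show ?thesis by (metis norm_ge_zero power_mono)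
qed

text \<open>Writing the positive element \<open>K *\<^sub>R 1 - k\<close> as a square makes the
  positivity of the state applicable to it.\<close>

lemma cstar_sqrt_shift:
  fixes k :: "'a::cstar_algebra"
  assumes k: "star k = k" "norm k \<le> K"
  obtains v where "star v = v" "v * v = K *\<^sub>R 1 - k"
proof (cases "K = 0")
  case True
  with k show ?thesis by (intro that[of 0]) auto
next
  case False
  with k(2) norm_ge_zero[of k] have K: "K > 0" by linarith
  have "star (inverse K *\<^sub>R k) = inverse K *\<^sub>R k" "norm (inverse K *\<^sub>R k) \<le> 1"
    using k K by (simp_all add: star_scaleR field_simps)
  then obtain v where v: "star v = v" "v * v = 1 - inverse K *\<^sub>R k"
    using cstar_sqrt by metis
  have "sqrt K *\<^sub>R v * (sqrt K *\<^sub>R v) = K *\<^sub>R (v * v)" using K by simp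
  then show ?thesis
    by (intro that[of "sqrt K *\<^sub>R v"]) (use v K in \<open>simp_all add: star_scaleR scaleR_diff_right\<close>)
qed

text \<open>The element \<^term>\<open>v * v\<close> is the absolute value of \<^term>\<open>j\<close>.\<close>

lemma cstar_abs:
  fixes j :: "'a::cstar_algebra"
  assumes j: "star j = j"
  shows "\<exists>v. star v = v \<and> (v * v) * (v * v) = j * j \<and> (\<forall>y. y * j = j * y \<longrightarrow> y * v = v * y)"
proof -
  \<comment> \<open>The summand 1 keeps the scaling factor positive when
    \<open>j = 0\<close>.\<close>
  define c where "c = norm j + 1"
  have c: "c > 0" using norm_ge_zero[of j] unfolding c_def by linarith
  define i where "i = inverse c *\<^sub>R j"
  have i: "star i = i" by (simp add: i_def star_scaleR j)
  have "norm i \<le> 1"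
    using c by (simp add: i_def) (simp add: c_def divide_simps)
  then have ii: "star (i * i) = i * i" "norm (i * i) \<le> 1"
    using norm_mult_ineq[of i i] mult_le_one[of "norm i" "norm i"] by (simp_all add: star_mult i)
  obtain s where s: "star s = s" "s * s = 1 - i * i" "norm (1 - s) \<le> 1"
    "\<forall>y. y * (i * i) = (i * i) * y \<longrightarrow> y * s = s * y"
    using cstar_sqrt[OF ii] by blast
  \<comment> \<open>The relation s^2 + i^2 = 1 bounds s^2 = 1 - i^2 in norm by 1. Hence i^2 = 1 - (1
    - i^2) has a square root \<open>m\<close>, the absolute value of \<open>i\<close>, and
    \<open>norm (1 - m) \<le> 1\<close> gives \<open>m\<close> a square root in turn.\<close>
  have "(norm s)\<^sup>2 \<le> 1"
  proof (rule norm_le_of_sum_squares)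
    show "s * i = i * s" using s(4)[rule_format, of i] by (simp add: mult.assoc)
  qed (use s(1,2) i in auto)
  then have k: "norm (1 - i * i) \<le> 1" "star (1 - i * i) = 1 - i * i"
    using cstar_identity[of s] s(1,2) ii(1) by (simp_all add: star_diff)
  obtain m where m: "star m = m" "m * m = 1 - (1 - i * i)" "norm (1 - m) \<le> 1"
    "\<forall>y. y * (1 - i * i) = (1 - i * i) * y \<longrightarrow> y * m = m * y"
    using cstar_sqrt[OF k(2,1)] by blast
  have "star (1 - m) = 1 - m" by (simp add: star_diff m(1))
  then obtain v where v: "star v = v" "v * v = 1 - (1 - m)" "norm (1 - v) \<le> 1"
    "\<forall>y. y * (1 - m) = (1 - m) * y \<longrightarrow> y * v = v * y"
    using cstar_sqrt[OF _ m(3)] by blast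
  show ?thesis
  proof (intro exI[of _ "sqrt c *\<^sub>R v"] conjI allI impI)
    show "sqrt c *\<^sub>R v * (sqrt c *\<^sub>R v) * (sqrt c *\<^sub>R v * (sqrt c *\<^sub>R v)) = j * j"
      using c v(2) m(2) by (simp add: i_def mult.assoc[symmetric])
    fix y assume "y * j = j * y"
    then have yi: "y * i = i * y" by (simp add: i_def)
    have "y * (i * i) = (i * i) * y" by (metis mult.assoc yi)
    then have "y * m = m * y" by (intro m(4)[rule_format]) (simp add: algebra_simps)
    then have "y * v = v * y" by (intro v(4)[rule_format]) (simp add: algebra_simps)
    then show "y * (sqrt c *\<^sub>R v) = sqrt c *\<^sub>R v * y" by simp
  qed (use v(1) in \<open>simp add: star_scaleR\<close>)
qed

section \<open>The norm is determined by the moments\<close>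

lemma commute_mult:
  fixes a :: "'a::semigroup_mult"
  shows "a * b = b * a \<Longrightarrow> a * c = c * a \<Longrightarrow> a * (b * c) = b * c * a"
  by (metis mult.assoc)

lemma mult_interchange:
  fixes a :: "'a::semigroup_mult"
  shows "b * c = c * b \<Longrightarrow> a * b * (c * d) = a * c * (b * d)"
  by (metis mult.assoc)

locale tracial =
  fixes \<phi> :: "'a::cstar_algebra \<Rightarrow> complex"
  assumes tracial: "tracial_cstar_prob_space \<phi>"
begin

lemma trace_add: "\<phi> (x + y) = \<phi> x + \<phi> y"
  and trace_scaleC: "\<phi> (c *\<^sub>C x) = c * \<phi> x"
  and trace_one [simp]: "\<phi> 1 = 1"
  and trace_pos: "0 \<le> Re (\<phi> (star x * x))"
  and trace_faithful: "Re (\<phi> (star x * x)) = 0 \<Longrightarrow> x = 0"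
  and trace_commute: "\<phi> (x * y) = \<phi> (y * x)"
  using tracial unfolding tracial_cstar_prob_space_def
  by (auto simp: complex_eq_iff complex_is_Real_iff)

lemma trace_zero [simp]: "\<phi> 0 = 0"
  using trace_scaleC[of 0 0] by simp

lemma trace_minus: "\<phi> (- x) = - \<phi> x"
  using trace_add[of x "- x"] by (simp add: eq_neg_iff_add_eq_0 add.commute)

lemma trace_diff: "\<phi> (x - y) = \<phi> x - \<phi> y"
  using trace_add[of x "- y"] by (simp add: trace_minus)

lemma trace_scaleR: "\<phi> (r *\<^sub>R x) = complex_of_real r * \<phi> x"
  by (simp add: scaleR_scaleC trace_scaleC)

lemma trace_le_norm:
  assumes "star k = k" "norm k \<le> K"
  shows "Re (\<phi> (star x * k * x)) \<le> K * Re (\<phi> (star x * x))"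
proof -
  obtain v where v: "star v = v" "v * v = K *\<^sub>R 1 - k"
    by (rule cstar_sqrt_shift[OF assms])
  have "star (v * x) * (v * x) = star x * (v * v) * x"
    by (simp add: star_mult v(1) mult.assoc)
  also have "\<dots> = K *\<^sub>R (star x * x) - star x * k * x"
    unfolding v(2) by (simp add: algebra_simps)
  finally show ?thesis using trace_pos[of "v * x"] by (simp add: trace_diff trace_scaleR)
qed

text \<open>If \<open>norm h\<close> exceeded \<open>K\<close>, a number \<open>s\<close> strictly
  between the two squares would leave a non-zero positive part of h^2 - s. There h^2 is at least
  \<open>s\<close>, so the numbers \<open>a n\<close> grow at least like s^n, whereas the moments
  let them grow at most like K^(2n).\<close>

lemma norm_le_of_moments_le:
  assumes h: "star h = h" and "0 \<le> K"
    and le: "\<And>n. Re (\<phi> (h ^ (2 * n))) \<le> K ^ (2 * n)"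
  shows "norm h \<le> K"
proof (rule ccontr)
  assume "\<not> norm h \<le> K"
  then have "K\<^sup>2 < (norm h)\<^sup>2"
    using \<open>0 \<le> K\<close> by (intro power_strict_mono) auto
  then obtain s where s: "K\<^sup>2 < s" "s < (norm h)\<^sup>2" using dense by blast
  have "0 \<le> K\<^sup>2" by simp
  with s(1) have s0: "s > 0" by linarith
  define j where "j = h * h - s *\<^sub>R 1"
  have j: "star j = j" by (simp add: j_def star_diff star_mult star_scaleR h)
  have hj: "h * j = j * h" by (simp add: j_def algebra_simps)
  obtain v where v: "star v = v" "(v * v) * (v * v) = j * j" "\<forall>y. y * j = j * y \<longrightarrow> y * v = v * y"
    using cstar_abs[OF j] by blast
  have hv: "h * v = v * h" and jv: "j * v = v * j"
    by (rule v(3)[rule_format], simp add: hj)+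
  define m where "m = v * v"
  \<comment> \<open>twice the positive part of \<^term>\<open>j\<close>\<close>
  define p where "p = m + j"
  have jm: "j * m = m * j" unfolding m_def by (rule commute_mult[OF jv jv])
  have hm: "h * m = m * h" unfolding m_def by (rule commute_mult[OF hv hv])
  have sa: "star m = m" "star p = p" by (simp_all add: m_def p_def star_mult star_add v(1) j)
  have hp: "h * p = p * h" by (simp add: p_def distrib_left distrib_right hm hj)
  have vp: "v * p = p * v" by (simp add: p_def m_def distrib_left distrib_right jv mult.assoc)
  have "j * p = m * p" using v(2) by (simp add: p_def distrib_left jm flip: m_def)
  \<comment> \<open>Multiplied by \<open>p\<close>, the element \<open>j\<close> and its absolute
    value \<open>m\<close> agree, so h^2 = s + j acts on \<open>p\<close> as s + m.\<close>
  then have hhp: "h * h * p = s *\<^sub>R p + m * p" by (simp add: j_def left_diff_distrib)  (simp add: algebra_simps)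
  \<comment> \<open>Otherwise v^2 = s - h^2, and the bound for sums of two squares contradicts the
    choice of \<open>s\<close>.\<close>
  have "p \<noteq> 0"
  proof
    assume "p = 0"
    then have "h * h + v * v = s *\<^sub>R 1" by (simp add: p_def m_def j_def algebra_simps)
    then have "(norm h)\<^sup>2 \<le> s"
      using s0 by (intro norm_le_of_sum_squares[OF h v(1) hv]) auto
    then show False using s(2) by simp
  qed
  have hnp: "h ^ n * p = p * h ^ n" and hnv: "h ^ n * v = v * h ^ n" for n
    by (rule power_commuting_commutes[OF hp], rule power_commuting_commutes[OF hv])
  define a where "a n = Re (\<phi> (star (h ^ n * p) * (h ^ n * p)))" for n
  have sq: "star (h ^ n * p) * (h ^ n * p) = h ^ (2 * n) * (p * p)" for n
  proof -
    have "star (h ^ n * p) * (h ^ n * p) = (h ^ n * p) * (h ^ n * p)"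
      by (simp add: star_mult star_power h sa hnp)
    also have "\<dots> = h ^ n * h ^ n * (p * p)" by (rule mult_interchange[OF hnp[symmetric]])
    finally show ?thesis by (simp add: mult_2 power_add)
  qed
  have "Re (\<phi> (star p * p)) \<noteq> 0"
    using trace_faithful \<open>p \<noteq> 0\<close> by blast
  then have a0: "a 0 > 0"
    using trace_pos[of p] by (simp add: a_def)
  \<comment> \<open>The excess of h^2 p over s p is m p with m = v^2. As everything commutes, it
    contributes the trace of an absolute square, which is non-negative.\<close>
  have step: "s * a n \<le> a (Suc n)" for n
  proof -
    have "h ^ (2 * Suc n) = h ^ (2 * n) * (h * h)"
      by (metis mult_Suc_right add.commute power2_eq_square power_add)
    then have "h ^ (2 * Suc n) * (p * p) = h ^ (2 * n) * (h * h * p) * p"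
      by (simp add: mult.assoc)
    also have "\<dots> = s *\<^sub>R (h ^ (2 * n) * (p * p)) + h ^ (2 * n) * m * p * p"
      unfolding hhp by (simp add: algebra_simps)
    also have "h ^ (2 * n) * m * p * p = star (h ^ n * v * p) * (h ^ n * v * p)"
    proof -
      have hvp: "h ^ n * (v * p) = v * p * h ^ n" by (rule commute_mult[OF hnv hnp])
      have "star (h ^ n * v * p) = p * v * h ^ n"
        by (simp add: star_mult star_power h sa v(1) mult.assoc)
      also have "\<dots> = h ^ n * (v * p)" using hvp vp by metis
      finally have "star (h ^ n * v * p) * (h ^ n * v * p) = h ^ n * (v * p) * (h ^ n * (v * p))"
        by (simp add: mult.assoc)
      also have "\<dots> = h ^ n * h ^ n * (v * p * (v * p))"
        by (rule mult_interchange[OF hvp[symmetric]])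
      also have "v * p * (v * p) = m * (p * p)"
        unfolding m_def by (rule mult_interchange[OF vp[symmetric]])
      finally show ?thesis by (simp add: mult_2 power_add mult.assoc)
    qed
    finally show ?thesis
      using trace_pos[of "h ^ n * v * p"] unfolding a_def sq by (simp add: trace_add trace_scaleR del: power_Suc mult_Suc_right)
  qed
  have lower: "s ^ n * a 0 \<le> a n" for n
  proof (induction n)
    case (Suc n)
    have "s * (s ^ n * a 0) \<le> s * a n" using Suc s0 by (intro mult_left_mono) auto
    then show ?case using step[of n] by (simp only: power_Suc mult.assoc)
  qed simp
  have upper: "a n \<le> norm (p * p) * (K\<^sup>2) ^ n" for n
  proof -
    have "a n = Re (\<phi> (star (h ^ n) * (p * p) * h ^ n))"
    proof -
      have "star (h ^ n * p) * (h ^ n * p) = p * h ^ n * (h ^ n * p)"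
        by (simp add: star_mult star_power h sa)
      also have "\<dots> = h ^ n * p * (p * h ^ n)" by (simp only: hnp)
      also have "\<dots> = star (h ^ n) * (p * p) * h ^ n"
        by (simp add: star_power h mult.assoc)
      finally show ?thesis by (simp add: a_def)
    qed
    also have "\<dots> \<le> norm (p * p) * Re (\<phi> (star (h ^ n) * h ^ n))"
      by (rule trace_le_norm) (simp_all add: star_mult sa)
    also have "star (h ^ n) * h ^ n = h ^ (2 * n)"
      by (simp add: star_power h mult_2 power_add)
    also have "norm (p * p) * Re (\<phi> (h ^ (2 * n))) \<le> norm (p * p) * K ^ (2 * n)"
      by (intro mult_left_mono le) auto
    finally show ?thesis by (simp add: power_mult)
  qed
  have "a 0 \<le> norm (p * p) * (K\<^sup>2 / s) ^ n" for n
    using order_trans[OF lower[of n] upper[of n]] s0 by (simp add: power_divide field_simps)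
  moreover have "(\<lambda>n. norm (p * p) * (K\<^sup>2 / s) ^ n) \<longlonglongrightarrow> norm (p * p) * 0"
    using s s0 by (intro tendsto_mult_left LIMSEQ_power_zero) auto
  ultimately have "a 0 \<le> norm (p * p) * 0" by (intro LIMSEQ_le_const) auto
  then show False using a0 by simp
qed

text \<open>The moments of the absolute square of \<open>a\<close> are bounded by powers of its
  norm, and by assumption these are also the moments of the absolute square of
  \<open>b\<close>.\<close>

theorem norm_le_of_moments_eq:
  assumes "\<And>n. \<phi> ((star b * b) ^ n) = \<phi> ((star a * a) ^ n)"
  shows "norm b \<le> norm a"
proof -
  have "norm (star b * b) \<le> norm (star a * a)"
  proof (rule norm_le_of_moments_le)
    fix n
    have "Re (\<phi> (star 1 * (star a * a) ^ (2 * n) * 1)) \<le> norm (star a * a) ^ (2 * n) * Re (\<phi> (star 1 * 1))"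
      by (rule trace_le_norm) (simp_all only: star_power star_mult star_star norm_power_ineq)
    then show "Re (\<phi> ((star b * b) ^ (2 * n))) \<le> norm (star a * a) ^ (2 * n)"
      by (simp add: assms)
  qed (simp_all add: star_mult star_star)
  then show ?thesis by (simp add: cstar_identity)
qed

end

section \<open>Words, weights and the gauge action\<close>

definition word :: "('l \<Rightarrow> 'a::cstar_algebra) \<Rightarrow> ('l \<times> bool) list \<Rightarrow> 'a" where
  "word y w = prod_list (map (\<lambda>(l, e). if e then star (y l) else y l) w)"

definition weight :: "('l \<Rightarrow> int) \<Rightarrow> ('l \<times> bool) list \<Rightarrow> int" where
  "weight d w = sum_list (map (\<lambda>(l, e). if e then - d l else d l) w)"

abbreviation star_words :: "'l set \<Rightarrow> ('l \<times> bool) list set" where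
  "star_words \<Lambda> \<equiv> lists (\<Lambda> \<times> UNIV)"

definition word_adj :: "('l \<times> bool) list \<Rightarrow> ('l \<times> bool) list" where
  "word_adj w = rev (map (\<lambda>(l, e). (l, \<not> e)) w)"

lemma word_simps [simp]:
  "word y [] = 1" "word y ((l, e) # w) = (if e then star (y l) else y l) * word y w"
  "word y (v @ w) = word y v * word y w"
  by (simp_all add: word_def)

lemma weight_simps [simp]:
  "weight d [] = 0" "weight d ((l, e) # w) = (if e then - d l else d l) + weight d w"
  "weight d (v @ w) = weight d v + weight d w"
  by (simp_all add: weight_def)

lemma word_adj_Cons: "word_adj ((l, e) # w) = word_adj w @ [(l, \<not> e)]"
  by (simp add: word_adj_def)

lemma word_word_adj: "word y (word_adj w) = star (word y w)"
  by (induction w) (auto simp: word_adj_Cons star_mult star_star, simp_all add: word_adj_def)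

lemma weight_word_adj: "weight d (word_adj w) = - weight d w"
  by (induction w) (auto simp: word_adj_Cons, simp_all add: word_adj_def)

lemma word_adj_in_star_words: "w \<in> star_words \<Lambda> \<Longrightarrow> word_adj w \<in> star_words \<Lambda>"
  by (auto simp: word_adj_def in_lists_conv_set)

text \<open>Equivalently, the *-moments do not change when each \<open>x l\<close> is multiplied by
  \<open>\<mu> powi d l\<close> with \<open>cmod \<mu> = 1\<close>. Constant \<open>d = 1\<close>
  rotates by the degree; the indicator of the complement of a set rotates only the letters outside
  it.\<close>

definition weight_invariant :: "('a::cstar_algebra \<Rightarrow> complex) \<Rightarrow> 'l set \<Rightarrow> ('l \<Rightarrow> 'a) \<Rightarrow> ('l \<Rightarrow> int) \<Rightarrow> bool" where
  "weight_invariant \<phi> \<Lambda> x d \<longleftrightarrow> (\<forall>w\<in>star_words \<Lambda>. weight d w \<noteq> 0 \<longrightarrow> \<phi> (word x w) = 0)"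

text \<open>\<^term>\<open>b\<close> arises from \<^term>\<open>a\<close> by replacing each \<^term>\<open>x l\<close> with
  \<^term>\<open>(\<mu> powi d l) *\<^sub>C x l\<close>.\<close>

inductive gauge_rel :: "'l set \<Rightarrow> ('l \<Rightarrow> 'a::cstar_algebra) \<Rightarrow> ('l \<Rightarrow> int) \<Rightarrow> complex \<Rightarrow> 'a \<Rightarrow> 'a \<Rightarrow> bool"
  for \<Lambda> x d \<mu> where
  zero: "gauge_rel \<Lambda> x d \<mu> 0 0"
| add: "gauge_rel \<Lambda> x d \<mu> a b \<Longrightarrow> w \<in> star_words \<Lambda> \<Longrightarrow>
    gauge_rel \<Lambda> x d \<mu> (a + c *\<^sub>C word x w) (b + (c * \<mu> powi weight d w) *\<^sub>C word x w)"

lemma gauge_word: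
  "w \<in> star_words \<Lambda> \<Longrightarrow> gauge_rel \<Lambda> x d \<mu> (c *\<^sub>C word x w) ((c * \<mu> powi weight d w) *\<^sub>C word x w)"
  using gauge_rel.add[OF gauge_rel.zero, of w \<Lambda> x d \<mu> c] by simp

lemma gauge_add:
  assumes "gauge_rel \<Lambda> x d \<mu> a b"
  shows "gauge_rel \<Lambda> x d \<mu> a' b' \<Longrightarrow> gauge_rel \<Lambda> x d \<mu> (a + a') (b + b')"
proof (induction rule: gauge_rel.induct)
  case zero
  then show ?case using assms by simp
next
  case (add a' b' w c)
  then show ?case using gauge_rel.add[OF add.IH add.hyps(2), of c] by (simp add: add.assoc)
qed

lemma gauge_word_mult:
  assumes "\<mu> \<noteq> 0" and v: "v \<in> star_words \<Lambda>"
  shows "gauge_rel \<Lambda> x d \<mu> a b \<Longrightarrow>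
    gauge_rel \<Lambda> x d \<mu> (c *\<^sub>C word x v * a) ((c * \<mu> powi weight d v) *\<^sub>C word x v * b)"
proof (induction rule: gauge_rel.induct)
  case zero
  then show ?case by (simp add: gauge_rel.zero)
next
  case (add a b w e)
  have "v @ w \<in> star_words \<Lambda>" using v add.hyps(2) by simp
  from gauge_rel.add[OF add.IH this, of "c * e"] show ?case
    using \<open>\<mu> \<noteq> 0\<close>
    by (simp add: distrib_left mult_scaleC_left mult_scaleC_right scaleC_scaleC power_int_add mult_ac)
qed

lemma gauge_mult:
  assumes "\<mu> \<noteq> 0" and ab': "gauge_rel \<Lambda> x d \<mu> a' b'"
  shows "gauge_rel \<Lambda> x d \<mu> a b \<Longrightarrow> gauge_rel \<Lambda> x d \<mu> (a * a') (b * b')"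
proof (induction rule: gauge_rel.induct)
  case zero
  then show ?case by (simp add: gauge_rel.zero)
next
  case (add a b w c)
  show ?case
    unfolding distrib_right by (rule gauge_add[OF add.IH gauge_word_mult[OF assms(1) add.hyps(2) ab']])
qed

lemma gauge_one: "gauge_rel \<Lambda> x d \<mu> 1 1"
  using gauge_word[of "[]" \<Lambda> x d \<mu> 1] by simp

lemma gauge_power: "\<mu> \<noteq> 0 \<Longrightarrow> gauge_rel \<Lambda> x d \<mu> a b \<Longrightarrow> gauge_rel \<Lambda> x d \<mu> (a ^ n) (b ^ n)"
  by (induction n) (simp_all add: gauge_one gauge_mult)

lemma gauge_star:
  assumes "cmod \<mu> = 1"
  shows "gauge_rel \<Lambda> x d \<mu> a b \<Longrightarrow> gauge_rel \<Lambda> x d \<mu> (star a) (star b)"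
proof (induction rule: gauge_rel.induct)
  case zero
  then show ?case by (simp add: gauge_rel.zero)
next
  case (add a b w c)
  have "cnj \<mu> = inverse \<mu>"
    using assms by (simp add: inverse_complex_def cmod_def complex_eq_iff)
  then have "cnj (\<mu> powi weight d w) = \<mu> powi weight d (word_adj w)"
    by (simp add: weight_word_adj power_int_minus power_int_inverse complex_cnj_power_int)
  with gauge_rel.add[OF add.IH word_adj_in_star_words[OF add.hyps(2)], of "cnj c"]
  show ?case by (simp add: star_add star_scaleC word_word_adj)
qed

lemma gauge_sum:
  "(\<And>i. i \<in> I \<Longrightarrow> gauge_rel \<Lambda> x d \<mu> (f i) (g i)) \<Longrightarrow> gauge_rel \<Lambda> x d \<mu> (sum f I) (sum g I)"
  by (induction I rule: infinite_finite_induct) (simp_all add: gauge_rel.zero gauge_add)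

context tracial
begin

lemma gauge_trace:
  assumes "weight_invariant \<phi> \<Lambda> x d"
  shows "gauge_rel \<Lambda> x d \<mu> a b \<Longrightarrow> \<phi> b = \<phi> a"
proof (induction rule: gauge_rel.induct)
  case (add a b w c)
  then show ?case
    using assms by (cases "weight d w = 0") (auto simp: trace_add trace_scaleC weight_invariant_def)
qed simp

text \<open>The relation passes to products and adjoints, hence to powers of absolute squares, whose
  traces therefore agree. In particular \<open>a = 0\<close> forces \<open>b = 0\<close>, so scaling
  respects the relations among the generators.\<close>

lemma gauge_norm_le:
  assumes "weight_invariant \<phi> \<Lambda> x d" "cmod \<mu> = 1" "gauge_rel \<Lambda> x d \<mu> a b"
  shows "norm b \<le> norm a"
proof (rule norm_le_of_moments_eq)
  fix n
  have "\<mu> \<noteq> 0" using assms(2) by auto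
  then have "gauge_rel \<Lambda> x d \<mu> ((star a * a) ^ n) ((star b * b) ^ n)"
    using assms by (intro gauge_power gauge_mult gauge_star)
  then show "\<phi> ((star b * b) ^ n) = \<phi> ((star a * a) ^ n)"
    by (rule gauge_trace[OF assms(1)])
qed

end

section \<open>Fejer means\<close>

definition letter_prod :: "('l \<Rightarrow> 'a::cstar_algebra) \<Rightarrow> 'l list \<Rightarrow> 'a" where
  "letter_prod x w = prod_list (map x w)"

lemma word_unstarred: "word x (map (\<lambda>l. (l, False)) w) = letter_prod x w"
  by (induction w) (simp_all add: letter_prod_def)

lemma weight_unstarred: "weight (\<lambda>l. int (d l)) (map (\<lambda>l. (l, False)) w) = int (sum_list (map d w))"
  by (induction w) simp_all

text \<open>Orthogonality of the characters of the cyclic group of order \<open>M\<close>;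
  restricting both exponents to the range below \<open>M\<close> excludes aliasing.\<close>

lemma sum_root_of_unity_powers:
  assumes "a < M" "b < M"
  shows "(\<Sum>t<M. (cis (2 * pi / M) ^ a * cnj (cis (2 * pi / M) ^ b)) ^ t) = (if a = b then of_nat M else 0)"
proof -
  define \<omega> where "\<omega> = cis (2 * pi / M)"
  define q where "q = \<omega> ^ a * cnj (\<omega> ^ b)"
  have M: "M > 0" using assms by simp
  have pow: "\<omega> ^ n = cis (2 * pi * n / M)" for n
    unfolding \<omega>_def Complex.DeMoivre by (simp add: mult_ac)
  have unit: "cnj (\<omega> ^ b) * \<omega> ^ b = 1"
    by (simp add: pow complex_eq_iff cis.simps power2_eq_square[symmetric])
  have "q = 1 \<longleftrightarrow> a = b"
  proof
    assume "q = 1"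
    then have "\<omega> ^ a = \<omega> ^ b" using unit by (metis q_def mult.assoc mult_1 mult_1_right)
    moreover have "inj_on (\<lambda>k. cis (2 * pi * real k / real M)) {..<M}"
      using Complex.bij_betw_roots_unity[OF M] by (rule bij_betw_imp_inj_on)
    ultimately show "a = b" using assms by (auto simp: pow inj_on_def)
  qed (use unit in \<open>simp add: q_def mult.commute\<close>)
  moreover have "q ^ M = 1"
  proof -
    have "\<omega> ^ M = 1" using M by (simp add: pow)
    then have "(\<omega> ^ n) ^ M = 1" for n by (metis power_commutes power_mult mult.commute power_one)
    then show ?thesis by (simp add: q_def power_mult_distrib flip: complex_cnj_power)
  qed
  ultimately show ?thesis
    using sum_gp_strict[of q M] by (auto simp: q_def \<omega>_def)
qed

text \<open>The Fejer kernel sampled at the roots of unity of order \<open>M\<close>. The choice M =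
  N + D keeps i + e and j below \<open>M\<close> for i, j < N and e \<le> D, so that the sum over
  the roots leaves exactly the pairs with i + e = j. There are N - e of them, with truncated
  subtraction.\<close>

lemma fejer_kernel:
  fixes N D :: nat
  assumes "N > 0"
  defines "M \<equiv> N + D"
  shows "\<exists>\<kappa> \<mu>. (\<forall>t<M. \<kappa> t \<ge> (0::real) \<and> cmod (\<mu> t) = 1) \<and>
    (\<forall>e\<le>D. (\<Sum>t<M. complex_of_real (\<kappa> t) * \<mu> t ^ e) = complex_of_real (real (N - e) / real N))"
proof -
  define \<omega> where "\<omega> = cis (2 * pi / M)"
  define S where "S t = (\<Sum>i<N. (\<omega> ^ t) ^ i)" for t :: nat
  define \<kappa> where "\<kappa> t = (cmod (S t))\<^sup>2 / (real M * real N)" for t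
  have "(\<Sum>t<M. complex_of_real (\<kappa> t) * (\<omega> ^ t) ^ e) = complex_of_real (real (N - e) / real N)" if e: "e \<le> D" for e
  proof -
    have "complex_of_real ((cmod (S t))\<^sup>2) * (\<omega> ^ t) ^ e = (\<Sum>i<N. \<Sum>j<N. (\<omega> ^ (i + e) * cnj (\<omega> ^ j)) ^ t)" for t
    proof -
      have "complex_of_real ((cmod (S t))\<^sup>2) = S t * cnj (S t)" by (rule complex_norm_square)
      also have "S t * cnj (S t) * (\<omega> ^ t) ^ e = (\<Sum>i<N. \<Sum>j<N. (\<omega> ^ t) ^ i * cnj ((\<omega> ^ t) ^ j) * (\<omega> ^ t) ^ e)"
      proof -
        have "S t * cnj (S t) = (\<Sum>i<N. \<Sum>j<N. (\<omega> ^ t) ^ i * cnj ((\<omega> ^ t) ^ j))"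
          by (simp add: S_def sum_product)
        then show ?thesis by (simp only: sum_distrib_right)
      qed
      also have "\<dots> = (\<Sum>i<N. \<Sum>j<N. (\<omega> ^ (i + e) * cnj (\<omega> ^ j)) ^ t)"
        by (simp add: power_mult_distrib power_add mult_ac flip: power_mult)
      finally show ?thesis .
    qed
    then have "(\<Sum>t<M. complex_of_real ((cmod (S t))\<^sup>2) * (\<omega> ^ t) ^ e) =
        (\<Sum>t<M. \<Sum>i<N. \<Sum>j<N. (\<omega> ^ (i + e) * cnj (\<omega> ^ j)) ^ t)" by simp
    also have "\<dots> = (\<Sum>i<N. \<Sum>j<N. \<Sum>t<M. (\<omega> ^ (i + e) * cnj (\<omega> ^ j)) ^ t)"
      by (subst sum.swap) (intro sum.cong refl sum.swap)
    also have "\<dots> = (\<Sum>i<N. \<Sum>j<N. if i + e = j then of_nat M else 0)"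
      unfolding \<omega>_def using e by (intro sum.cong refl sum_root_of_unity_powers) (auto simp: M_def)
    also have "\<dots> = (\<Sum>i<N. if i < N - e then of_nat M else 0)"
      by (intro sum.cong refl) (auto simp: sum.delta')
    also have "\<dots> = of_nat (N - e) * of_nat M"
    proof -
      have "{..<N} \<inter> {i. i < N - e} = {..<N - e}" by auto
      then show ?thesis by (simp add: sum.If_cases)
    qed
    finally have "(\<Sum>t<M. complex_of_real ((cmod (S t))\<^sup>2) * (\<omega> ^ t) ^ e) = of_nat (N - e) * of_nat M" .
    moreover have "(\<Sum>t<M. complex_of_real (\<kappa> t) * (\<omega> ^ t) ^ e) =
        (\<Sum>t<M. complex_of_real ((cmod (S t))\<^sup>2) * (\<omega> ^ t) ^ e) / (of_nat M * of_nat N)"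
      by (simp add: \<kappa>_def sum_divide_distrib)
    moreover have "of_nat M \<noteq> (0::complex)" using assms(1) by (simp add: M_def del: of_nat_add)
    ultimately show ?thesis by simp
  qed
  moreover have "\<kappa> t \<ge> 0 \<and> cmod (\<omega> ^ t) = 1" for t
    by (simp add: \<kappa>_def \<omega>_def norm_power)
  ultimately show ?thesis by blast
qed

lemma norm_sum_scaleC_le:
  fixes v :: "'i \<Rightarrow> 'a::complex_normed_vector"
  assumes "\<And>t. t \<in> T \<Longrightarrow> \<kappa> t \<ge> 0" "\<And>t. t \<in> T \<Longrightarrow> norm (v t) \<le> B"
  shows "norm (\<Sum>t\<in>T. complex_of_real (\<kappa> t) *\<^sub>C v t) \<le> sum \<kappa> T * B"
proof -
  have "norm (\<Sum>t\<in>T. complex_of_real (\<kappa> t) *\<^sub>C v t) \<le> (\<Sum>t\<in>T. \<kappa> t * B)"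
    using assms by (intro sum_norm_le) (simp add: norm_scaleC mult_left_mono)
  then show ?thesis by (simp add: sum_distrib_right)
qed

lemma scaleC_sum_left: "(\<Sum>i\<in>I. f i) *\<^sub>C (x :: 'a::complex_normed_vector) = (\<Sum>i\<in>I. f i *\<^sub>C x)"
  by (induction I rule: infinite_finite_induct) (simp_all add: scaleC_add_left)

lemma scaleC_sum_right: "c *\<^sub>C (\<Sum>i\<in>I. f i :: 'a::complex_normed_vector) = (\<Sum>i\<in>I. c *\<^sub>C f i)"
  by (induction I rule: infinite_finite_induct) (simp_all add: scaleC_add_right)

context tracial
begin

text \<open>The left-hand sum is an average of rotated copies of the right-hand one; the weights
  have total mass 1, by exponent 0 of the kernel, and rotation does not increase the norm. Truncated
  subtraction removes the words of weight at least \<open>N\<close>.\<close>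

lemma fejer_norm_le:
  assumes inv: "weight_invariant \<phi> \<Lambda> x (\<lambda>l. int (d l))"
    and W: "finite W" "W \<subseteq> lists \<Lambda>" and N: "N > 0"
  shows "norm (\<Sum>w\<in>W. (complex_of_real (real (N - sum_list (map d w)) / real N) * c w) *\<^sub>C letter_prod x w)
    \<le> norm (\<Sum>w\<in>W. c w *\<^sub>C letter_prod x w)"
proof -
  let ?e = "\<lambda>w. sum_list (map d w)"
  \<comment> \<open>The sampling points depend on \<open>W\<close> through \<open>D\<close>, but the
    resulting multipliers do not.\<close>
  obtain D where D: "\<And>w. w \<in> W \<Longrightarrow> ?e w \<le> D"
    using finite_nat_set_iff_bounded_le[of "?e ` W"] W(1) by auto
  obtain \<kappa> \<mu> where km: "\<And>t. t < N + D \<Longrightarrow> \<kappa> t \<ge> (0::real)" "\<And>t. t < N + D \<Longrightarrow> cmod (\<mu> t) = 1"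
    and ker: "\<And>e. e \<le> D \<Longrightarrow> (\<Sum>t<N+D. complex_of_real (\<kappa> t) * \<mu> t ^ e) = complex_of_real (real (N - e) / real N)"
    using fejer_kernel[OF N, of D] by blast
  define g where "g t = (\<Sum>w\<in>W. (c w * \<mu> t ^ ?e w) *\<^sub>C letter_prod x w)" for t
  have g: "norm (g t) \<le> norm (\<Sum>w\<in>W. c w *\<^sub>C letter_prod x w)" if "t < N + D" for t
  proof (rule gauge_norm_le[OF inv km(2)[OF that]])
    show "gauge_rel \<Lambda> x (\<lambda>l. int (d l)) (\<mu> t) (\<Sum>w\<in>W. c w *\<^sub>C letter_prod x w) (g t)"
      unfolding g_def
    proof (rule gauge_sum)
      fix w assume "w \<in> W"
      then have "map (\<lambda>l. (l, False)) w \<in> star_words \<Lambda>" using W by (auto simp: in_lists_conv_set)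
      from gauge_word[OF this, of x "\<lambda>l. int (d l)" "\<mu> t" "c w"]
      show "gauge_rel \<Lambda> x (\<lambda>l. int (d l)) (\<mu> t) (c w *\<^sub>C letter_prod x w) ((c w * \<mu> t ^ ?e w) *\<^sub>C letter_prod x w)"
        by (simp add: word_unstarred weight_unstarred)
    qed
  qed
  have "(\<Sum>w\<in>W. (complex_of_real (real (N - ?e w) / real N) * c w) *\<^sub>C letter_prod x w) =
      (\<Sum>w\<in>W. \<Sum>t<N+D. (complex_of_real (\<kappa> t) * (c w * \<mu> t ^ ?e w)) *\<^sub>C letter_prod x w)"
    unfolding scaleC_sum_left[symmetric]
  proof (intro sum.cong refl arg_cong2[of _ _ _ _ scaleC])
    fix w assume "w \<in> W"
    show "complex_of_real (real (N - ?e w) / real N) * c w = (\<Sum>t<N+D. complex_of_real (\<kappa> t) * (c w * \<mu> t ^ ?e w))"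
      by (simp only: ker[OF D[OF \<open>w \<in> W\<close>], symmetric] sum_distrib_right) (simp add: mult_ac)
  qed
  also have "\<dots> = (\<Sum>t<N+D. complex_of_real (\<kappa> t) *\<^sub>C g t)"
    unfolding g_def scaleC_sum_right by (subst sum.swap) (simp add: scaleC_scaleC)
  finally have "norm (\<Sum>w\<in>W. (complex_of_real (real (N - ?e w) / real N) * c w) *\<^sub>C letter_prod x w)
      \<le> sum \<kappa> {..<N+D} * norm (\<Sum>w\<in>W. c w *\<^sub>C letter_prod x w)"
    using norm_sum_scaleC_le[of "{..<N+D}" \<kappa> g] km(1) g by simp
  moreover have "complex_of_real (sum \<kappa> {..<N+D}) = 1" using ker[of 0] N by simp
  then have "sum \<kappa> {..<N+D} = 1" using of_real_eq_1_iff by blast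
  ultimately show ?thesis by simp
qed

text \<open>Truncation to the letters of \<^term>\<open>F\<close> is the Fejer mean of order 1 for the weight that counts
  the letters outside \<^term>\<open>F\<close>.\<close>

lemma truncation_norm_le:
  assumes len: "weight_invariant \<phi> \<Lambda> x (\<lambda>_. 1)"
    and out: "weight_invariant \<phi> \<Lambda> x (\<lambda>l. if l \<in> F then 0 else 1)"
    and W: "finite W" "W \<subseteq> lists \<Lambda>" and N: "N > 0"
  shows "norm (\<Sum>w\<in>W. (complex_of_real (if set w \<subseteq> F then real (N - length w) / real N else 0) * c w) *\<^sub>C letter_prod x w)
    \<le> norm (\<Sum>w\<in>W. c w *\<^sub>C letter_prod x w)"
proof -
  define d where "d l = (if l \<in> F then 0 else 1 :: nat)" for l
  define b where "b w = complex_of_real (real (1 - sum_list (map d w)) / real 1) * c w" for w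
  have len': "weight_invariant \<phi> \<Lambda> x (\<lambda>l. int 1)" using len by simp
  have out': "weight_invariant \<phi> \<Lambda> x (\<lambda>l. int (d l))" using out by (simp add: d_def if_distrib cong: if_cong)
  have "sum_list (map d w) = 0 \<longleftrightarrow> set w \<subseteq> F" for w
    by (induction w) (auto simp: d_def)
  \<comment> \<open>At order 1 the truncated difference is already an indicator: a single letter
    outside \<open>F\<close> makes it 0.\<close>
  then have "1 - sum_list (map d w) = (if set w \<subseteq> F then 1 else 0)" for w
    by (metis One_nat_def diff_0_eq_0 diff_Suc_Suc diff_zero not0_implies_Suc)
  then have b: "b w = (if set w \<subseteq> F then c w else 0)" for w
    unfolding b_def by simp
  have "(\<Sum>w\<in>W. (complex_of_real (if set w \<subseteq> F then real (N - length w) / real N else 0) * c w) *\<^sub>C letter_prod x w)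
    = (\<Sum>w\<in>W. (complex_of_real (real (N - sum_list (map (\<lambda>_. 1) w)) / real N) * b w) *\<^sub>C letter_prod x w)"
    by (intro sum.cong refl) (simp add: b sum_list_triv)
  also have "norm \<dots> \<le> norm (\<Sum>w\<in>W. b w *\<^sub>C letter_prod x w)"
    by (rule fejer_norm_le[OF len' W N])
  also have "\<dots> \<le> norm (\<Sum>w\<in>W. c w *\<^sub>C letter_prod x w)"
    unfolding b_def by (rule fejer_norm_le[OF out' W]) simp
  finally show ?thesis .
qed

end

section \<open>Free complexification\<close>

lemma star_word_conv_word: "star_word x k i \<epsilon> = word x (map (\<lambda>m. (i m, \<epsilon> m)) [1..<Suc k])"
  by (simp add: star_word_def word_def comp_def)

lemma alg_gen_star_algI:
  "1 \<in> star_alg_gen S"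
  "x \<in> S \<Longrightarrow> x \<in> star_alg_gen S"
  "x \<in> S \<Longrightarrow> star x \<in> star_alg_gen S"
  "a \<in> star_alg_gen S \<Longrightarrow> b \<in> star_alg_gen S \<Longrightarrow> a + b \<in> star_alg_gen S"
  "a \<in> star_alg_gen S \<Longrightarrow> c *\<^sub>C a \<in> star_alg_gen S"
  "a \<in> star_alg_gen S \<Longrightarrow> b \<in> star_alg_gen S \<Longrightarrow> a * b \<in> star_alg_gen S"
  unfolding star_alg_gen_def by (auto intro: alg_gen.intros)

lemma star_alg_gen_power: "a \<in> star_alg_gen S \<Longrightarrow> a ^ n \<in> star_alg_gen S"
  by (induction n) (auto intro: alg_gen_star_algI)

lemma word_in_star_alg_gen: "w \<in> star_words \<Lambda> \<Longrightarrow> word y w \<in> star_alg_gen (y ` \<Lambda>)"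
proof (induction w)
  case Nil
  show ?case by (simp add: alg_gen_star_algI(1))
next
  case (Cons p w)
  obtain l e where p: "p = (l, e)" by (cases p)
  with Cons.prems have "l \<in> \<Lambda>" and w: "w \<in> star_words \<Lambda>" by auto
  then have "(if e then star (y l) else y l) \<in> star_alg_gen (y ` \<Lambda>)"
    by (simp add: alg_gen_star_algI(2,3))
  with Cons.IH[OF w] show ?case by (simp add: p alg_gen_star_algI(6))
qed

section \<open>Normal forms of words in the Haar unitary and the letters\<close>

abbreviation (input) inner_words :: "('l \<times> bool) list \<Rightarrow> ('l option \<times> bool) list" where
  "inner_words w \<equiv> map (\<lambda>(l, e). (Some l, e)) w"

definition zword :: "int \<Rightarrow> ('l option \<times> bool) list" where
  "zword k = replicate (nat k) (None, False) @ replicate (nat (- k)) (None, True)"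

text \<open>A list $[(i_1,w_1),\dots,(i_m,w_m)]$ and $k$ encode $z^{i_1}w_1\cdots z^{i_m}w_mz^k$; the
  letter \<^term>\<open>None\<close> stands for $z$.\<close>

type_synonym 'l blocks = "(int \<times> ('l \<times> bool) list) list"

fun block_word :: "'l blocks \<Rightarrow> int \<Rightarrow> ('l option \<times> bool) list" where
  "block_word [] k = zword k"
| "block_word ((i, w) # l) k = zword i @ inner_words w @ block_word l k"

text \<open>The word is absorbed from its right end. Powers of \<open>z\<close> cancel in the
  integer exponents, and a letter joins the following block precisely when that block's exponent has
  become 0.\<close>

fun normal_form :: "('l option \<times> bool) list \<Rightarrow> 'l blocks \<times> int" where
  "normal_form [] = ([], 0)"
| "normal_form ((None, e) # v) = (case normal_form v of
      ([], k) \<Rightarrow> ([], k + (if e then - 1 else 1))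
    | ((i, w) # l, k) \<Rightarrow> ((i + (if e then - 1 else 1), w) # l, k))"
| "normal_form ((Some a, e) # v) = (case normal_form v of
      ([], k) \<Rightarrow> ([(0, [(a, e)])], k)
    | ((i, w) # l, k) \<Rightarrow> if i = 0 then ((0, (a, e) # w) # l, k) else ((0, [(a, e)]) # (i, w) # l, k))"

definition letter_count :: "('l option \<times> bool) list \<Rightarrow> nat" where
  "letter_count v = length (filter (\<lambda>(l, e). l \<noteq> None) v)"

definition block_length :: "'l blocks \<Rightarrow> nat" where
  "block_length l = sum_list (map (\<lambda>(i, w). length w) l)"

definition block_weight :: "('l \<Rightarrow> int) \<Rightarrow> 'l blocks \<Rightarrow> int" where
  "block_weight d l = sum_list (map (\<lambda>(i, w). weight d w) l)"

lemma letter_count_simps [simp]: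
  "letter_count [] = 0" "letter_count ((l, e) # v) = (if l = None then 0 else 1) + letter_count v"
  "letter_count (u @ v) = letter_count u + letter_count v"
  by (simp_all add: letter_count_def)

lemma block_simps [simp]:
  "block_length [] = 0" "block_length ((i, w) # l) = length w + block_length l"
  "block_weight d [] = 0" "block_weight d ((i, w) # l) = weight d w + block_weight d l"
  by (simp_all add: block_length_def block_weight_def)

lemma replicate_None [simp]:
  "letter_count (replicate n (None, e)) = 0" "weight (case_option 0 d) (replicate n (None, e)) = 0"
  by (induction n) simp_all

lemma zword_props [simp]:
  "letter_count (zword k) = 0" "weight (case_option 0 d) (zword k) = 0"
  "zword k \<in> star_words (insert None (Some ` \<Lambda>))"
  by (auto simp: zword_def)

lemma inner_words_props [simp]:
  "letter_count (inner_words w) = length w" "weight (case_option 0 d) (inner_words w) = weight d w"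
  "word (case_option z y) (inner_words w) = word y w"
  by (induction w) auto

lemma inner_words_in: "w \<in> star_words \<Lambda> \<Longrightarrow> inner_words w \<in> star_words (insert None (Some ` \<Lambda>))"
  by (auto simp: in_lists_conv_set)

lemma block_word_props:
  "letter_count (block_word l k) = block_length l"
  "weight (case_option 0 d) (block_word l k) = block_weight d l"
  by (induction l k rule: block_word.induct) auto

text \<open>Only the leading and the trailing power of \<open>z\<close> may be trivial, so after
  dropping those the factors alternate between the two free algebras.\<close>

definition reduced_blocks :: "'l set \<Rightarrow> 'l blocks \<Rightarrow> bool" where
  "reduced_blocks \<Lambda> l \<longleftrightarrow> (\<forall>(i, w)\<in>set l. w \<noteq> [] \<and> w \<in> star_words \<Lambda>) \<and> (\<forall>(i, w)\<in>set (tl l). i \<noteq> 0)"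

lemma reduced_blocks_simps [simp]:
  "reduced_blocks \<Lambda> []"
  "reduced_blocks \<Lambda> ((i, w) # l) \<longleftrightarrow>
    w \<noteq> [] \<and> w \<in> star_words \<Lambda> \<and> reduced_blocks \<Lambda> l \<and> (l \<noteq> [] \<longrightarrow> fst (hd l) \<noteq> 0)"
  by (simp add: reduced_blocks_def) (cases l; simp add: reduced_blocks_def split_beta conj_ac)

lemma block_length_append [simp]: "block_length (l @ l') = block_length l + block_length l'"
  by (simp add: block_length_def)

lemma block_word_in:
  "\<forall>(i, w)\<in>set l. w \<in> star_words \<Lambda> \<Longrightarrow> block_word l k \<in> star_words (insert None (Some ` \<Lambda>))"
proof (induction l k rule: block_word.induct)
  case (2 i w l k)
  then show ?case using inner_words_in[of w \<Lambda>] by simp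
qed simp

text \<open>The last equation keeps the total exponent of \<open>z\<close>; it decides what happens
  when only one block is left.\<close>

lemma normal_form_props:
  assumes "v \<in> star_words (insert None (Some ` \<Lambda>))" "normal_form v = (l, k)"
  shows "reduced_blocks \<Lambda> l" "block_length l = letter_count v" "block_weight d l = weight (case_option 0 d) v"
    "sum_list (map fst l) + k = weight (case_option 1 (\<lambda>_. 0)) v"
proof -
  have "reduced_blocks \<Lambda> l \<and> block_length l = letter_count v \<and> block_weight d l = weight (case_option 0 d) v \<and>
    sum_list (map fst l) + k = weight (case_option 1 (\<lambda>_. 0)) v"
    using assms
  proof (induction v arbitrary: l k rule: normal_form.induct)
    case 1
    then show ?case by simp
  next
    case (2 e v)
    obtain l' k' where nf: "normal_form v = (l', k')" by (cases "normal_form v")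
    have "v \<in> star_words (insert None (Some ` \<Lambda>))" using "2.prems"(1) by simp
    note IH = "2.IH"[OF this nf]
    show ?case
    proof (cases l')
      case Nil
      with "2.prems"(2) nf IH show ?thesis by (cases e) auto
    next
      case (Cons b l'')
      with "2.prems"(2) nf IH show ?thesis by (cases b; cases e; clarsimp)
    qed
  next
    case (3 a e v)
    obtain l' k' where nf: "normal_form v = (l', k')" by (cases "normal_form v")
    have "v \<in> star_words (insert None (Some ` \<Lambda>))" and a: "a \<in> \<Lambda>" using "3.prems"(1) by auto
    note IH = "3.IH"[OF this(1) nf]
    show ?case
    proof (cases l')
      case Nil
      with "3.prems"(2) nf IH a show ?thesis by (cases e) auto
    next
      case (Cons b l'')
      with "3.prems"(2) nf IH a show ?thesis by (cases b; cases e; cases "fst b = 0"; clarsimp)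
    qed
  qed
  then show "reduced_blocks \<Lambda> l" "block_length l = letter_count v" "block_weight d l = weight (case_option 0 d) v"
    "sum_list (map fst l) + k = weight (case_option 1 (\<lambda>_. 0)) v" by auto
qed

section \<open>Words after multiplication of every letter by the Haar unitary\<close>

fun complexify :: "('l \<times> bool) list \<Rightarrow> ('l option \<times> bool) list" where
  "complexify [] = []"
| "complexify ((a, e) # w) =
    (if e then (Some a, True) # (None, True) # complexify w
     else (None, False) # (Some a, False) # complexify w)"

lemma complexify_props [simp]:
  "word (case_option z y) (complexify w) = word (\<lambda>l. z * y l) w"
  "letter_count (complexify w) = length w"
  "weight (case_option 0 d) (complexify w) = weight d w"
  "weight (case_option 1 (\<lambda>_. 0)) (complexify w) = weight (\<lambda>_. 1) w"
  by (induction w rule: complexify.induct) (auto simp: star_mult mult.assoc)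

lemma complexify_in: "w \<in> star_words \<Lambda> \<Longrightarrow> complexify w \<in> star_words (insert None (Some ` \<Lambda>))"
  by (induction w rule: complexify.induct) auto

definition alternating :: "('l \<times> bool) list \<Rightarrow> bool" where
  "alternating w \<longleftrightarrow> successively (\<lambda>a b. snd a \<noteq> snd b) w"

text \<open>Between two neighbouring letters a non-trivial power of \<open>z\<close> remains exactly
  when both are starred or both unstarred. The leading exponent is recorded for the induction: it
  shows whether the next letter to the left merges with the first block.\<close>

lemma normal_form_complexify:
  assumes "w \<noteq> []" "normal_form (complexify w) = (l, k)"
  shows "l \<noteq> [] \<and> fst (hd l) = (if snd (hd w) then 0 else 1) \<and> (length l = 1 \<longrightarrow> alternating w)"
  using assms
proof (induction w arbitrary: l k rule: complexify.induct)
  case (2 a e w)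
  show ?case
  proof (cases "w = []")
    case True
    with 2 show ?thesis by (cases e) (auto simp: alternating_def)
  next
    case False
    obtain l' k' where nf: "normal_form (complexify w) = (l', k')" by (cases "normal_form (complexify w)")
    obtain b e' w' where w: "w = (b, e') # w'" using False by (cases w) auto
    have IH: "l' \<noteq> []" "fst (hd l') = (if e' then 0 else 1)" "length l' = 1 \<longrightarrow> alternating w"
      using "2.IH" False nf w by (cases e; force)+
    obtain i v l'' where l': "l' = (i, v) # l''" using IH(1) by (cases l') auto
    show ?thesis
      using "2.prems" nf IH unfolding l' alternating_def w
      by (cases e; cases e') (auto split: if_splits)
  qed
qed simp

section \<open>Powers of a Haar unitary that is free from the family\<close>

locale free_haar_unitary = tracial \<psi> for \<psi> :: "'m::cstar_algebra \<Rightarrow> complex" +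
  fixes z :: 'm and y :: "'l \<Rightarrow> 'm" and \<Lambda> :: "'l set"
  assumes haar: "haar_unitary \<psi> z" and free: "star_free \<psi> {z} (y ` \<Lambda>)"
begin

abbreviation "Y \<equiv> case_option z y"
abbreviation "all_words \<equiv> star_words (insert None (Some ` \<Lambda>))"

lemma unitary: "star z * z = 1" "z * star z = 1"
  using haar by (auto simp: haar_unitary_def)

lemma zword_pos: "word Y (zword (int n)) = z ^ n"
proof -
  have "word Y (replicate n (None, False)) = z ^ n" by (induction n) auto
  then show ?thesis by (simp add: zword_def)
qed

lemma zword_neg: "word Y (zword (- int n)) = star z ^ n"
proof -
  have "word Y (replicate n (None, True)) = star z ^ n" by (induction n) auto
  then show ?thesis by (simp add: zword_def)
qed

lemma zword_succ: "z * word Y (zword k) = word Y (zword (k + 1))"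
proof (cases "k \<ge> 0")
  case True
  then obtain n where "k = int n" by (metis nonneg_int_cases)
  then show ?thesis using zword_pos[of n] zword_pos[of "Suc n"] by (simp add: add.commute)
next
  case False
  then obtain n where n: "k = - int (Suc n)" by (metis negD linorder_not_le)
  show ?thesis
    using zword_neg[of "Suc n"] zword_neg[of n] unitary by (simp add: n flip: mult.assoc)
qed

lemma zword_pred: "star z * word Y (zword k) = word Y (zword (k - 1))"
  using zword_succ[of "k - 1"] unitary by (metis diff_add_cancel mult.assoc mult_1)

lemma zword_add: "word Y (zword i) * word Y (zword j) = word Y (zword (i + j))"
proof (induction i rule: int_induct[of _ 0])
  case base
  then show ?case using zword_pos[of 0] by simp
next
  case (step1 i)
  then show ?case using zword_succ[of i] zword_succ[of "i + j"] by (metis add.commute add.left_commute mult.assoc)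
next
  case (step2 i)
  then show ?case using zword_pred[of i] zword_pred[of "i + j"]
    by (metis add_diff_eq diff_add_eq mult.assoc add.commute)
qed

lemma trace_zword: "k \<noteq> 0 \<Longrightarrow> \<psi> (word Y (zword k)) = 0"
proof -
  assume k: "k \<noteq> 0"
  have "word Y (zword k) = (if 0 \<le> k then z ^ nat k else star z ^ nat (- k))"
  proof (cases "0 \<le> k")
    case True
    then show ?thesis using zword_pos[of "nat k"] by simp
  next
    case False
    then show ?thesis using zword_neg[of "nat (- k)"] by simp
  qed
  then show ?thesis using haar k unfolding haar_unitary_def by metis
qed

lemma word_normal_form:
  "normal_form v = (l, k) \<Longrightarrow> word Y v = word Y (block_word l k)"
proof (induction v arbitrary: l k rule: normal_form.induct)
  case 1
  then show ?case using zword_pos[of 0] by simp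
next
  case (2 e v)
  obtain l' k' where nf: "normal_form v = (l', k')" by (cases "normal_form v")
  note IH = "2.IH"[OF nf]
  show ?case
  proof (cases l')
    case Nil
    with "2.prems" nf IH show ?thesis
      by (auto simp: zword_succ zword_pred)
  next
    case (Cons b l'')
    with "2.prems" nf IH show ?thesis
      by (cases b) (auto simp: zword_succ zword_pred simp flip: mult.assoc)
  qed
next
  case (3 a e v)
  obtain l' k' where nf: "normal_form v = (l', k')" by (cases "normal_form v")
  note IH = "3.IH"[OF nf]
  have z0: "word Y (zword 0) = 1" using zword_pos[of 0] by simp
  show ?case
  proof (cases l')
    case Nil
    with "3.prems" nf IH show ?thesis by (auto simp: z0)
  next
    case (Cons b l'')
    with "3.prems" nf IH show ?thesis
      by (cases b) (auto simp: z0 mult.assoc split: if_splits)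
  qed
qed

section \<open>Centered alternating products and their expansion\<close>

definition centered :: "('l \<times> bool) list \<Rightarrow> 'm" where
  "centered w = word y w - \<psi> (word y w) *\<^sub>C 1"

fun centered_list :: "'l blocks \<Rightarrow> int \<Rightarrow> 'm list" where
  "centered_list [] k = (if k = 0 then [] else [word Y (zword k)])"
| "centered_list ((i, w) # l) k = word Y (zword i) # centered w # centered_list l k"

definition alternates :: "'m set \<Rightarrow> 'm set \<Rightarrow> 'm list \<Rightarrow> bool" where
  "alternates A B as \<longleftrightarrow> (\<forall>j<length as. as ! j \<in> (if even j then A else B))"

lemma alternates_Nil [simp]: "alternates A B []"
  by (simp add: alternates_def)

lemma alternates_Cons [simp]: "alternates A B (a # as) \<longleftrightarrow> a \<in> A \<and> alternates B A as"
  by (auto simp: alternates_def nth_Cons split: nat.splits)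

lemma zword_in: "word Y (zword k) \<in> star_alg_gen {z}"
proof -
  have z: "z ^ n \<in> star_alg_gen {z}" "star z ^ n \<in> star_alg_gen {z}" for n
    by (simp_all add: star_alg_gen_power alg_gen_star_algI(2,3))
  show ?thesis
  proof (cases "0 \<le> k")
    case True
    then show ?thesis using z(1) zword_pos[of "nat k"] by simp
  next
    case False
    then show ?thesis using z(2) zword_neg[of "nat (- k)"] by simp
  qed
qed

lemma centered_in: "w \<in> star_words \<Lambda> \<Longrightarrow> centered w \<in> star_alg_gen (y ` \<Lambda>)"
  unfolding centered_def diff_conv_add_uminus scaleC_minus_left[symmetric]
  by (intro alg_gen_star_algI word_in_star_alg_gen)

lemma trace_centered: "\<psi> (centered w) = 0"
  by (simp add: centered_def trace_diff trace_scaleC)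

lemma centered_list_alternates:
  "\<forall>(i, w)\<in>set l. i \<noteq> 0 \<and> w \<in> star_words \<Lambda> \<Longrightarrow>
    alternates (star_alg_gen {z}) (star_alg_gen (y ` \<Lambda>)) (centered_list l k) \<and>
    (\<forall>a\<in>set (centered_list l k). \<psi> a = 0)"
  by (induction l k rule: centered_list.induct)
    (auto simp: zword_in centered_in trace_centered trace_zword)

lemma trace_centered_list:
  assumes l: "reduced_blocks \<Lambda> l" "l \<noteq> []"
  shows "\<psi> (prod_list (centered_list l k)) = 0"
proof -
  obtain i w l' where l': "l = (i, w) # l'" using l(2) by (cases l) auto
  have F: "\<psi> (prod_list as) = 0" if "as \<noteq> []" "\<forall>a\<in>set as. \<psi> a = 0"
    "alternates (star_alg_gen {z}) (star_alg_gen (y ` \<Lambda>)) as \<or> alternates (star_alg_gen (y ` \<Lambda>)) (star_alg_gen {z}) as" for as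
    using free that unfolding star_free_def free_subalgebras_def alternates_def by blast
  have 1: "\<forall>(i, w)\<in>set l'. i \<noteq> 0 \<and> w \<in> star_words \<Lambda>" and w: "w \<in> star_words \<Lambda>"
    using l unfolding l' reduced_blocks_def by auto
  note alt = centered_list_alternates[OF 1, of k]
  show ?thesis
  \<comment> \<open>A leading power z^0 = 1 is not centered; it is dropped, and the alternating
    product then starts in the algebra of the family.\<close>
  proof (cases "i = 0")
    case True
    have "\<psi> (prod_list (centered w # centered_list l' k)) = 0"
      using alt w by (intro F) (auto simp: centered_in trace_centered)
    then show ?thesis using zword_pos[of 0] by (simp add: l' True)
  next
    case False
    then show ?thesis
      using alt w unfolding l' by (intro F) (auto simp: centered_in trace_centered zword_in trace_zword)
  qed
qed

text \<open>These are the error terms of the expansion: fewer letters but one common weight. Powers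
  of \<open>z\<close> cost nothing, since \<open>None\<close> counts neither as a letter nor in the
  weight.\<close>

inductive_set short_span :: "('l \<Rightarrow> int) \<Rightarrow> nat \<Rightarrow> int \<Rightarrow> 'm set" for d n D where
  zero: "0 \<in> short_span d n D"
| add: "s \<in> short_span d n D \<Longrightarrow> v \<in> all_words \<Longrightarrow> letter_count v < n \<Longrightarrow>
    weight (case_option 0 d) v = D \<Longrightarrow> s + c *\<^sub>C word Y v \<in> short_span d n D"

lemma short_span_word:
  "v \<in> all_words \<Longrightarrow> letter_count v < n \<Longrightarrow> weight (case_option 0 d) v = D \<Longrightarrow>
    c *\<^sub>C word Y v \<in> short_span d n D"
  using short_span.add[OF short_span.zero, of v n d D c] by simp

lemma short_span_add:
  assumes "s \<in> short_span d n D"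
  shows "t \<in> short_span d n D \<Longrightarrow> s + t \<in> short_span d n D"
proof (induction rule: short_span.induct)
  case zero
  then show ?case using assms by simp
next
  case (add t v c)
  then show ?case using short_span.add[OF add.IH add.hyps(2-4), of c] by (simp add: add.assoc)
qed

lemma short_span_mult:
  assumes u: "u \<in> all_words"
    and m: "letter_count u + n \<le> m" "weight (case_option 0 d) u + D = E"
  shows "t \<in> short_span d n D \<Longrightarrow> c *\<^sub>C word Y u * t \<in> short_span d m E"
proof (induction rule: short_span.induct)
  case zero
  then show ?case by (simp add: short_span.zero)
next
  case (add t v e)
  have "u @ v \<in> all_words" using u add.hyps(2) by simp
  from short_span.add[OF add.IH this, of "c * e"] add.hyps m show ?case
    by (simp add: distrib_left mult_scaleC_left mult_scaleC_right scaleC_scaleC mult.commute[of e c])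
qed

lemma short_span_trace:
  assumes "\<And>v. v \<in> all_words \<Longrightarrow> letter_count v < n \<Longrightarrow> weight (case_option 0 d) v = D \<Longrightarrow> \<psi> (word Y v) = 0"
  shows "t \<in> short_span d n D \<Longrightarrow> \<psi> t = 0"
  by (induction rule: short_span.induct) (simp_all add: trace_add trace_scaleC assms)

text \<open>Expanding the centered factors of an alternating product: every other term has fewer letters.\<close>

lemma centered_list_expand:
  assumes "\<forall>(i, w)\<in>set l. w \<noteq> [] \<and> w \<in> star_words \<Lambda> \<and> (\<psi> (word y w) \<noteq> 0 \<longrightarrow> weight d w = 0)"
  shows "\<exists>s\<in>short_span d (block_length l) (block_weight d l).
    prod_list (centered_list l k) = word Y (block_word l k) + s"
  using assms
proof (induction l)
  case Nil
  show ?case by (rule bexI[of _ 0]) (use zword_pos[of 0] in \<open>auto intro: short_span.zero\<close>)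
next
  case (Cons b l)
  obtain i w where b: "b = (i, w)" by (cases b)
  then have w: "w \<noteq> []" "w \<in> star_words \<Lambda>" "\<psi> (word y w) \<noteq> 0 \<Longrightarrow> weight d w = 0"
    and l: "\<forall>(i, w)\<in>set l. w \<in> star_words \<Lambda>"
    using Cons.prems by auto
  obtain s where s: "s \<in> short_span d (block_length l) (block_weight d l)"
    "prod_list (centered_list l k) = word Y (block_word l k) + s"
    using Cons by auto
  define \<alpha> where "\<alpha> = \<psi> (word y w)"
  let ?n = "block_length (b # l)" and ?D = "block_weight d (b # l)"
  have iw: "zword i @ inner_words w \<in> all_words"
    using inner_words_in[OF w(2)] by simp
  have 1: "1 *\<^sub>C word Y (zword i @ inner_words w) * s \<in> short_span d ?n ?D"
    by (rule short_span_mult[OF iw _ _ s(1)]) (simp_all add: b del: word_simps)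
  \<comment> \<open>Replacing \<open>w\<close> by the scalar \<alpha> loses its letters but keeps
    the weight, because \<alpha> is non-zero only if \<open>w\<close> has weight 0. The same applies
    to the third term.\<close>
  have 2: "(- \<alpha>) *\<^sub>C word Y (zword i) * s \<in> short_span d ?n ?D"
  proof (cases "\<alpha> = 0")
    case False
    then show ?thesis using w(3)
      by (intro short_span_mult[OF _ _ _ s(1)]) (simp_all add: b \<alpha>_def)
  qed (simp add: short_span.zero)
  have 3: "(- \<alpha>) *\<^sub>C word Y (zword i @ block_word l k) \<in> short_span d ?n ?D"
  proof (cases "\<alpha> = 0")
    case False
    then show ?thesis using w(1,3) block_word_in[OF l, of k]
      by (intro short_span_word) (simp_all add: b \<alpha>_def block_word_props)
  qed (simp add: short_span.zero)
  show ?case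
  proof (rule bexI[OF _ short_span_add[OF short_span_add[OF 1 2] 3]])
    show "prod_list (centered_list (b # l) k) = word Y (block_word (b # l) k) +
      (1 *\<^sub>C word Y (zword i @ inner_words w) * s + (- \<alpha>) *\<^sub>C word Y (zword i) * s +
        (- \<alpha>) *\<^sub>C word Y (zword i @ block_word l k))"
      by (simp add: b s(2) centered_def \<alpha>_def[symmetric] algebra_simps mult_scaleC_left mult_scaleC_right
        scaleC_minus_left scaleC_diff_right scaleC_add_right)
  qed
qed

text \<open>With at least two blocks each inner word is strictly shorter than the whole, so by
  \<open>P\<close> its trace is non-zero only at weight 0 and the expansion applies. Freeness kills
  the centered product and \<open>Q\<close> kills the error terms.\<close>

lemma trace_block_word:
  assumes l: "reduced_blocks \<Lambda> l" "length l \<ge> 2" and wt: "block_weight d l \<noteq> 0"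
    and P: "\<And>w. w \<in> star_words \<Lambda> \<Longrightarrow> length w < block_length l \<Longrightarrow> weight d w \<noteq> 0 \<Longrightarrow> \<psi> (word y w) = 0"
    and Q: "\<And>v. v \<in> all_words \<Longrightarrow> letter_count v < block_length l \<Longrightarrow> weight (case_option 0 d) v \<noteq> 0 \<Longrightarrow> \<psi> (word Y v) = 0"
  shows "\<psi> (word Y (block_word l k)) = 0"
proof -
  have short: "length w < block_length l" if iw: "(i, w) \<in> set l" for i w
  proof -
    obtain l1 l2 where l12: "l = l1 @ (i, w) # l2" using iw by (meson split_list)
    with l(2) have "l1 @ l2 \<noteq> []" by auto
    then obtain j v where jv: "(j, v) \<in> set (l1 @ l2)" by (metis last_in_set surj_pair)
    then have "v \<noteq> []" using l(1) l12 by (auto simp: reduced_blocks_def)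
    moreover obtain u u' where "l1 @ l2 = u @ (j, v) # u'" using jv by (meson split_list)
    then have "length v \<le> block_length (l1 @ l2)" by simp
    ultimately have "block_length (l1 @ l2) > 0" by (cases v) auto
    then show ?thesis by (simp add: l12)
  qed
  have "\<forall>(i, w)\<in>set l. w \<noteq> [] \<and> w \<in> star_words \<Lambda> \<and> (\<psi> (word y w) \<noteq> 0 \<longrightarrow> weight d w = 0)"
    using l(1) P short unfolding reduced_blocks_def by blast
  from centered_list_expand[OF this, of k] obtain s
    where s: "s \<in> short_span d (block_length l) (block_weight d l)"
      "prod_list (centered_list l k) = word Y (block_word l k) + s" by blast
  have "\<psi> s = 0" using wt by (intro short_span_trace[OF _ s(1)] Q) auto
  moreover have "\<psi> (prod_list (centered_list l k)) = 0"
    using l by (intro trace_centered_list) auto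
  ultimately show ?thesis using s(2) by (simp add: trace_add)
qed

text \<open>By traciality the two outer powers combine. If a non-trivial power of \<open>z\<close>
  remains, it is centered and free from \<open>w\<close>, so the trace factors and vanishes.\<close>

lemma trace_single_block:
  assumes w: "w \<noteq> []" "w \<in> star_words \<Lambda>"
  shows "\<psi> (word Y (block_word [(i, w)] k)) = (if i + k = 0 then \<psi> (word y w) else 0)"
proof -
  have "\<psi> (word Y (block_word [(i, w)] k)) = \<psi> (word Y (zword k) * (word Y (zword i) * word y w))"
    by (simp add: trace_commute[of _ "word Y (zword k)"] flip: mult.assoc)
  also have "\<dots> = \<psi> (word Y (zword (i + k)) * word y w)"
    by (simp add: zword_add add.commute flip: mult.assoc)
  finally have eq: "\<psi> (word Y (block_word [(i, w)] k)) = \<psi> (word Y (zword (i + k)) * word y w)" .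
  show ?thesis
  proof (cases "i + k = 0")
    case True
    then show ?thesis using zword_pos[of 0] by (simp only: eq) simp
  next
    case False
    have "\<psi> (prod_list (centered_list [(i + k, w)] 0)) = 0"
      using w by (intro trace_centered_list) (auto simp: reduced_blocks_def)
    then have "\<psi> (word Y (zword (i + k)) * word y w) = \<psi> (word y w) * \<psi> (word Y (zword (i + k)))"
      by (simp add: centered_def right_diff_distrib mult_scaleC_right trace_diff trace_scaleC)
    then show ?thesis using False by (simp only: eq) (simp add: trace_zword)
  qed
qed

text \<open>Induction on the number of letters, simultaneously for words over \<Lambda> and for
  words that also contain \<open>z\<close>: centering a block needs the former, and expansion
  produces the latter. By \<open>inv\<close> powers of \<open>z\<close> may be inserted, and
  freeness settles every word whose normal form then has several blocks.\<close>

theorem weight_invariant_of_alternating: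
  assumes alt: "\<And>w. w \<in> star_words \<Lambda> \<Longrightarrow> alternating w \<Longrightarrow> weight (\<lambda>_. 1) w = 0 \<Longrightarrow>
      weight d w \<noteq> 0 \<Longrightarrow> \<psi> (word y w) = 0"
    and inv: "\<And>w. w \<in> star_words \<Lambda> \<Longrightarrow> \<psi> (word (\<lambda>l. z * y l) w) = \<psi> (word y w)"
  shows "weight_invariant \<psi> \<Lambda> y d"
proof -
  have "(\<forall>w\<in>star_words \<Lambda>. length w = n \<longrightarrow> weight d w \<noteq> 0 \<longrightarrow> \<psi> (word y w) = 0) \<and>
    (\<forall>v\<in>all_words. letter_count v = n \<longrightarrow> weight (case_option 0 d) v \<noteq> 0 \<longrightarrow> \<psi> (word Y v) = 0)" for n
  proof (induction n rule: less_induct)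
    case (less n)
    have block: "\<psi> (word Y (block_word l k)) = 0"
      if "reduced_blocks \<Lambda> l" "length l \<ge> 2" "block_weight d l \<noteq> 0" "block_length l = n" for l k
      using less.IH that by (intro trace_block_word) auto
    have P: "\<psi> (word y w) = 0" if w: "w \<in> star_words \<Lambda>" "length w = n" "weight d w \<noteq> 0" for w
    proof -
      have "w \<noteq> []" using w(3) by auto
      obtain l k where nf: "normal_form (complexify w) = (l, k)" by fastforce
      note nfp = normal_form_props[OF complexify_in[OF w(1)] nf, simplified]
      note nfc = normal_form_complexify[OF \<open>w \<noteq> []\<close> nf]
      have eq: "\<psi> (word y w) = \<psi> (word Y (block_word l k))"
        using inv[OF w(1)] word_normal_form[OF nf] by simp
      show ?thesis
      proof (cases "length l \<ge> 2")
        case True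
        then show ?thesis unfolding eq using nfp w by (intro block) auto
      next
        case False
        then have "length l = 1" using nfc by (cases l) (auto simp: not_le less_Suc_eq)
        then obtain i v where l: "l = [(i, v)]" by (cases l) auto
        have v: "v \<noteq> []" "v \<in> star_words \<Lambda>" using nfp(1) by (auto simp: l reduced_blocks_def)
        show ?thesis
        proof (cases "i + k = 0")
          case True
          \<comment> \<open>A single block means that \<open>w\<close> alternates, and the total
            exponent i + k of \<open>z\<close> is the degree of \<open>w\<close>, which is therefore
            0.\<close>
          then show ?thesis using alt w nfc nfp(4) by (simp add: l)
        next
          case False
          then show ?thesis unfolding eq l trace_single_block[OF v] by simp
        qed
      qed
    qed
    have Q: "\<psi> (word Y v) = 0" if v: "v \<in> all_words" "letter_count v = n" "weight (case_option 0 d) v \<noteq> 0" for v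
    proof -
      obtain l k where nf: "normal_form v = (l, k)" by fastforce
      note nfp = normal_form_props[OF v(1) nf]
      have "l \<noteq> []" using nfp(3)[of d] v(3) by auto
      show ?thesis
      proof (cases "length l \<ge> 2")
        case True
        then show ?thesis unfolding word_normal_form[OF nf] using nfp v by (intro block) auto
      next
        case False
        then have "length l = 1" using \<open>l \<noteq> []\<close> by (cases l) (auto simp: not_le less_Suc_eq)
        then obtain i w where l: "l = [(i, w)]" by (cases l) auto
        have w: "w \<noteq> []" "w \<in> star_words \<Lambda>" using nfp(1) by (auto simp: l reduced_blocks_def)
        \<comment> \<open>The inner word has all \<open>n\<close> letters, so the claim just proved
          for words without \<open>z\<close> is used at the same length.\<close>
        have "\<psi> (word y w) = 0" using P[of w] w nfp(2) nfp(3)[of d] v by (simp add: l)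
        then show ?thesis unfolding word_normal_form[OF nf] l trace_single_block[OF w] by simp
      qed
    qed
    from P Q show ?case by blast
  qed
  then show ?thesis unfolding weight_invariant_def by blast
qed

end

section \<open>Reflections and hyperoctahedral invariance\<close>

type_synonym plane = "complex \<times> complex"

definition cscale :: "complex \<Rightarrow> plane \<Rightarrow> plane" where
  "cscale c v = (c * fst v, c * snd v)"

text \<open>The self-adjoint unitary matrix with zero diagonal and off-diagonal entries
  \<open>cis t\<close> and \<open>cis (- t)\<close>. A product of two of them is diagonal with
  phases given by the difference of the angles.\<close>

definition reflection :: "real \<Rightarrow> plane \<Rightarrow> plane" where
  "reflection t v = (cis t * snd v, cis (- t) * fst v)"

text \<open>The diagonal matrix of the reflections with angles \<^term>\<open>\<beta> r\<close> satisfies the relations of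
  $A_H(n)$ for every $n$.\<close>

definition gen_op :: "(nat \<Rightarrow> real) \<Rightarrow> gen \<Rightarrow> plane \<Rightarrow> plane" where
  "gen_op \<beta> g = (case g of (n, r, s) \<Rightarrow> if r = s \<and> r \<in> {1..n} then reflection (\<beta> r) else (\<lambda>_. 0))"

fun letters_op :: "(nat \<Rightarrow> real) \<Rightarrow> gen list \<Rightarrow> plane \<Rightarrow> plane" where
  "letters_op \<beta> [] v = v"
| "letters_op \<beta> (g # gs) v = gen_op \<beta> g (letters_op \<beta> gs v)"

definition poly_op :: "(nat \<Rightarrow> real) \<Rightarrow> gen free_alg \<Rightarrow> plane \<Rightarrow> plane" where
  "poly_op \<beta> p v = (\<Sum>w\<in>Poly_Mapping.keys p. cscale (Poly_Mapping.lookup p w) (letters_op \<beta> (letters w) v))"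

lemma cscale_simps:
  "cscale c (u + v) = cscale c u + cscale c v" "cscale (c + d) v = cscale c v + cscale d v"
  "cscale c (cscale d v) = cscale (c * d) v" "cscale 0 v = 0" "cscale c 0 = 0" "cscale 1 v = v"
  "cscale (complex_of_real r) v = r *\<^sub>R v"
  by (auto simp: cscale_def prod_eq_iff algebra_simps scaleR_conv_of_real)

lemma norm_cscale: "norm (cscale c v) = cmod c * norm v"
proof -
  have "(cmod c * cmod a)\<^sup>2 + (cmod c * cmod b)\<^sup>2 = (cmod c)\<^sup>2 * ((cmod a)\<^sup>2 + (cmod b)\<^sup>2)" for a b
    by (simp add: power_mult_distrib distrib_left)
  then show ?thesis
    by (simp add: cscale_def norm_prod_def norm_mult real_sqrt_mult)
qed

text \<open>Here \<open>inner\<close> is the real part of the Hermitian product. It induces the same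
  norm, and adjoints with respect to it suffice for the C*-identity.\<close>

lemma inner_cscale: "inner (cscale (cnj c) u) v = inner u (cscale c v)"
  by (simp add: cscale_def inner_prod_def inner_complex_def algebra_simps)

lemma reflection_linear:
  "reflection t (u + v) = reflection t u + reflection t v" "reflection t (cscale c v) = cscale c (reflection t v)"
  by (auto simp: reflection_def cscale_def prod_eq_iff algebra_simps)

lemma reflection_reflection: "reflection t (reflection t v) = v"
  by (simp add: reflection_def prod_eq_iff cis_mult flip: mult.assoc)

lemma inner_reflection: "inner (reflection t u) v = inner u (reflection t v)"
  by (simp add: reflection_def inner_prod_def inner_complex_def algebra_simps)

lemma gen_op_linear:
  "gen_op \<beta> g (u + v) = gen_op \<beta> g u + gen_op \<beta> g v" "gen_op \<beta> g (cscale c v) = cscale c (gen_op \<beta> g v)"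
  "gen_op \<beta> g 0 = 0"
  using reflection_linear(2)[of _ 0 0]
  by (auto simp: gen_op_def reflection_linear cscale_simps split: prod.splits)

lemma inner_gen_op: "inner (gen_op \<beta> g u) v = inner u (gen_op \<beta> g v)"
  by (auto simp: gen_op_def inner_reflection split: prod.splits)

lemma letters_op_linear:
  "letters_op \<beta> gs (u + v) = letters_op \<beta> gs u + letters_op \<beta> gs v"
  "letters_op \<beta> gs (cscale c v) = cscale c (letters_op \<beta> gs v)"
  by (induction gs) (simp_all add: gen_op_linear)

lemma letters_op_append: "letters_op \<beta> (gs @ hs) v = letters_op \<beta> gs (letters_op \<beta> hs v)"
  by (induction gs) simp_all

lemma inner_letters_op: "inner (letters_op \<beta> (rev gs) u) v = inner u (letters_op \<beta> gs v)"
  by (induction gs arbitrary: u) (simp_all add: letters_op_append inner_gen_op)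

lemma poly_op_superset:
  "finite W \<Longrightarrow> Poly_Mapping.keys p \<subseteq> W \<Longrightarrow>
    poly_op \<beta> p v = (\<Sum>w\<in>W. cscale (Poly_Mapping.lookup p w) (letters_op \<beta> (letters w) v))"
  unfolding poly_op_def by (rule sum.mono_neutral_left) (auto simp: in_keys_iff cscale_simps)

lemma poly_op_single: "poly_op \<beta> (Poly_Mapping.single w c) v = cscale c (letters_op \<beta> (letters w) v)"
  by (subst poly_op_superset[of "{w}"]) auto

lemma poly_op_add: "poly_op \<beta> (p + q) v = poly_op \<beta> p v + poly_op \<beta> q v"
proof -
  let ?W = "Poly_Mapping.keys p \<union> Poly_Mapping.keys q"
  have "Poly_Mapping.keys (p + q) \<subseteq> ?W" by (rule keys_add)
  then show ?thesis
    by (simp add: poly_op_superset[of ?W] lookup_add cscale_simps sum.distrib)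
qed

lemma poly_op_linear:
  "poly_op \<beta> p (u + v) = poly_op \<beta> p u + poly_op \<beta> p v"
  "poly_op \<beta> p (cscale c v) = cscale c (poly_op \<beta> p v)"
  by (induction p rule: single_add_induct)
    (simp_all add: poly_op_single poly_op_add letters_op_linear cscale_simps mult.commute)

lemma poly_op_mult: "poly_op \<beta> (p * q) v = poly_op \<beta> p (poly_op \<beta> q v)"
proof (induction p rule: single_add_induct)
  case (single w c)
  show ?case
    by (induction q rule: single_add_induct)
      (simp_all add: mult_single distrib_left poly_op_single poly_op_add letters_op_linear
        letters_op_append cscale_simps)
qed (simp add: distrib_right poly_op_add)

lemma poly_op_fscale: "poly_op \<beta> (fscale c p) v = cscale c (poly_op \<beta> p v)"
  by (simp add: fscale_def poly_op_mult poly_op_single)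

lemma poly_op_one: "poly_op \<beta> 1 v = v"
  using poly_op_single[of \<beta> 0 1 v] by (simp add: cscale_simps)

lemma poly_op_zero: "poly_op \<beta> 0 v = 0"
  by (simp add: poly_op_def)

lemma poly_op_diff: "poly_op \<beta> (p - q) v = poly_op \<beta> p v - poly_op \<beta> q v"
  using poly_op_add[of \<beta> "p - q" q v] by simp

lemma poly_op_sum: "poly_op \<beta> (\<Sum>k\<in>K. f k) v = (\<Sum>k\<in>K. poly_op \<beta> (f k) v)"
  by (induction K rule: infinite_finite_induct) (simp_all add: poly_op_add poly_op_zero)

lemma poly_op_fgen: "poly_op \<beta> (fgen g) v = gen_op \<beta> g v"
  by (simp add: fgen_def poly_op_single cscale_simps)

lemma poly_op_prod_fgen: "poly_op \<beta> (prod_list (map fgen gs)) v = letters_op \<beta> gs v"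
  by (induction gs) (simp_all add: poly_op_one poly_op_mult poly_op_fgen)

lemma inner_poly_op: "inner (poly_op \<beta> (fstar p) u) v = inner u (poly_op \<beta> p v)"
proof (induction p rule: single_add_induct)
  case (single w c)
  have "inner (poly_op \<beta> (fstar (Poly_Mapping.single w c)) u) v =
      inner (letters_op \<beta> (rev (letters w)) (cscale (cnj c) u)) v"
    by (simp add: poly_op_single word_rev_def letters_op_linear)
  also have "\<dots> = inner u (poly_op \<beta> (Poly_Mapping.single w c) v)"
    by (simp add: inner_letters_op inner_cscale poly_op_single)
  finally show ?case .
qed (simp add: fstar_add poly_op_add inner_add_left inner_add_right)

lemma bounded_linear_poly_op: "bounded_linear (poly_op \<beta> p)"
proof -
  have "linear (poly_op \<beta> p)"
    using poly_op_linear(2)[of \<beta> p "complex_of_real _"]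
    by (intro linearI) (simp_all add: poly_op_linear cscale_simps)
  then show ?thesis by (simp add: linear_conv_bounded_linear)
qed

text \<open>Being a C*-seminorm that vanishes on the relators, it lies below
  \<open>AH_seminorm\<close>. Thus a polynomial that is 0 in \<open>AH_free\<close> also acts as 0
  on the plane, which is all that is needed of the representation.\<close>

definition op_norm :: "(nat \<Rightarrow> real) \<Rightarrow> gen free_alg \<Rightarrow> real" where
  "op_norm \<beta> p = onorm (poly_op \<beta> p)"

lemma norm_poly_op_le: "norm (poly_op \<beta> p v) \<le> op_norm \<beta> p * norm v"
  unfolding op_norm_def by (rule onorm[OF bounded_linear_poly_op])

lemma op_norm_nonneg: "0 \<le> op_norm \<beta> p"
  unfolding op_norm_def by (rule onorm_pos_le[OF bounded_linear_poly_op])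

lemma op_norm_le: "0 \<le> b \<Longrightarrow> (\<And>v. norm (poly_op \<beta> p v) \<le> b * norm v) \<Longrightarrow> op_norm \<beta> p \<le> b"
  unfolding op_norm_def by (rule onorm_bound)

lemma op_norm_fstar_le: "op_norm \<beta> (fstar p) \<le> op_norm \<beta> p"
proof (rule op_norm_le[OF op_norm_nonneg])
  fix v
  define u where "u = poly_op \<beta> (fstar p) v"
  have "norm u * norm u = inner (poly_op \<beta> (fstar p) v) u"
    by (simp add: u_def power2_norm_eq_inner flip: power2_eq_square)
  also have "\<dots> = inner v (poly_op \<beta> p u)" by (rule inner_poly_op)
  also have "\<dots> \<le> norm v * (op_norm \<beta> p * norm u)"
    by (intro order_trans[OF norm_cauchy_schwarz] mult_left_mono norm_poly_op_le) auto
  finally have "norm u * norm u \<le> (op_norm \<beta> p * norm v) * norm u" by (simp add: mult_ac)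
  then show "norm u \<le> op_norm \<beta> p * norm v"
    by (cases "u = 0") (simp_all add: op_norm_nonneg)
qed

lemma op_norm_cstar_seminorm: "cstar_seminorm (op_norm \<beta>)"
  unfolding cstar_seminorm_def
proof (intro conjI allI)
  fix p q :: "gen free_alg" and c :: complex
  show "0 \<le> op_norm \<beta> p" by (rule op_norm_nonneg)
  show "op_norm \<beta> (p + q) \<le> op_norm \<beta> p + op_norm \<beta> q"
    by (rule op_norm_le)
      (auto simp: op_norm_nonneg poly_op_add distrib_right intro!: norm_triangle_mono norm_poly_op_le)
  have le: "op_norm \<beta> (fscale c p) \<le> cmod c * op_norm \<beta> p" for c p
    by (rule op_norm_le)
      (auto simp: op_norm_nonneg poly_op_fscale norm_cscale mult.assoc intro!: mult_left_mono norm_poly_op_le)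
  show "op_norm \<beta> (fscale c p) = cmod c * op_norm \<beta> p"
  proof (cases "c = 0")
    case True
    then show ?thesis using le[of 0 p] op_norm_nonneg[of \<beta> "fscale c p"] by simp
  next
    case False
    have "op_norm \<beta> p \<le> cmod (inverse c) * op_norm \<beta> (fscale c p)"
      using le[of "inverse c" "fscale c p"] False by (simp add: fscale_fscale)
    then have "cmod c * op_norm \<beta> p \<le> op_norm \<beta> (fscale c p)"
      using False by (simp add: norm_divide field_simps)
    then show ?thesis using le[of c p] by simp
  qed
  have mult: "op_norm \<beta> (p * q) \<le> op_norm \<beta> p * op_norm \<beta> q" for p q
  proof (rule op_norm_le)
    fix v
    have "norm (poly_op \<beta> (p * q) v) \<le> op_norm \<beta> p * norm (poly_op \<beta> q v)"
      unfolding poly_op_mult by (rule norm_poly_op_le)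
    also have "\<dots> \<le> op_norm \<beta> p * (op_norm \<beta> q * norm v)"
      by (intro mult_left_mono norm_poly_op_le op_norm_nonneg)
    finally show "norm (poly_op \<beta> (p * q) v) \<le> op_norm \<beta> p * op_norm \<beta> q * norm v"
      by (simp add: mult.assoc)
  qed (simp add: op_norm_nonneg)
  then show "op_norm \<beta> (p * q) \<le> op_norm \<beta> p * op_norm \<beta> q" .
  show "op_norm \<beta> (fstar p * p) = (op_norm \<beta> p)\<^sup>2"
  proof (rule antisym)
    show "op_norm \<beta> (fstar p * p) \<le> (op_norm \<beta> p)\<^sup>2"
      using mult[of "fstar p" p] mult_right_mono[OF op_norm_fstar_le op_norm_nonneg, of \<beta> p \<beta> p]
      by (simp add: power2_eq_square)
    have "op_norm \<beta> p \<le> sqrt (op_norm \<beta> (fstar p * p))"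
    proof (rule op_norm_le)
      fix v
      have "(norm (poly_op \<beta> p v))\<^sup>2 = inner v (poly_op \<beta> (fstar p * p) v)"
        using inner_poly_op[of \<beta> p "poly_op \<beta> p v" v]
        by (simp add: poly_op_mult power2_norm_eq_inner inner_commute)
      also have "\<dots> \<le> norm v * (op_norm \<beta> (fstar p * p) * norm v)"
        by (intro order_trans[OF norm_cauchy_schwarz] mult_left_mono norm_poly_op_le) auto
      finally have "(norm (poly_op \<beta> p v))\<^sup>2 \<le> (sqrt (op_norm \<beta> (fstar p * p)) * norm v)\<^sup>2"
        by (simp add: power_mult_distrib op_norm_nonneg power2_eq_square mult_ac)
      then show "norm (poly_op \<beta> p v) \<le> sqrt (op_norm \<beta> (fstar p * p)) * norm v"
        by (rule power2_le_imp_le) (simp add: op_norm_nonneg)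
    qed (simp add: op_norm_nonneg)
    then have "(op_norm \<beta> p)\<^sup>2 \<le> (sqrt (op_norm \<beta> (fstar p * p)))\<^sup>2"
      by (intro power_mono op_norm_nonneg)
    then show "(op_norm \<beta> p)\<^sup>2 \<le> op_norm \<beta> (fstar p * p)" by (simp add: op_norm_nonneg)
  qed
qed

lemma poly_op_relator:
  assumes "x \<in> AH_relators"
  shows "poly_op \<beta> x v = 0"
proof -
  have sum: "(\<Sum>k=1..n. gen_op \<beta> (n, r, k) (gen_op \<beta> (n, s, k) v)) = (if r = s then v else 0)"
    "(\<Sum>k=1..n. gen_op \<beta> (n, k, r) (gen_op \<beta> (n, k, s) v)) = (if r = s then v else 0)"
    if "r \<in> {1..n}" "s \<in> {1..n}" for n r s
  proof -
    have "(\<Sum>k=1..n. gen_op \<beta> (n, r, k) (gen_op \<beta> (n, s, k) v)) = (\<Sum>k=1..n. if k = r then if r = s then v else 0 else 0)"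
      using that by (intro sum.cong refl) (auto simp: gen_op_def reflection_reflection reflection_linear(2)[of _ 0 0, simplified cscale_simps])
    then show "(\<Sum>k=1..n. gen_op \<beta> (n, r, k) (gen_op \<beta> (n, s, k) v)) = (if r = s then v else 0)"
      using that by simp
    have "(\<Sum>k=1..n. gen_op \<beta> (n, k, r) (gen_op \<beta> (n, k, s) v)) = (\<Sum>k=1..n. if k = r then if r = s then v else 0 else 0)"
      using that by (intro sum.cong refl) (auto simp: gen_op_def reflection_reflection reflection_linear(2)[of _ 0 0, simplified cscale_simps])
    then show "(\<Sum>k=1..n. gen_op \<beta> (n, k, r) (gen_op \<beta> (n, k, s) v)) = (if r = s then v else 0)"
      using that by simp
  qed
  have one: "poly_op \<beta> (if r = s then 1 else 0) v = (if r = s then v else 0)" for r s :: nat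
    by (simp add: poly_op_one poly_op_zero)
  have off: "gen_op \<beta> (n, i, j) u = 0" if "i \<noteq> j" for n i j u
    using that by (simp add: gen_op_def)
  show ?thesis
    using assms unfolding AH_relators_def
  proof (elim UnE CollectE exE conjE)
    fix n r s assume "x = fgen (n, r, s)" "\<not> (r \<in> {1..n} \<and> s \<in> {1..n})"
    then show ?thesis by (auto simp: poly_op_fgen gen_op_def)
  next
    fix n r s
    assume "x = (\<Sum>k=1..n. fgen (n,r,k) * fstar (fgen (n,s,k))) - (if r = s then 1 else 0)"
      and "r \<in> {1..n}" "s \<in> {1..n}"
    then show ?thesis
      by (simp only: poly_op_diff poly_op_sum poly_op_mult fstar_fgen poly_op_fgen sum one) simp
  next
    fix n r s
    assume "x = (\<Sum>k=1..n. fstar (fgen (n,k,r)) * fgen (n,k,s)) - (if r = s then 1 else 0)"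
      and "r \<in> {1..n}" "s \<in> {1..n}"
    then show ?thesis
      by (simp only: poly_op_diff poly_op_sum poly_op_mult fstar_fgen poly_op_fgen sum one) simp
  next
    fix n i j k
    assume "x = fgen (n,i,j) * fgen (n,i,k)" "j \<noteq> k"
    then show ?thesis
      by (cases "i = j") (simp_all add: poly_op_mult poly_op_fgen off gen_op_linear)
  next
    fix n i j k
    assume "x = fgen (n,j,i) * fgen (n,k,i)" "j \<noteq> k"
    then show ?thesis
      by (cases "i = j") (simp_all add: poly_op_mult poly_op_fgen off gen_op_linear)
  qed
qed

lemma op_norm_in_AH_seminorms: "op_norm \<beta> \<in> AH_seminorms"
proof -
  have "op_norm \<beta> x = 0" if "x \<in> AH_relators" for x
    using op_norm_le[of 0 \<beta> x] op_norm_nonneg[of \<beta> x] by (simp add: poly_op_relator[OF that])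
  then show ?thesis by (simp add: AH_seminorms_def op_norm_cstar_seminorm)
qed

lemma poly_op_eq_0:
  assumes "AH_of p = 0"
  shows "poly_op \<beta> p v = 0"
proof -
  have "op_norm \<beta> p \<le> 0"
    using AH_seminorm_upper[OF op_norm_in_AH_seminorms, of \<beta> p] assms by (simp flip: norm_AH_of)
  then have "op_norm \<beta> p * norm v \<le> 0" by (intro mult_nonpos_nonneg) auto
  then show ?thesis using norm_poly_op_le[of \<beta> p v] by (metis norm_le_zero_iff order_trans)
qed

section \<open>Evaluation of hyperoctahedral invariance at the reflections\<close>

lemma AH_of_fscale: "AH_of (fscale c p) = c *\<^sub>C AH_of p"
  by transfer (simp add: AH_rel_refl AH_Cauchy_const)

lemma AH_of_prod_list: "AH_of (prod_list ps) = prod_list (map AH_of ps)"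
  by (induction ps) (simp_all add: AH_of_mult)

text \<open>Off-diagonal generators act as 0, so in the invariance identity only the term with the
  original indices survives: the moment is unchanged when multiplied by a product of
  reflections.\<close>

lemma H_invariant_reflections:
  fixes \<epsilon> :: "nat \<Rightarrow> bool"
  assumes inv: "H_invariant \<phi> n y" and i: "i \<in> {1..k} \<rightarrow> {1..n}"
  defines "c \<equiv> \<phi> (star_word y k i \<epsilon>)"
  shows "cscale c v = cscale c (letters_op \<beta> (map (\<lambda>m. (n, i m, i m)) [1..<Suc k]) v)"
proof -
  define J where "J = ({1..k} \<rightarrow>\<^sub>E {1..n})"
  define gs where "gs j = map (\<lambda>m. (n, i m, j m)) [1..<Suc k]" for j :: "nat \<Rightarrow> nat"
  define b where "b j = \<phi> (star_word y k j \<epsilon>)" for j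
  define p where "p = fscale c 1 - (\<Sum>j\<in>J. fscale (b j) (prod_list (map fgen (gs j))))"
  have "AH_of (prod_list (map fgen (gs j))) = prod_list (map (\<lambda>m. AH_gen n (i m) (j m)) [1..<Suc k])" for j
    by (simp add: AH_of_prod_list gs_def AH_gen_def comp_def del: upt_Suc)
  then have "AH_of p = 0"
    using inv i unfolding H_invariant_def p_def AH_of_diff[symmetric] AH_of_sum AH_of_fscale AH_of_one
    by (simp add: c_def b_def J_def del: upt_Suc)
  then have "cscale c v = (\<Sum>j\<in>J. cscale (b j) (letters_op \<beta> (gs j) v))"
    using poly_op_eq_0[of p \<beta> v]
    by (simp add: p_def poly_op_diff poly_op_sum poly_op_fscale poly_op_one poly_op_prod_fgen)
  \<comment> \<open>The sum runs over extensional functions, so the surviving index is the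
    restriction of \<open>i\<close>.\<close>
  also have "\<dots> = (\<Sum>j\<in>{restrict i {1..k}}. cscale (b j) (letters_op \<beta> (gs j) v))"
  proof (rule sum.mono_neutral_right)
    show "finite J" by (simp add: J_def finite_PiE)
    show "{restrict i {1..k}} \<subseteq> J" using i by (auto simp: J_def)
    show "\<forall>j\<in>J - {restrict i {1..k}}. cscale (b j) (letters_op \<beta> (gs j) v) = 0"
    proof
      fix j assume j: "j \<in> J - {restrict i {1..k}}"
      have "\<exists>m\<in>{1..k}. j m \<noteq> i m"
      proof (rule ccontr)
        assume "\<not> (\<exists>m\<in>{1..k}. j m \<noteq> i m)"
        then have "j = restrict i {1..k}"
          using j \<open>{restrict i {1..k}} \<subseteq> J\<close> unfolding J_def
          by (intro PiE_ext[of j "{1..k}" "\<lambda>_. {1..n}"]) auto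
        then show False using j by simp
      qed
      then obtain m where m: "m \<in> {1..k}" "j m \<noteq> i m" by blast
      have zero: "letters_op \<beta> hs 0 = 0" for hs
        using letters_op_linear(2)[of \<beta> hs 0 0] by (simp add: cscale_simps)
      have "(n, i m, j m) \<in> set (gs j)" using m(1) by (auto simp: gs_def simp del: upt_Suc)
      then obtain g1 g2 where "gs j = g1 @ (n, i m, j m) # g2" by (meson split_list)
      moreover have "gen_op \<beta> (n, i m, j m) u = 0" for u using m(2) by (simp add: gen_op_def)
      ultimately show "cscale (b j) (letters_op \<beta> (gs j) v) = 0"
        by (simp add: letters_op_append zero cscale_simps)
    qed
  qed
  also have "\<dots> = cscale c (letters_op \<beta> (map (\<lambda>m. (n, i m, i m)) [1..<Suc k]) v)"
  proof -
    have "gs (restrict i {1..k}) = map (\<lambda>m. (n, i m, i m)) [1..<Suc k]"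
      unfolding gs_def by (rule map_cong) auto
    moreover have "star_word y k (restrict i {1..k}) \<epsilon> = star_word y k i \<epsilon>"
      unfolding star_word_def by (intro arg_cong[of _ _ prod_list] map_cong) auto
    ultimately show ?thesis by (simp add: b_def c_def)
  qed
  finally show ?thesis .
qed

text \<open>The angle of a product of reflections: each one swaps the coordinates and so reverses
  the sign of the angle accumulated to its right.\<close>

fun alt_sum :: "('b \<Rightarrow> real) \<Rightarrow> 'b list \<Rightarrow> real" where
  "alt_sum \<beta> [] = 0"
| "alt_sum \<beta> (r # rs) = \<beta> r - alt_sum \<beta> rs"

lemma letters_op_reflections:
  "set rs \<subseteq> {1..n} \<Longrightarrow> letters_op \<beta> (map (\<lambda>r. (n, r, r)) rs) (a, b) =
    (if even (length rs) then (cis (alt_sum \<beta> rs) * a, cis (- alt_sum \<beta> rs) * b)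
     else (cis (alt_sum \<beta> rs) * b, cis (- alt_sum \<beta> rs) * a))"
  by (induction rs) (auto simp: gen_op_def reflection_def cis_mult simp flip: mult.assoc)

text \<open>On an alternating word the sign belonging to a position agrees with the sign belonging
  to the exponent, up to a global sign fixed by the first letter.\<close>

lemma alt_sum_alternating:
  assumes "alternating w" "w \<noteq> []"
  shows "alt_sum \<beta> (map fst w) = (if snd (hd w) then - 1 else 1) * (\<Sum>(l, e)\<leftarrow>w. if e then - \<beta> l else \<beta> l)"
  using assms
proof (induction w)
  case (Cons p w)
  obtain l e where p: "p = (l, e)" by (cases p)
  show ?case
  proof (cases w)
    case Nil
    then show ?thesis by (simp add: p)
  next
    case (Cons q w')
    obtain l' e' where q: "q = (l', e')" by (cases q)
    have "alternating w" "e' = (\<not> e)"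
      using Cons.prems(1) by (auto simp: Cons p q alternating_def)
    with Cons.IH show ?thesis by (auto simp: Cons p q)
  qed
qed simp

lemma even_weight_one: "even (weight (\<lambda>_. 1) w) \<longleftrightarrow> even (length w)"
  by (induction w) (auto split: if_split_asm)

lemma map_nth_shift: "map (\<lambda>m. (fst (w ! (m - 1)), snd (w ! (m - 1)))) [1..<Suc (length w)] = w"
  by (rule nth_equalityI) (simp_all del: upt_Suc)

lemma trace_alternating:
  assumes H: "H_plus_invariant \<phi> \<Lambda> x" and w: "w \<in> star_words \<Lambda>" "alternating w" "weight (\<lambda>_. 1) w = 0"
    and d: "weight d w \<noteq> 0"
  shows "\<phi> (word x w) = 0"
proof -
  \<comment> \<open>Invariance concerns tuples of distinct members numbered from 1. The letters of
    \<open>w\<close> are enumerated by \<open>r\<close>, and \<open>f\<close> translates the word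
    into those numbers.\<close>
  define L where "L = set (map fst w)"
  define n where "n = card L"
  have "finite L" by (simp add: L_def)
  then obtain r where r: "bij_betw r {1..n} L"
    using ex_bij_betw_nat_finite_1 unfolding n_def by blast
  define f where "f = inv_into {1..n} r"
  have rf: "r (f l) = l" and f: "f l \<in> {1..n}" if "l \<in> L" for l
    using r that unfolding f_def bij_betw_def by (auto intro: f_inv_into_f inv_into_into)
  define v where "v = map (\<lambda>(l, e). (f l, e)) w"
  define k where "k = length v"
  define i where "i m = fst (v ! (m - 1))" for m
  define \<epsilon> where "\<epsilon> m = snd (v ! (m - 1))" for m
  \<comment> \<open>The angles are scaled so that the whole word accumulates \<pi> or -\<pi>; the
    phase is then -1 and the moment equals its own negative.\<close>
  define \<beta> where "\<beta> m = pi / weight d w * d (r m)" for m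
  have v: "map (\<lambda>m. (i m, \<epsilon> m)) [1..<Suc k] = v"
    unfolding i_def \<epsilon>_def k_def by (rule map_nth_shift)
  have word: "star_word (\<lambda>m. x (r m)) k i \<epsilon> = word x w"
  proof -
    have "word (\<lambda>m. x (r m)) (map (\<lambda>(l, e). (f l, e)) u) = word x u" if "set (map fst u) \<subseteq> L" for u
      using that by (induction u) (auto simp: rf)
    then show ?thesis unfolding star_word_conv_word v v_def by (simp add: L_def)
  qed
  have is_eq: "map i [1..<Suc k] = map fst v"
    using arg_cong[OF v, of "map fst"] by (simp add: comp_def del: upt_Suc)
  have fv: "set (map fst v) \<subseteq> {1..n}" using f by (force simp: v_def L_def)
  have "r ` {1..n} \<subseteq> \<Lambda>" using r w(1) by (auto simp: bij_betw_def L_def in_lists_conv_set)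
  then have inv: "H_invariant \<phi> n (\<lambda>m. x (r m))"
    using H r unfolding H_plus_invariant_def bij_betw_def by blast
  have i: "i \<in> {1..k} \<rightarrow> {1..n}"
  proof
    fix m assume "m \<in> {1..k}"
    then have "i m \<in> set (map i [1..<Suc k])" by (auto simp del: upt_Suc)
    then show "i m \<in> {1..n}" using fv unfolding is_eq by blast
  qed
  have len: "length v = length w" by (simp add: v_def)
  have "even (length v)" using even_weight_one[of w] w(3) by (simp add: len)
  moreover have ops: "map (\<lambda>m. (n, i m, i m)) [1..<Suc k] = map (\<lambda>r. (n, r, r)) (map fst v)"
    unfolding is_eq[symmetric] by (simp add: comp_def del: upt_Suc)
  \<comment> \<open>Degree 0 makes the length even, so the product of reflections is diagonal and
    the vector \<open>(1, 0)\<close> reads off one phase.\<close>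
  ultimately have phase: "\<phi> (word x w) = \<phi> (word x w) * cis (alt_sum \<beta> (map fst v))"
    using H_invariant_reflections[OF inv i, of \<epsilon> "(1, 0)" \<beta>] letters_op_reflections[OF fv, of \<beta> 1 0]
    unfolding word ops by (simp add: cscale_def)
  have "w \<noteq> []" using d by auto
  have "alternating v"
    using w(2) unfolding alternating_def v_def by (simp add: successively_map case_prod_beta)
  then have "alt_sum \<beta> (map fst v) = (if snd (hd v) then - 1 else 1) * (\<Sum>(l, e)\<leftarrow>v. if e then - \<beta> l else \<beta> l)"
    using \<open>w \<noteq> []\<close> by (intro alt_sum_alternating) (simp_all add: v_def)
  also have "(\<Sum>(l, e)\<leftarrow>v. if e then - \<beta> l else \<beta> l) = pi / weight d w * weight d w"
  proof -
    have "(\<Sum>(l, e)\<leftarrow>map (\<lambda>(l, e). (f l, e)) u. if e then - \<beta> l else \<beta> l) = pi / weight d w * weight d u"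
      if "set (map fst u) \<subseteq> L" for u
      using that by (induction u) (auto simp: rf \<beta>_def algebra_simps add_divide_distrib diff_divide_distrib)
    then show ?thesis by (simp add: v_def L_def)
  qed
  also have "\<dots> = pi" using d by simp
  finally have "cis (alt_sum \<beta> (map fst v)) = - 1" by (auto simp: complex_eq_iff)
  then show ?thesis using phase by simp
qed

section \<open>Finite-dimensional subspaces and extension to the closure\<close>

definition cspan :: "'a::complex_normed_vector set \<Rightarrow> 'a set" where
  "cspan B = range (\<lambda>c. \<Sum>b\<in>B. c b *\<^sub>C b)"

lemma cspan_add: "u \<in> cspan B \<Longrightarrow> v \<in> cspan B \<Longrightarrow> u + v \<in> cspan B"
proof -
  assume "u \<in> cspan B" "v \<in> cspan B"
  then obtain c d where "u = (\<Sum>b\<in>B. c b *\<^sub>C b)" "v = (\<Sum>b\<in>B. d b *\<^sub>C b)"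
    unfolding cspan_def by blast
  then have "u + v = (\<Sum>b\<in>B. (c b + d b) *\<^sub>C b)" by (simp add: scaleC_add_left sum.distrib)
  then show ?thesis unfolding cspan_def by (intro range_eqI)
qed

lemma cspan_scale: "v \<in> cspan B \<Longrightarrow> e *\<^sub>C v \<in> cspan B"
proof -
  assume "v \<in> cspan B"
  then obtain c where "v = (\<Sum>b\<in>B. c b *\<^sub>C b)" unfolding cspan_def by blast
  then have "e *\<^sub>C v = (\<Sum>b\<in>B. (e * c b) *\<^sub>C b)" by (simp add: scaleC_sum_right scaleC_scaleC)
  then show ?thesis unfolding cspan_def by (intro range_eqI)
qed

lemma cspan_zero: "0 \<in> cspan B"
proof -
  have "0 = (\<Sum>b\<in>B. 0 *\<^sub>C b)" by simp
  then show ?thesis unfolding cspan_def by (intro range_eqI)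
qed

lemma cspan_base: "finite B \<Longrightarrow> b \<in> B \<Longrightarrow> b \<in> cspan B"
proof -
  assume "finite B" "b \<in> B"
  then have "b = (\<Sum>a\<in>B. (if a = b then 1 else 0) *\<^sub>C a)"
    by (simp add: if_distrib[of "\<lambda>c. c *\<^sub>C _"] cong: if_cong)
  then show ?thesis unfolding cspan_def by (intro range_eqI)
qed

lemma cspan_sum: "(\<And>i. i \<in> I \<Longrightarrow> f i \<in> cspan B) \<Longrightarrow> sum f I \<in> cspan B"
  by (induction I rule: infinite_finite_induct) (auto intro: cspan_add cspan_zero)

lemma cspan_insert:
  assumes "finite B" "b \<notin> B"
  shows "cspan (insert b B) = {c *\<^sub>C b + v |c v. v \<in> cspan B}"
proof (intro set_eqI iffI)
  fix u assume "u \<in> cspan (insert b B)"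
  then obtain c where "u = c b *\<^sub>C b + (\<Sum>b\<in>B. c b *\<^sub>C b)"
    using assms unfolding cspan_def by auto
  then show "u \<in> {c *\<^sub>C b + v |c v. v \<in> cspan B}" unfolding cspan_def by blast
next
  fix u assume "u \<in> {c *\<^sub>C b + v |c v. v \<in> cspan B}"
  then obtain c d where u: "u = c *\<^sub>C b + (\<Sum>a\<in>B. d a *\<^sub>C a)" unfolding cspan_def by blast
  have "(\<Sum>a\<in>B. (if a = b then c else d a) *\<^sub>C a) = (\<Sum>a\<in>B. d a *\<^sub>C a)"
    using assms(2) by (intro sum.cong) auto
  then have "u = (\<Sum>a\<in>insert b B. (if a = b then c else d a) *\<^sub>C a)"
    using assms by (simp add: u)
  then show "u \<in> cspan (insert b B)" unfolding cspan_def by (intro range_eqI)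
qed

text \<open>The distance from \<open>b\<close> to \<open>V\<close> is positive and bounds the
  coefficient of \<open>b\<close> by a multiple of the norm. Along a convergent sequence the
  coefficients are therefore Cauchy, and then the parts in \<open>V\<close> converge too.\<close>

lemma closed_cspan_insert:
  fixes V :: "'a::complex_normed_vector set"
  assumes V: "closed V" "0 \<in> V" "\<And>u v. u \<in> V \<Longrightarrow> v \<in> V \<Longrightarrow> u + v \<in> V" "\<And>c v. v \<in> V \<Longrightarrow> c *\<^sub>C v \<in> V"
    and b: "b \<notin> V"
  shows "closed {c *\<^sub>C b + v |c v. v \<in> V}"
  unfolding closed_sequential_limits
proof (intro allI impI, elim conjE)
  fix y l assume y: "\<forall>n. y n \<in> {c *\<^sub>C b + v |c v. v \<in> V}" and lim: "y \<longlonglongrightarrow> l"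
  have "\<exists>c v. y n = c *\<^sub>C b + v \<and> v \<in> V" for n using y by blast
  then obtain c v where cv: "\<And>n. y n = c n *\<^sub>C b + v n" "\<And>n. v n \<in> V" by metis
  define \<delta> where "\<delta> = infdist b V"
  have \<delta>: "\<delta> > 0"
    using V(1,2) b in_closed_iff_infdist_zero[of V b] infdist_nonneg[of b V] unfolding \<delta>_def by fastforce
  have diff: "u - w \<in> V" if "u \<in> V" "w \<in> V" for u w
    using V(3)[OF that(1) V(4)[OF that(2), of "- 1"]] by (simp add: scaleC_minus_left)
  have bound: "cmod e * \<delta> \<le> norm (e *\<^sub>C b + u)" if "u \<in> V" for e u
  proof (cases "e = 0")
    case False
    have "(- inverse e) *\<^sub>C u \<in> V" using V(4) that by blast
    then have "\<delta> \<le> dist b ((- inverse e) *\<^sub>C u)" unfolding \<delta>_def by (rule infdist_le)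
    then have "cmod e * \<delta> \<le> cmod e * norm (b - (- inverse e) *\<^sub>C u)"
      by (intro mult_left_mono) (auto simp: dist_norm)
    also have "\<dots> = norm (e *\<^sub>C (b - (- inverse e) *\<^sub>C u))" by (rule norm_scaleC[symmetric])
    also have "e *\<^sub>C (b - (- inverse e) *\<^sub>C u) = e *\<^sub>C b + u"
      using False by (simp add: scaleC_diff_right scaleC_add_right scaleC_scaleC scaleC_minus_left scaleC_minus_right)
    finally show ?thesis .
  qed simp
  have "Cauchy c"
  proof (rule metric_CauchyI)
    fix \<epsilon> :: real assume "\<epsilon> > 0"
    then have "\<epsilon> * \<delta> > 0" using \<delta> by simp
    then obtain M where M: "\<And>m n. m \<ge> M \<Longrightarrow> n \<ge> M \<Longrightarrow> dist (y m) (y n) < \<epsilon> * \<delta>"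
      using LIMSEQ_imp_Cauchy[OF lim] unfolding Cauchy_def by meson
    have "dist (c m) (c n) < \<epsilon>" if "m \<ge> M" "n \<ge> M" for m n
    proof -
      have "y m - y n = (c m - c n) *\<^sub>C b + (v m - v n)" by (simp add: cv(1) scaleC_diff_left)
      then have "cmod (c m - c n) * \<delta> \<le> dist (y m) (y n)"
        using bound[OF diff[OF cv(2) cv(2)]] by (simp add: dist_norm)
      also have "\<dots> < \<epsilon> * \<delta>" using M that by blast
      finally show ?thesis using \<delta> by (simp add: dist_norm)
    qed
    then show "\<exists>M. \<forall>m\<ge>M. \<forall>n\<ge>M. dist (c m) (c n) < \<epsilon>" by blast
  qed
  then obtain e where e: "c \<longlonglongrightarrow> e" using Cauchy_convergent_iff convergent_def by blast
  have "(\<lambda>n. c n *\<^sub>C b) \<longlonglongrightarrow> e *\<^sub>C b"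
  proof (rule LIM_zero_cancel, rule tendsto_norm_zero_cancel)
    have "(\<lambda>n. cmod (c n - e) * norm b) \<longlonglongrightarrow> 0"
      using e by (intro tendsto_mult_left_zero tendsto_norm_zero LIM_zero)
    then show "(\<lambda>n. norm (c n *\<^sub>C b - e *\<^sub>C b)) \<longlonglongrightarrow> 0"
      by (simp flip: scaleC_diff_left add: norm_scaleC)
  qed
  then have "(\<lambda>n. y n - c n *\<^sub>C b) \<longlonglongrightarrow> l - e *\<^sub>C b" by (intro tendsto_diff lim)
  then have "v \<longlonglongrightarrow> l - e *\<^sub>C b" by (simp add: cv(1))
  then have "l - e *\<^sub>C b \<in> V" using V(1) cv(2) closed_sequentially by blast
  moreover have "l = e *\<^sub>C b + (l - e *\<^sub>C b)" by simp
  ultimately show "l \<in> {c *\<^sub>C b + v |c v. v \<in> V}" by blast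
qed

lemma closed_cspan: "finite B \<Longrightarrow> closed (cspan B)"
proof (induction B rule: finite_induct)
  case empty
  show ?case by (simp add: cspan_def)
next
  case (insert b B)
  show ?case
  proof (cases "b \<in> cspan B")
    case True
    have "cspan (insert b B) = cspan B"
    proof (intro equalityI subsetI)
      show "u \<in> cspan B" if "u \<in> cspan (insert b B)" for u
        using that True unfolding cspan_insert[OF insert.hyps(1,2)] by (auto intro: cspan_add cspan_scale)
      show "u \<in> cspan (insert b B)" if "u \<in> cspan B" for u
        using that unfolding cspan_insert[OF insert.hyps(1,2)] by (auto intro!: exI[of _ 0] exI[of _ u])
    qed
    then show ?thesis using insert.IH by simp
  next
    case False
    then show ?thesis
      unfolding cspan_insert[OF insert.hyps(1,2)]
      by (intro closed_cspan_insert insert.IH cspan_add cspan_scale cspan_zero)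
  qed
qed

text \<open>The closed set \<open>U\<close> will be a finite-dimensional span: values that lie in it
  on \<open>V\<close> stay in it on the closure, so the extension keeps finite rank.\<close>

lemma extend_contraction:
  fixes f :: "'a \<Rightarrow> 'a::{complex_normed_vector, banach}"
  assumes V: "\<And>a b. a \<in> V \<Longrightarrow> b \<in> V \<Longrightarrow> a + b \<in> V" "\<And>c a. a \<in> V \<Longrightarrow> c *\<^sub>C a \<in> V"
    and f_add: "\<And>a b. a \<in> V \<Longrightarrow> b \<in> V \<Longrightarrow> f (a + b) = f a + f b"
    and f_scale: "\<And>c a. a \<in> V \<Longrightarrow> f (c *\<^sub>C a) = c *\<^sub>C f a"
    and f_norm: "\<And>a. a \<in> V \<Longrightarrow> norm (f a) \<le> norm a"
    and U: "closed U" "\<And>a. a \<in> V \<Longrightarrow> f a \<in> U"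
  shows "\<exists>S. (\<forall>a\<in>V. S a = f a) \<and>
    (\<forall>a\<in>closure V. \<forall>b\<in>closure V. S (a + b) = S a + S b) \<and> (\<forall>c. \<forall>a\<in>closure V. S (c *\<^sub>C a) = c *\<^sub>C S a) \<and>
    (\<forall>a\<in>closure V. norm (S a) \<le> norm a \<and> S a \<in> U)"
proof -
  have "uniformly_continuous_on V f"
    unfolding uniformly_continuous_on_def
  proof (intro allI impI exI conjI ballI)
    fix e :: real and a b assume "0 < e" and ab: "a \<in> V" "b \<in> V" "dist b a < e"
    have b': "b + (- 1) *\<^sub>C a \<in> V" using ab V by blast
    have "f b - f a = f (b + (- 1) *\<^sub>C a)"
      by (simp only: f_add[OF ab(2) V(2)[OF ab(1)]] f_scale[OF ab(1)]) (simp add: scaleC_minus_left)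
    then have "dist (f b) (f a) \<le> dist b a"
      using f_norm[OF b'] by (simp add: dist_norm scaleC_minus_left)
    then show "dist (f b) (f a) < e" using ab(3) by simp
  qed
  then obtain S where S: "uniformly_continuous_on (closure V) S" "\<And>a. a \<in> V \<Longrightarrow> f a = S a"
    by (rule uniformly_continuous_on_extension_on_closure) blast
  have cont: "continuous_on (closure V) S" by (rule uniformly_continuous_imp_continuous[OF S(1)])
  have seq: "\<exists>s. (\<forall>n. s n \<in> V) \<and> s \<longlonglongrightarrow> a \<and> (\<lambda>n. f (s n)) \<longlonglongrightarrow> S a" if "a \<in> closure V" for a
  proof -
    obtain s where s: "\<And>n. s n \<in> V" "s \<longlonglongrightarrow> a" using \<open>a \<in> closure V\<close> closure_sequential by blast
    have "(\<lambda>n. S (s n)) \<longlonglongrightarrow> S a"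
      using cont that s closure_subset unfolding continuous_on_sequentially comp_def by blast
    moreover have "(\<lambda>n. f (s n)) = (\<lambda>n. S (s n))" using S(2) s(1) by auto
    ultimately show ?thesis using s by (intro exI[of _ s]) simp
  qed
  have lim_unique: "S a = l" if "\<And>n. s n \<in> V" "s \<longlonglongrightarrow> a" "(\<lambda>n. f (s n)) \<longlonglongrightarrow> l" for s a l
  proof -
    have "a \<in> closure V" using that closure_sequential by blast
    then have "(\<lambda>n. S (s n)) \<longlonglongrightarrow> S a"
      using cont that closure_subset unfolding continuous_on_sequentially comp_def by blast
    moreover have "(\<lambda>n. f (s n)) = (\<lambda>n. S (s n))" using S(2) that(1) by auto
    ultimately show ?thesis using that(3) LIMSEQ_unique by simp
  qed
  show ?thesis
  proof (intro exI[of _ S] conjI ballI allI)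
    show "S a = f a" if "a \<in> V" for a using S(2)[OF that] by simp
  next
    fix a b assume "a \<in> closure V" "b \<in> closure V"
    then obtain s t where s: "\<And>n. s n \<in> V" "s \<longlonglongrightarrow> a" "(\<lambda>n. f (s n)) \<longlonglongrightarrow> S a"
      and t: "\<And>n. t n \<in> V" "t \<longlonglongrightarrow> b" "(\<lambda>n. f (t n)) \<longlonglongrightarrow> S b"
      using seq by meson
    show "S (a + b) = S a + S b"
    proof (rule lim_unique)
      show "(\<lambda>n. f (s n + t n)) \<longlonglongrightarrow> S a + S b"
        using tendsto_add[OF s(3) t(3)] by (simp add: f_add s t)
    qed (use V s t in \<open>auto intro: tendsto_add\<close>)
  next
    fix c a assume "a \<in> closure V"
    then obtain s where s: "\<And>n. s n \<in> V" "s \<longlonglongrightarrow> a" "(\<lambda>n. f (s n)) \<longlonglongrightarrow> S a" using seq by meson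
    show "S (c *\<^sub>C a) = c *\<^sub>C S a"
    proof (rule lim_unique)
      show "(\<lambda>n. f (c *\<^sub>C s n)) \<longlonglongrightarrow> c *\<^sub>C S a"
        using tendsto_scaleC[OF s(3)] by (simp add: f_scale s)
    qed (use V s in \<open>auto intro: tendsto_scaleC\<close>)
  next
    fix a assume "a \<in> closure V"
    then obtain s where s: "\<And>n. s n \<in> V" "s \<longlonglongrightarrow> a" "(\<lambda>n. f (s n)) \<longlonglongrightarrow> S a" using seq by meson
    show "norm (S a) \<le> norm a"
      using f_norm s by (intro LIMSEQ_le[OF tendsto_norm[OF s(3)] tendsto_norm[OF s(2)]]) blast
    show "S a \<in> U" using U s by (meson closed_sequentially)
  qed
qed

section \<open>Truncation operators\<close>

text \<open>Formal polynomials remember their words, which an element of the algebra does not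
  determine when the generators satisfy relations.\<close>

definition polys :: "'l set \<Rightarrow> 'l free_alg set" where
  "polys \<Lambda> = {p. \<forall>w\<in>Poly_Mapping.keys p. letters w \<in> lists \<Lambda>}"

lemma polys_add: "p \<in> polys \<Lambda> \<Longrightarrow> q \<in> polys \<Lambda> \<Longrightarrow> p + q \<in> polys \<Lambda>"
  using keys_add[of p q] unfolding polys_def by blast

lemma polys_single: "letters w \<in> lists \<Lambda> \<Longrightarrow> Poly_Mapping.single w c \<in> polys \<Lambda>"
  by (simp add: polys_def)

lemma polys_mult:
  assumes "p \<in> polys \<Lambda>" "q \<in> polys \<Lambda>"
  shows "p * q \<in> polys \<Lambda>"
  unfolding polys_def
proof (intro CollectI ballI)
  fix w assume "w \<in> Poly_Mapping.keys (p * q)"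
  then obtain u v where "w = u + v" "u \<in> Poly_Mapping.keys p" "v \<in> Poly_Mapping.keys q"
    using keys_mult[of p q] by blast
  then show "letters w \<in> lists \<Lambda>" using assms by (auto simp: polys_def)
qed

lemma polys_fscale: "p \<in> polys \<Lambda> \<Longrightarrow> fscale c p \<in> polys \<Lambda>"
  unfolding fscale_def by (rule polys_mult[OF polys_single]) simp_all

lemma prod_list_in_alg_gen: "set as \<subseteq> alg_gen S \<Longrightarrow> prod_list as \<in> alg_gen S"
  by (induction as) (auto intro: alg_gen.intros)

lemma alg_gen_zero: "0 \<in> alg_gen S"
  using alg_gen.scale[OF alg_gen.one, of 0 S] by simp

lemma alg_gen_sum: "(\<And>i. i \<in> I \<Longrightarrow> f i \<in> alg_gen S) \<Longrightarrow> sum f I \<in> alg_gen S"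
  by (induction I rule: infinite_finite_induct) (auto intro: alg_gen.add alg_gen_zero)

lemma letter_prod_in_alg_gen: "w \<in> lists \<Lambda> \<Longrightarrow> letter_prod x w \<in> alg_gen (x ` \<Lambda>)"
  unfolding letter_prod_def by (rule prod_list_in_alg_gen) (auto intro: alg_gen.gen)

lemma feval_letter_prod: "feval x p = (\<Sum>w\<in>Poly_Mapping.keys p. Poly_Mapping.lookup p w *\<^sub>C letter_prod x (letters w))"
  by (simp add: feval_def letter_prod_def)

lemma alg_gen_eq_feval: "alg_gen (x ` \<Lambda>) = feval x ` polys \<Lambda>"
proof (intro equalityI subsetI)
  fix a assume "a \<in> alg_gen (x ` \<Lambda>)"
  then show "a \<in> feval x ` polys \<Lambda>"
  proof induction
    case one
    have "1 \<in> polys \<Lambda>" using polys_single[of 0 \<Lambda> 1] by simp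
    then show ?case by (intro image_eqI[of _ _ 1]) simp_all
  next
    case (gen a)
    then obtain l where "a = x l" "l \<in> \<Lambda>" by blast
    then show ?case by (intro image_eqI[of _ _ "fgen l"]) (simp_all add: fgen_def polys_single)
  next
    case (add a b)
    then show ?case using polys_add by (fastforce simp flip: feval_add)
  next
    case (scale a c)
    then show ?case using polys_fscale by (fastforce simp flip: feval_scale)
  next
    case (mult a b)
    then show ?case using polys_mult by (fastforce simp flip: feval_mult)
  qed
next
  fix a assume "a \<in> feval x ` polys \<Lambda>"
  then show "a \<in> alg_gen (x ` \<Lambda>)"
    by (auto simp: feval_letter_prod polys_def intro!: alg_gen_sum alg_gen.scale letter_prod_in_alg_gen)
qed

definition trunc_coeff :: "'l set \<Rightarrow> nat \<Rightarrow> 'l list \<Rightarrow> real" where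
  "trunc_coeff F N w = (if set w \<subseteq> F then real (N - length w) / real N else 0)"

definition trunc :: "('l \<Rightarrow> 'a::cstar_algebra) \<Rightarrow> 'l set \<Rightarrow> nat \<Rightarrow> 'l free_alg \<Rightarrow> 'a" where
  "trunc x F N p = (\<Sum>w\<in>Poly_Mapping.keys p.
    (complex_of_real (trunc_coeff F N (letters w)) * Poly_Mapping.lookup p w) *\<^sub>C letter_prod x (letters w))"

lemma trunc_superset:
  "finite W \<Longrightarrow> Poly_Mapping.keys p \<subseteq> W \<Longrightarrow> trunc x F N p = (\<Sum>w\<in>W.
    (complex_of_real (trunc_coeff F N (letters w)) * Poly_Mapping.lookup p w) *\<^sub>C letter_prod x (letters w))"
  unfolding trunc_def by (rule sum.mono_neutral_left) (auto simp: in_keys_iff)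

lemma trunc_add: "trunc x F N (p + q) = trunc x F N p + trunc x F N q"
proof -
  let ?W = "Poly_Mapping.keys p \<union> Poly_Mapping.keys q"
  have "Poly_Mapping.keys (p + q) \<subseteq> ?W" by (rule keys_add)
  then show ?thesis
    by (simp add: trunc_superset[of ?W] lookup_add distrib_left scaleC_add_left sum.distrib)
qed

lemma trunc_fscale: "trunc x F N (fscale c p) = c *\<^sub>C trunc x F N p"
proof (induction p rule: single_add_induct)
  case (single w e)
  have "trunc x F N (Poly_Mapping.single w e) =
      (complex_of_real (trunc_coeff F N (letters w)) * e) *\<^sub>C letter_prod x (letters w)" for w e
    by (subst trunc_superset[of "{w}"]) auto
  then show ?case by (simp add: fscale_def mult_single scaleC_scaleC mult.left_commute)
qed (simp add: fscale_add_right trunc_add scaleC_add_right)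

lemma trunc_in_cspan:
  assumes F: "finite F"
  shows "trunc x F N p \<in> cspan (letter_prod x ` {w. set w \<subseteq> F \<and> length w \<le> N})"
  unfolding trunc_def
proof (intro cspan_sum)
  fix w
  have fin: "finite (letter_prod x ` {w. set w \<subseteq> F \<and> length w \<le> N})"
    by (intro finite_imageI finite_lists_length_le F)
  show "(complex_of_real (trunc_coeff F N (letters w)) * Poly_Mapping.lookup p w) *\<^sub>C letter_prod x (letters w)
    \<in> cspan (letter_prod x ` {w. set w \<subseteq> F \<and> length w \<le> N})"
  proof (cases "set (letters w) \<subseteq> F \<and> length (letters w) \<le> N")
    case True
    then show ?thesis by (intro cspan_scale cspan_base[OF fin]) auto
  next
    case False
    then have "trunc_coeff F N (letters w) = 0" by (auto simp: trunc_coeff_def)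
    then show ?thesis by (simp add: cspan_zero)
  qed
qed

context tracial
begin

lemma norm_trunc_le:
  assumes len: "weight_invariant \<phi> \<Lambda> x (\<lambda>_. 1)"
    and out: "weight_invariant \<phi> \<Lambda> x (\<lambda>l. if l \<in> F then 0 else 1)"
    and p: "p \<in> polys \<Lambda>" and N: "N > 0"
  shows "norm (trunc x F N p) \<le> norm (feval x p)"
proof -
  define W where "W = letters ` Poly_Mapping.keys p"
  define c where "c w = Poly_Mapping.lookup p (Word w)" for w
  have inj: "inj_on letters (Poly_Mapping.keys p)" by (auto simp: inj_on_def free_word.expand)
  have "finite W" "W \<subseteq> lists \<Lambda>" using p by (auto simp: W_def polys_def)
  from truncation_norm_le[OF len out this N, of c] show ?thesis
    unfolding W_def sum.reindex[OF inj]
    by (simp add: comp_def c_def trunc_def trunc_coeff_def feval_letter_prod)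
qed

lemma truncation_operator:
  assumes len: "weight_invariant \<phi> \<Lambda> x (\<lambda>_. 1)"
    and out: "weight_invariant \<phi> \<Lambda> x (\<lambda>l. if l \<in> F then 0 else 1)"
    and F: "finite F" "F \<subseteq> \<Lambda>" and N: "N > 0"
  shows "\<exists>S. finite_rank_contraction (closure (alg_gen (x ` \<Lambda>))) S \<and> (\<forall>p\<in>polys \<Lambda>. S (feval x p) = trunc x F N p)"
proof -
  define V where "V = alg_gen (x ` \<Lambda>)"
  define B where "B = letter_prod x ` {w. set w \<subseteq> F \<and> length w \<le> N}"
  have B: "finite B" unfolding B_def by (intro finite_imageI finite_lists_length_le F)
  have BV: "B \<subseteq> V" using F(2) unfolding B_def V_def by (auto intro!: letter_prod_in_alg_gen)
  have V: "V = feval x ` polys \<Lambda>" unfolding V_def by (rule alg_gen_eq_feval)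
  have V_add: "a + b \<in> V" if "a \<in> V" "b \<in> V" for a b using that unfolding V_def by (rule alg_gen.add)
  have V_scale: "c *\<^sub>C a \<in> V" if "a \<in> V" for a c using that unfolding V_def by (rule alg_gen.scale)
  \<comment> \<open>The difference of \<open>p\<close> and \<open>q\<close> evaluates to 0, so the
    norm inequality makes its truncation 0: truncation depends only on the element.\<close>
  have eq: "trunc x F N p = trunc x F N q"
    if "p \<in> polys \<Lambda>" "q \<in> polys \<Lambda>" "feval x p = feval x q" for p q
  proof -
    have "p + fscale (- 1) q \<in> polys \<Lambda>" using that by (intro polys_add polys_fscale)
    from norm_trunc_le[OF len out this N] show ?thesis
      by (simp add: trunc_add trunc_fscale feval_add feval_scale scaleC_minus_left that(3))
  qed
  define f where "f a = trunc x F N (SOME p. p \<in> polys \<Lambda> \<and> feval x p = a)" for a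
  have f: "f (feval x p) = trunc x F N p" if "p \<in> polys \<Lambda>" for p
  proof -
    have "(SOME q. q \<in> polys \<Lambda> \<and> feval x q = feval x p) \<in> polys \<Lambda> \<and>
        feval x (SOME q. q \<in> polys \<Lambda> \<and> feval x q = feval x p) = feval x p"
      by (rule someI[of _ p]) (simp add: that)
    then show ?thesis unfolding f_def using that by (intro eq) auto
  qed
  have "closed (cspan B)" by (rule closed_cspan[OF B])
  have "\<exists>S. (\<forall>a\<in>V. S a = f a) \<and>
    (\<forall>a\<in>closure V. \<forall>b\<in>closure V. S (a + b) = S a + S b) \<and> (\<forall>c. \<forall>a\<in>closure V. S (c *\<^sub>C a) = c *\<^sub>C S a) \<and>
    (\<forall>a\<in>closure V. norm (S a) \<le> norm a \<and> S a \<in> cspan B)"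
  proof (rule extend_contraction)
    show "a + b \<in> V" if "a \<in> V" "b \<in> V" for a b using that by (rule V_add)
    show "c *\<^sub>C a \<in> V" if "a \<in> V" for a c using that by (rule V_scale)
    show "f (a + b) = f a + f b" if "a \<in> V" "b \<in> V" for a b
      using that unfolding V by (auto simp: f polys_add trunc_add simp flip: feval_add)
    show "f (c *\<^sub>C a) = c *\<^sub>C f a" if "a \<in> V" for c a
      using that unfolding V by (auto simp: f polys_fscale trunc_fscale simp flip: feval_scale)
    show "norm (f a) \<le> norm a" if "a \<in> V" for a
      using that norm_trunc_le[OF len out _ N] unfolding V by (auto simp: f)
    show "f a \<in> cspan B" if "a \<in> V" for a
      using that trunc_in_cspan[OF F(1)] unfolding V B_def by (auto simp: f)
  qed fact
  then obtain S where S: "\<forall>a\<in>V. S a = f a" "\<forall>a\<in>closure V. \<forall>b\<in>closure V. S (a + b) = S a + S b"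
    "\<forall>c. \<forall>a\<in>closure V. S (c *\<^sub>C a) = c *\<^sub>C S a" "\<forall>a\<in>closure V. norm (S a) \<le> norm a"
    "\<forall>a\<in>closure V. S a \<in> cspan B" by blast
  \<comment> \<open>The words spanning the range use letters of \<Lambda> only, so the operator maps
    the algebra into itself.\<close>
  have "cspan B \<subseteq> V"
    using BV unfolding cspan_def V_def by (auto intro!: alg_gen_sum alg_gen.scale)
  then have "\<forall>a\<in>closure V. S a \<in> closure V" using S(5) closure_subset by blast
  moreover have "\<exists>c. S a = (\<Sum>b\<in>B. c b *\<^sub>C b)" if "a \<in> closure V" for a
    using S(5) that unfolding cspan_def by blast
  moreover have "B \<subseteq> closure V" using BV closure_subset by blast
  ultimately have "finite_rank_contraction (closure V) S"
    using S B unfolding finite_rank_contraction_def by blast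
  moreover have "\<forall>p\<in>polys \<Lambda>. S (feval x p) = trunc x F N p" using S(1) f unfolding V by auto
  ultimately show ?thesis unfolding V_def by blast
qed

text \<open>A polynomial has finitely many words; once \<open>F\<close> contains the letters of one
  of them and \<open>N\<close> exceeds its length, its factor is 1 - length / N.\<close>

lemma trunc_tendsto:
  assumes p: "p \<in> polys \<Lambda>"
  shows "((\<lambda>(F, N). trunc x F N p) \<longlongrightarrow> feval x p) (finite_subsets_at_top \<Lambda> \<times>\<^sub>F sequentially)"
proof -
  let ?G = "finite_subsets_at_top \<Lambda> \<times>\<^sub>F sequentially"
  have coeff: "((\<lambda>(F, N). trunc_coeff F N w) \<longlongrightarrow> 1) ?G" if w: "w \<in> lists \<Lambda>" for w
  proof -
    have "eventually (\<lambda>F. set w \<subseteq> F) (finite_subsets_at_top \<Lambda>)"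
      using w unfolding eventually_finite_subsets_at_top by (intro exI[of _ "set w"]) auto
    moreover have "eventually (\<lambda>N. length w < N) sequentially" by (rule eventually_gt_at_top)
    moreover have "1 - real (length w) / real N = trunc_coeff F N w" if "set w \<subseteq> F" "length w < N" for F N
      using that by (simp add: trunc_coeff_def of_nat_diff diff_divide_distrib)
    ultimately have ev: "eventually (\<lambda>FN. 1 - real (length w) / real (snd FN) = trunc_coeff (fst FN) (snd FN) w) ?G"
      unfolding eventually_prod_filter
      by (intro exI[of _ "\<lambda>F. set w \<subseteq> F"] exI[of _ "\<lambda>N. length w < N"]) simp
    have "((\<lambda>N. 1 - real (length w) / real N) \<longlongrightarrow> 1 - 0) sequentially"
      by (intro tendsto_diff tendsto_const lim_const_over_n)
    then have "((\<lambda>FN. 1 - real (length w) / real (snd FN)) \<longlongrightarrow> 1) ?G"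
      using filterlim_compose[OF _ filterlim_snd] by simp
    from Lim_transform_eventually[OF this ev] show ?thesis by (simp add: case_prod_unfold)
  qed
  have "((\<lambda>FN. \<Sum>w\<in>Poly_Mapping.keys p. (complex_of_real (trunc_coeff (fst FN) (snd FN) (letters w)) * Poly_Mapping.lookup p w) *\<^sub>C letter_prod x (letters w))
      \<longlongrightarrow> (\<Sum>w\<in>Poly_Mapping.keys p. Poly_Mapping.lookup p w *\<^sub>C letter_prod x (letters w))) ?G"
  proof (rule tendsto_sum)
    fix w assume w: "w \<in> Poly_Mapping.keys p"
    have c: "((\<lambda>FN. trunc_coeff (fst FN) (snd FN) (letters w)) \<longlongrightarrow> 1) ?G"
      using coeff[of "letters w"] p w by (simp add: polys_def case_prod_unfold)
    let ?v = "Poly_Mapping.lookup p w *\<^sub>C letter_prod x (letters w)"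
    have "((\<lambda>FN. trunc_coeff (fst FN) (snd FN) (letters w) *\<^sub>R ?v) \<longlongrightarrow> 1 *\<^sub>R ?v) ?G"
      by (intro tendsto_scaleR c tendsto_const)
    then show "((\<lambda>FN. (complex_of_real (trunc_coeff (fst FN) (snd FN) (letters w)) * Poly_Mapping.lookup p w) *\<^sub>C letter_prod x (letters w))
      \<longlongrightarrow> ?v) ?G"
      by (simp add: scaleR_scaleC scaleC_scaleC)
  qed
  then show ?thesis by (simp add: trunc_def feval_letter_prod case_prod_unfold)
qed

text \<open>Contractivity carries the convergence from polynomials over to their closure. The
  condition on \<open>F\<close> is stated eventually so that it covers both all finite
  \<open>F\<close> and, for a finite family, the single set \<open>F = \<Lambda>\<close>.\<close>

theorem metric_approximation_of_weight_invariant: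
  assumes len: "weight_invariant \<phi> \<Lambda> x (\<lambda>_. 1)"
    and out: "\<forall>\<^sub>F F in finite_subsets_at_top \<Lambda>. weight_invariant \<phi> \<Lambda> x (\<lambda>l. if l \<in> F then 0 else 1)"
  shows "metric_approximation_property (closure (alg_gen (x ` \<Lambda>)))"
proof -
  let ?B = "closure (alg_gen (x ` \<Lambda>))" and ?G = "finite_subsets_at_top \<Lambda> \<times>\<^sub>F sequentially"
  define good where "good F N S \<longleftrightarrow> finite_rank_contraction ?B S \<and> (\<forall>p\<in>polys \<Lambda>. S (feval x p) = trunc x F N p)"
    for F N S
  \<comment> \<open>The choice is arbitrary where no suitable operator exists; eventually along the
    filter one does.\<close>
  define T where "T = (\<lambda>(F, N). SOME S. good F N S)"
  have "eventually (\<lambda>F. finite F \<and> F \<subseteq> \<Lambda>) (finite_subsets_at_top \<Lambda>)"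
    by (rule eventually_finite_subsets_at_top_weakI) simp
  with out have "eventually (\<lambda>F. weight_invariant \<phi> \<Lambda> x (\<lambda>l. if l \<in> F then 0 else 1) \<and> finite F \<and> F \<subseteq> \<Lambda>)
      (finite_subsets_at_top \<Lambda>)" by (rule eventually_conj)
  moreover have "eventually (\<lambda>N. N > 0) sequentially" by (rule eventually_gt_at_top)
  moreover have "good F N (T (F, N))"
    if "weight_invariant \<phi> \<Lambda> x (\<lambda>l. if l \<in> F then 0 else 1) \<and> finite F \<and> F \<subseteq> \<Lambda>" "N > 0" for F N
  proof -
    have "\<exists>S. good F N S" unfolding good_def using that truncation_operator[OF len, of F N] by blast
    then show ?thesis unfolding T_def by (simp add: someI_ex)
  qed
  ultimately have good: "eventually (\<lambda>(F, N). good F N (T (F, N))) ?G"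
    unfolding eventually_prod_filter case_prod_unfold
    by (intro exI[of _ "\<lambda>F. weight_invariant \<phi> \<Lambda> x (\<lambda>l. if l \<in> F then 0 else 1) \<and> finite F \<and> F \<subseteq> \<Lambda>"]
      exI[of _ "\<lambda>N. N > 0"]) simp
  have tend: "((\<lambda>FN. norm (T FN y - y)) \<longlongrightarrow> 0) ?G" if y: "y \<in> ?B" for y
  proof (rule tendstoI)
    fix e :: real assume "e > 0"
    then have "e / 3 > 0" by simp
    then have "\<exists>a\<in>alg_gen (x ` \<Lambda>). dist a y < e / 3"
      using y unfolding closure_approachable by blast
    then obtain p where p: "p \<in> polys \<Lambda>" "norm (y - feval x p) < e / 3"
      unfolding alg_gen_eq_feval by (auto simp: dist_norm norm_minus_commute)
    have "feval x p \<in> alg_gen (x ` \<Lambda>)" using p(1) by (simp add: alg_gen_eq_feval)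
    then have aB: "feval x p \<in> ?B" by (rule subsetD[OF closure_subset])
    have yB: "y - feval x p \<in> ?B"
    proof -
      obtain s where s: "\<And>n. s n \<in> alg_gen (x ` \<Lambda>)" "s \<longlonglongrightarrow> y" using y closure_sequential[of y "alg_gen (x ` \<Lambda>)"] by blast
      have "s n + (- 1) *\<^sub>C feval x p \<in> alg_gen (x ` \<Lambda>)" for n
        using s(1) p(1) by (intro alg_gen.add alg_gen.scale) (auto simp: alg_gen_eq_feval)
      moreover have "(\<lambda>n. s n + (- 1) *\<^sub>C feval x p) \<longlonglongrightarrow> y - feval x p"
        using tendsto_diff[OF s(2) tendsto_const[of "feval x p"]] by (simp add: scaleC_minus_left)
      ultimately show ?thesis
        unfolding closure_sequential by (intro exI[of _ "\<lambda>n. s n + (- 1) *\<^sub>C feval x p"]) simp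
    qed
    have "eventually (\<lambda>(F, N). dist (trunc x F N p) (feval x p) < e / 3) ?G"
      using tendstoD[OF trunc_tendsto[OF p(1), of x], of "e / 3"] \<open>e > 0\<close> by (simp add: case_prod_unfold)
    with good show "eventually (\<lambda>FN. dist (norm (T FN y - y)) 0 < e) ?G"
    proof eventually_elim
      case (elim FN)
      obtain F N where FN: "FN = (F, N)" by (cases FN)
      define S where "S = T FN"
      have S: "finite_rank_contraction ?B S" "S (feval x p) = trunc x F N p"
        using elim(1) p(1) by (auto simp: FN S_def good_def)
      have "S y = S (y - feval x p) + S (feval x p)"
        using S(1) yB aB unfolding finite_rank_contraction_def by (metis diff_add_cancel)
      then have "S y - y = S (y - feval x p) + (trunc x F N p - feval x p) - (y - feval x p)"
        by (simp add: S(2))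
      then have "norm (S y - y) \<le> norm (S (y - feval x p)) + norm (trunc x F N p - feval x p) + norm (y - feval x p)"
        using norm_triangle_ineq[of "S (y - feval x p)" "trunc x F N p - feval x p"]
          norm_triangle_ineq4[of "S (y - feval x p) + (trunc x F N p - feval x p)" "y - feval x p"] by simp
      moreover have "norm (S (y - feval x p)) \<le> norm (y - feval x p)"
        using S(1) yB unfolding finite_rank_contraction_def by blast
      ultimately show ?case using p(2) elim(2) by (simp add: FN S_def dist_norm)
    qed
  qed
  show ?thesis
    unfolding metric_approximation_property_def
  proof (intro exI[of _ "filtermap T ?G"] conjI ballI)
    show "filtermap T ?G \<noteq> bot" by (simp add: filtermap_bot_iff prod_filter_eq_bot)
    show "eventually (finite_rank_contraction ?B) (filtermap T ?G)"
      unfolding eventually_filtermap using good by eventually_elim (auto simp: good_def)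
    show "((\<lambda>S. norm (S y - y)) \<longlongrightarrow> 0) (filtermap T ?G)" if "y \<in> ?B" for y
      using tend[OF that] unfolding filterlim_filtermap .
  qed
qed

end

text \<open>The induction runs in the enlargement, where \<open>z\<close> lives. As \<iota>
  preserves traces of words, its result can be read back for \<open>x\<close>.\<close>

lemma weight_invariant_complexification:
  assumes fc: "free_complexification_invariant \<phi> \<Lambda> x \<psi> \<iota> z"
    and alt: "\<And>w. w \<in> star_words \<Lambda> \<Longrightarrow> alternating w \<Longrightarrow> weight (\<lambda>_. 1) w = 0 \<Longrightarrow>
      weight d w \<noteq> 0 \<Longrightarrow> \<phi> (word x w) = 0"
  shows "weight_invariant \<phi> \<Lambda> x d"
proof -
  let ?y = "\<lambda>l. \<iota> (x l)"
  have enl: "tracial_cstar_prob_space \<psi>" "unital_star_hom \<iota>" "\<And>a. \<psi> (\<iota> a) = \<phi> a"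
    and haar: "haar_unitary \<psi> z" and free: "star_free \<psi> {z} (\<iota> ` x ` \<Lambda>)"
    and same: "same_star_distribution \<Lambda> \<psi> (\<lambda>r. z * \<iota> (x r)) \<phi> x"
    using fc by (auto simp: free_complexification_invariant_def enlargement_def)
  have "word ?y w = \<iota> (word x w)" for w
    using enl(2) by (induction w) (auto simp: unital_star_hom_def)
  then have word: "\<psi> (word ?y w) = \<phi> (word x w)" for w by (simp add: enl(3))
  have "\<psi> (word (\<lambda>l. z * ?y l) w) = \<phi> (word x w)" if w: "w \<in> star_words \<Lambda>" for w
  proof -
    let ?i = "\<lambda>m. fst (w ! (m - 1))" and ?e = "\<lambda>m. snd (w ! (m - 1))"
    have "w ! (m - 1) \<in> \<Lambda> \<times> UNIV" if "m \<in> {1..length w}" for m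
      using w that by (auto simp: in_lists_conv_set)
    then have "?i \<in> {1..length w} \<rightarrow> \<Lambda>" by (simp add: mem_Times_iff)
    then have "\<psi> (star_word (\<lambda>l. z * ?y l) (length w) ?i ?e) = \<phi> (star_word x (length w) ?i ?e)"
      using same unfolding same_star_distribution_def by blast
    then show ?thesis by (simp only: star_word_conv_word map_nth_shift)
  qed
  moreover have "free_haar_unitary \<psi> z ?y \<Lambda>"
    using enl(1) haar free by unfold_locales (simp_all add: image_image)
  ultimately have "weight_invariant \<psi> \<Lambda> ?y d"
    using alt by (intro free_haar_unitary.weight_invariant_of_alternating) (simp_all add: word)
  then show ?thesis by (simp add: weight_invariant_def word)
qed

theorem theorem5p2:
  fixes \<phi> :: "'a::cstar_algebra \<Rightarrow> complex" and \<psi> :: "'m::cstar_algebra \<Rightarrow> complex"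
    and \<iota> :: "'a \<Rightarrow> 'm" and z :: 'm and \<Lambda> :: "'l set" and x :: "'l \<Rightarrow> 'a"
  assumes "tracial_cstar_prob_space \<phi>"
    and "free_complexification_invariant \<phi> \<Lambda> x \<psi> \<iota> z"
    and "H_plus_invariant \<phi> \<Lambda> x \<or>
      (\<exists>n\<ge>1. \<exists>e. bij_betw e ({1..n} \<times> {1..n}) \<Lambda> \<and> H_bi_invariant \<phi> n (\<lambda>r s. x (e (r, s))))"
  shows "metric_approximation_property (closure (alg_gen (x ` \<Lambda>)))"
proof -
  interpret tracial \<phi> by unfold_locales (rule assms(1))
  \<comment> \<open>For constant weight 1 the two conditions on the weight of an alternating word
    contradict each other.\<close>
  have len: "weight_invariant \<phi> \<Lambda> x (\<lambda>_. 1)"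
    by (rule weight_invariant_complexification[OF assms(2)]) simp
  have "\<forall>\<^sub>F F in finite_subsets_at_top \<Lambda>. weight_invariant \<phi> \<Lambda> x (\<lambda>l. if l \<in> F then 0 else 1)"
    using assms(3)
  proof
    assume H: "H_plus_invariant \<phi> \<Lambda> x"
    show ?thesis
      by (intro always_eventually allI weight_invariant_complexification[OF assms(2)] trace_alternating[OF H])
  next
    assume "\<exists>n\<ge>1. \<exists>e. bij_betw e ({1..n} \<times> {1..n}) \<Lambda> \<and> H_bi_invariant \<phi> n (\<lambda>r s. x (e (r, s)))"
    then have fin: "finite \<Lambda>" using bij_betw_finite by blast
    \<comment> \<open>When \<Lambda> is finite, \<open>F\<close> eventually equals it. No letter
      then lies outside \<open>F\<close>, and every word over \<Lambda> has weight 0.\<close>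
    have "weight_invariant \<phi> \<Lambda> x (\<lambda>l. if l \<in> \<Lambda> then 0 else 1)"
    proof -
      have "weight (\<lambda>l. if l \<in> \<Lambda> then 0 else 1) w = 0" if "w \<in> star_words \<Lambda>" for w
        using that by (induction w) auto
      then show ?thesis by (simp add: weight_invariant_def)
    qed
    then show ?thesis
      unfolding eventually_finite_subsets_at_top using fin by (intro exI[of _ \<Lambda>]) (auto dest: subset_antisym)
  qed
  then show ?thesis by (rule metric_approximation_of_weight_invariant[OF len])
qed

end
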